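(* Let $A$ be a finite-dimensional Hopf algebra over an algebraically closed field $\mathbb{F}$, let $d:=\dim_{\mathbb{F}} A$, let $\ell+1$ be the number of isomorphism classes of simple $A$-modules, and let $\gamma$ be the greatest common divisor of the dimensions of the indecomposable projective $A$-modules. Consider the critical group $K(A)$ of the left-regular $A$-module $A$. If $\ell=0$ then $K(A)=0$; otherwise $$K(A)\cong \mathbb{Z}/\gamma\mathbb{Z}\ \oplus\ (\mathbb{Z}/d\mathbb{Z})^{\ell-1}.$$
   Context: All modules are finite-dimensional left $A$-modules; the tensor product $V\otimes W$ (over $\mathbb{F}$) of $A$-modules is an $A$-module via the coproduct, $a(v\otimes w)=\sum a_1v\otimes a_2w$ where $\Delta(a)=\sum a_1\otimes a_2$. The Grothendieck group $G_0(A)$ is the free abelian group on isomorphism classes $[V]$ of $A$-modules modulo $[U]-[V]+[W]$ for every short exact sequence $0\to U\to V\to W\to 0$; it is a ring with $[V]\cdot[W]=[V\otimes W]$, unit the class of the trivial module, and augmentation ring map $G_0(A)\to\mathbb{Z}$, $[V]\mapsto\dim V$, whose kernel is the augmentation ideal $I$. For an $A$-module $V$ of dimension $n$, its critical group is the abelian group $K(V):=I/G_0(A)\,(n-[V])$, the quotient of $I$ by the principal left ideal generated by $n-[V]$. *)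

theory Defs
  imports "Jordan_Normal_Form.Matrix"
          "HOL-Algebra.Free_Abelian_Groups"
          "HOL-Algebra.Elementary_Groups"
          "HOL-Algebra.Product_Groups"
          "HOL-Computational_Algebra.Polynomial"
begin

text \<open>A finite-dimensional Hopf algebra A over a field 'k is given by a basis
  e_0, ..., e_{d-1} (d = hdim) and structure constants:
  e_i e_j = sum_k hmu i j k e_k;   1 = sum_k hunit k e_k;
  Delta(e_k) = sum_{i,j} hdelta k i j (e_i (x) e_j);   eps(e_k) = hcounit k;
  S(e_k) = sum_l hanti k l e_l.\<close>

record 'k hopf =
  hdim    :: nat
  hmu     :: "nat \<Rightarrow> nat \<Rightarrow> nat \<Rightarrow> 'k"
  hunit   :: "nat \<Rightarrow> 'k"
  hdelta  :: "nat \<Rightarrow> nat \<Rightarrow> nat \<Rightarrow> 'k"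
  hcounit :: "nat \<Rightarrow> 'k"
  hanti   :: "nat \<Rightarrow> nat \<Rightarrow> 'k"

definition hopf_algebra :: "'k::field hopf \<Rightarrow> bool" where
  "hopf_algebra H \<longleftrightarrow>
    (let d = hdim H; mu = hmu H; u = hunit H; de = hdelta H; eps = hcounit H; s = hanti H in
     \<comment> \<open>associativity\<close>
     (\<forall>i<d. \<forall>j<d. \<forall>l<d. \<forall>m<d.
        (\<Sum>k<d. mu i j k * mu k l m) = (\<Sum>k<d. mu j l k * mu i k m)) \<and>
     \<comment> \<open>unit\<close>
     (\<forall>j<d. \<forall>k<d. (\<Sum>i<d. u i * mu i j k) = (if j = k then 1 else 0)) \<and>
     (\<forall>j<d. \<forall>k<d. (\<Sum>i<d. u i * mu j i k) = (if j = k then 1 else 0)) \<and>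
     \<comment> \<open>coassociativity\<close>
     (\<forall>m<d. \<forall>a<d. \<forall>b<d. \<forall>c<d.
        (\<Sum>k<d. de m k c * de k a b) = (\<Sum>k<d. de m a k * de k b c)) \<and>
     \<comment> \<open>counit\<close>
     (\<forall>m<d. \<forall>j<d. (\<Sum>i<d. eps i * de m i j) = (if m = j then 1 else 0)) \<and>
     (\<forall>m<d. \<forall>i<d. (\<Sum>j<d. eps j * de m i j) = (if m = i then 1 else 0)) \<and>
     \<comment> \<open>comultiplication is an algebra map\<close>
     (\<forall>i<d. \<forall>j<d. \<forall>a<d. \<forall>b<d.
        (\<Sum>k<d. mu i j k * de k a b) =
        (\<Sum>p<d. \<Sum>q<d. \<Sum>r<d. \<Sum>t<d. de i p q * de j r t * mu p r a * mu q t b)) \<and>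
     (\<forall>a<d. \<forall>b<d. (\<Sum>k<d. u k * de k a b) = u a * u b) \<and>
     \<comment> \<open>counit is an algebra map\<close>
     (\<forall>i<d. \<forall>j<d. (\<Sum>k<d. mu i j k * eps k) = eps i * eps j) \<and>
     (\<Sum>k<d. u k * eps k) = 1 \<and>
     \<comment> \<open>antipode\<close>
     (\<forall>k<d. \<forall>m<d.
        (\<Sum>i<d. \<Sum>j<d. \<Sum>l<d. de k i j * s i l * mu l j m) = eps k * u m) \<and>
     (\<forall>k<d. \<forall>m<d.
        (\<Sum>i<d. \<Sum>j<d. \<Sum>l<d. de k i j * s j l * mu i l m) = eps k * u m))"

definition alg_closed_field :: "'k::field itself \<Rightarrow> bool" where
  "alg_closed_field _ \<longleftrightarrow> (\<forall>p::'k poly. degree p > 0 \<longrightarrow> (\<exists>x. poly p x = 0))"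

text \<open>A module of dimension n is a pair (n, rho) where rho i is the n x n matrix
  by which the basis element e_i acts on 'k^n.\<close>

type_synonym 'k rep = "nat \<times> (nat \<Rightarrow> 'k mat)"

definition is_module :: "'k::field hopf \<Rightarrow> 'k rep \<Rightarrow> bool" where
  "is_module H M \<longleftrightarrow>
    (let n = fst M; \<rho> = snd M; d = hdim H in
      (\<forall>i<d. \<rho> i \<in> carrier_mat n n) \<and>
      (\<forall>i<d. \<forall>j<d. \<rho> i * \<rho> j = mat n n (\<lambda>(r,c). \<Sum>k<d. hmu H i j k * \<rho> k $$ (r,c))) \<and>
      mat n n (\<lambda>(r,c). \<Sum>k<d. hunit H k * \<rho> k $$ (r,c)) = 1\<^sub>m n)"

definition mod_hom :: "'k::field hopf \<Rightarrow> 'k rep \<Rightarrow> 'k rep \<Rightarrow> 'k mat \<Rightarrow> bool" where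
  "mod_hom H M N f \<longleftrightarrow> f \<in> carrier_mat (fst N) (fst M) \<and>
     (\<forall>i<hdim H. f * snd M i = snd N i * f)"

definition mod_iso :: "'k::field hopf \<Rightarrow> 'k rep \<Rightarrow> 'k rep \<Rightarrow> bool" where
  "mod_iso H M N \<longleftrightarrow> (\<exists>f g. mod_hom H M N f \<and> g \<in> carrier_mat (fst M) (fst N) \<and>
      f * g = 1\<^sub>m (fst N) \<and> g * f = 1\<^sub>m (fst M))"

definition iso_class :: "'k::field hopf \<Rightarrow> 'k rep \<Rightarrow> 'k rep set" where
  "iso_class H M = {N. is_module H N \<and> mod_iso H M N}"

definition mod_classes :: "'k::field hopf \<Rightarrow> 'k rep set set" where
  "mod_classes H = {iso_class H M | M. is_module H M}"

definition class_dim :: "'k rep set \<Rightarrow> nat" where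
  "class_dim C = fst (SOME M. M \<in> C)"

definition inv_subspace :: "'k::field hopf \<Rightarrow> 'k rep \<Rightarrow> 'k vec set \<Rightarrow> bool" where
  "inv_subspace H M W \<longleftrightarrow> W \<subseteq> carrier_vec (fst M) \<and> 0\<^sub>v (fst M) \<in> W \<and>
     (\<forall>x\<in>W. \<forall>y\<in>W. x + y \<in> W) \<and> (\<forall>c. \<forall>x\<in>W. c \<cdot>\<^sub>v x \<in> W) \<and>
     (\<forall>i<hdim H. \<forall>x\<in>W. snd M i *\<^sub>v x \<in> W)"

definition simple_mod :: "'k::field hopf \<Rightarrow> 'k rep \<Rightarrow> bool" where
  "simple_mod H M \<longleftrightarrow> is_module H M \<and> fst M > 0 \<and>
     (\<forall>W. inv_subspace H M W \<longrightarrow> W = {0\<^sub>v (fst M)} \<or> W = carrier_vec (fst M))"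

definition indecomposable_mod :: "'k::field hopf \<Rightarrow> 'k rep \<Rightarrow> bool" where
  "indecomposable_mod H M \<longleftrightarrow> is_module H M \<and> fst M > 0 \<and>
     (\<forall>W1 W2. inv_subspace H M W1 \<longrightarrow> inv_subspace H M W2 \<longrightarrow>
        W1 \<inter> W2 = {0\<^sub>v (fst M)} \<longrightarrow>
        (\<forall>x\<in>carrier_vec (fst M). \<exists>a\<in>W1. \<exists>b\<in>W2. x = a + b) \<longrightarrow>
        W1 = {0\<^sub>v (fst M)} \<or> W2 = {0\<^sub>v (fst M)})"

definition surj_mat :: "'k::field mat \<Rightarrow> bool" where
  "surj_mat g \<longleftrightarrow> (\<forall>w\<in>carrier_vec (dim_row g). \<exists>v\<in>carrier_vec (dim_col g). g *\<^sub>v v = w)"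

definition projective_mod :: "'k::field hopf \<Rightarrow> 'k rep \<Rightarrow> bool" where
  "projective_mod H P \<longleftrightarrow> is_module H P \<and>
     (\<forall>V W g h. is_module H V \<longrightarrow> is_module H W \<longrightarrow> mod_hom H V W g \<longrightarrow> surj_mat g \<longrightarrow>
        mod_hom H P W h \<longrightarrow> (\<exists>k. mod_hom H P V k \<and> g * k = h))"

definition short_exact :: "'k::field hopf \<Rightarrow> 'k rep \<Rightarrow> 'k rep \<Rightarrow> 'k rep \<Rightarrow> bool" where
  "short_exact H U V W \<longleftrightarrow> is_module H U \<and> is_module H V \<and> is_module H W \<and>
     (\<exists>f g. mod_hom H U V f \<and> mod_hom H V W g \<and>
        (\<forall>x\<in>carrier_vec (fst U). f *\<^sub>v x = 0\<^sub>v (fst V) \<longrightarrow> x = 0\<^sub>v (fst U)) \<and>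
        surj_mat g \<and>
        (\<forall>y\<in>carrier_vec (fst V). g *\<^sub>v y = 0\<^sub>v (fst W) \<longleftrightarrow> (\<exists>x\<in>carrier_vec (fst U). f *\<^sub>v x = y)))"

text \<open>Basis vector (a,b) of V (x) W, with dim W = m, has index a*m+b.\<close>
definition tensor_mod :: "'k::field hopf \<Rightarrow> 'k rep \<Rightarrow> 'k rep \<Rightarrow> 'k rep" where
  "tensor_mod H V W = (let n = fst V; m = fst W; d = hdim H in
     (n * m, \<lambda>k. mat (n * m) (n * m) (\<lambda>(r,c).
        \<Sum>i<d. \<Sum>j<d. hdelta H k i j * (snd V i $$ (r div m, c div m)) * (snd W j $$ (r mod m, c mod m)))))"

definition trivial_mod :: "'k::field hopf \<Rightarrow> 'k rep" where
  "trivial_mod H = (1, \<lambda>i. mat 1 1 (\<lambda>_. hcounit H i))"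

definition regular_mod :: "'k::field hopf \<Rightarrow> 'k rep" where
  "regular_mod H = (hdim H, \<lambda>i. mat (hdim H) (hdim H) (\<lambda>(k,j). hmu H i j k))"

definition G0_free :: "'k::field hopf \<Rightarrow> ('k rep set \<Rightarrow>\<^sub>0 int) monoid" where
  "G0_free H = free_Abelian_group (mod_classes H)"

definition G0_rels :: "'k::field hopf \<Rightarrow> ('k rep set \<Rightarrow>\<^sub>0 int) set" where
  "G0_rels H = generate (G0_free H)
     {frag_of (iso_class H U) - frag_of (iso_class H V) + frag_of (iso_class H W) | U V W.
        short_exact H U V W}"

definition G0 :: "'k::field hopf \<Rightarrow> ('k rep set \<Rightarrow>\<^sub>0 int) set monoid" where
  "G0 H = G0_free H Mod G0_rels H"

definition G0_class :: "'k::field hopf \<Rightarrow> 'k rep \<Rightarrow> ('k rep set \<Rightarrow>\<^sub>0 int) set" where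
  "G0_class H M = r_coset (G0_free H) (G0_rels H) (frag_of (iso_class H M))"

definition class_tensor :: "'k::field hopf \<Rightarrow> 'k rep set \<Rightarrow> 'k rep set \<Rightarrow> 'k rep set" where
  "class_tensor H C C' = iso_class H (tensor_mod H (SOME M. M \<in> C) (SOME N. N \<in> C'))"

definition frag_tensor :: "'k::field hopf \<Rightarrow> ('k rep set \<Rightarrow>\<^sub>0 int) \<Rightarrow> ('k rep set \<Rightarrow>\<^sub>0 int) \<Rightarrow> ('k rep set \<Rightarrow>\<^sub>0 int)" where
  "frag_tensor H a b = (\<Sum>C\<in>Poly_Mapping.keys a. \<Sum>C'\<in>Poly_Mapping.keys b.
      frag_cmul (poly_mapping.lookup a C * poly_mapping.lookup b C') (frag_of (class_tensor H C C')))"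

definition G0_mult :: "'k::field hopf \<Rightarrow> ('k rep set \<Rightarrow>\<^sub>0 int) set \<Rightarrow> ('k rep set \<Rightarrow>\<^sub>0 int) set \<Rightarrow> ('k rep set \<Rightarrow>\<^sub>0 int) set" where
  "G0_mult H X Y = r_coset (G0_free H) (G0_rels H) (frag_tensor H (SOME x. x \<in> X) (SOME y. y \<in> Y))"

definition frag_aug :: "('k rep set \<Rightarrow>\<^sub>0 int) \<Rightarrow> int" where
  "frag_aug a = (\<Sum>C\<in>Poly_Mapping.keys a. poly_mapping.lookup a C * int (class_dim C))"

definition G0_aug :: "('k rep set \<Rightarrow>\<^sub>0 int) set \<Rightarrow> int" where
  "G0_aug X = frag_aug (SOME x. x \<in> X)"

definition aug_ideal :: "'k::field hopf \<Rightarrow> ('k rep set \<Rightarrow>\<^sub>0 int) set set" where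
  "aug_ideal H = {X \<in> carrier (G0 H). G0_aug X = 0}"

text \<open>K(V) = I / G_0(A) (n - [V]), n = dim V, where n denotes n times the unit [trivial].\<close>
definition critical_group :: "'k::field hopf \<Rightarrow> 'k rep \<Rightarrow> ('k rep set \<Rightarrow>\<^sub>0 int) set set monoid" where
  "critical_group H V =
     (let D = r_coset (G0_free H) (G0_rels H)
                (frag_cmul (int (fst V)) (frag_of (iso_class H (trivial_mod H))) - frag_of (iso_class H V))
      in ((G0 H)\<lparr>carrier := aug_ideal H\<rparr>) Mod {G0_mult H X D | X. X \<in> carrier (G0 H)})"

end

theory Submission
  imports Defs "Jordan_Normal_Form.Char_Poly"
begin

text \<open>In \<open>G\<^sub>0(A)\<close> one has \<open>[V] [A] = dim V [A]\<close>, because \<open>V \<otimes> A\<close> is a sum of \<open>dim V\<close> copies of \<open>A\<close>. Hence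
  \<open>G\<^sub>0(A) (d - [A])\<close> consists of the elements \<open>d x - dim(x) [A]\<close>. In the basis of simple modules
  \<open>S\<^sub>0, \<dots>, S\<^sub>l\<close>, with \<open>S\<^sub>0\<close> trivial, dropping the coordinate of \<open>S\<^sub>0\<close> identifies the augmentation
  ideal with \<open>\<int>\<^sup>l\<close> and the relations with \<open>d \<int>\<^sup>l + \<int> (a\<^sub>1, \<dots>, a\<^sub>l)\<close>, where \<open>a\<^sub>j = [A : S\<^sub>j]\<close>; a unimodular
  change of basis and \<open>\<Sum>\<^sub>j a\<^sub>j dim S\<^sub>j = d\<close> give \<open>\<int>/gcd(a) \<oplus> (\<int>/d)\<^bsup>l-1\<^esup>\<close>.

  If \<open>e\<close> is a primitive idempotent with \<open>e S\<^sub>i \<noteq> 0\<close>, then \<open>[M : S\<^sub>i] = dim e M\<close> and \<open>A e\<close> is the projective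
  cover of \<open>S\<^sub>i\<close>. So \<open>a\<^sub>i = dim e A\<close>, whereas \<open>\<gamma>\<close> is formed from the numbers \<open>dim A e\<close>. The two agree because
  \<open>A\<close> is a Frobenius algebra: a nonzero integral \<open>\<lambda>\<close> in the dual makes \<open>\<lambda>(x y)\<close> nondegenerate
  (Larson and Sweedler). The same argument shows that the antipode is bijective, which the
  isomorphism \<open>V \<otimes> A \<cong> A\<^bsup>dim V\<^esup>\<close> needs.\<close>

subsection \<open>Hopf algebra identities\<close>

text \<open>Coordinates on G_0(A) come from additive functions. The rank of a fixed idempotent
  \<open>e_j\<close> on a module is additive along short exact sequences, hence vanishes on the
  relations, and on the simple modules these ranks form the dual basis. Algebraic closedness enters
  here: it makes Hom(P_j, S_j) one-dimensional, so that \<open>e_j\<close> has rank 1 on S_j.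

  Modules are tuples of matrices, so submodules, quotients and summands are handled as pairs of
  matrices f, f' with f' f = 1. Simple quotients and indecomposable projectives are found by
  minimality of dimension, and Fitting's lemma carries the uniqueness arguments for projective
  covers.

  The modulus gamma is the gcd of all a_0, ..., a_l, whereas the change of basis sends (a_1, ...,
  a_l) to (g, 0, ..., 0), with g their gcd up to sign, and produces gcd(d, g). The two agree because
  the trivial module has dimension 1, so that a_0 = d - (a_1 dim S_1 + ... + a_l dim S_l).\<close>

locale hopf_alg =
  fixes H :: "'k::field hopf"
  assumes hopf: "hopf_algebra H"
begin

lemmas ax0 = hopf[unfolded hopf_algebra_def Let_def]
lemmas ax1 = ax0[THEN conjunct2]
lemmas ax2 = ax1[THEN conjunct2]
lemmas ax3 = ax2[THEN conjunct2]
lemmas ax4 = ax3[THEN conjunct2]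
lemmas ax5 = ax4[THEN conjunct2]
lemmas ax6 = ax5[THEN conjunct2]
lemmas ax7 = ax6[THEN conjunct2]
lemmas ax8 = ax7[THEN conjunct2]
lemmas ax9 = ax8[THEN conjunct2]
lemmas ax10 = ax9[THEN conjunct2]
lemmas ax11 = ax10[THEN conjunct2]
lemmas ax_assoc = ax0[THEN conjunct1, rule_format]
lemmas ax_unitl = ax1[THEN conjunct1, rule_format]
lemmas ax_unitr = ax2[THEN conjunct1, rule_format]
lemmas ax_coassoc = ax3[THEN conjunct1, rule_format]
lemmas ax_counitl = ax4[THEN conjunct1, rule_format]
lemmas ax_counitr = ax5[THEN conjunct1, rule_format]
lemmas ax_mul_cop = ax6[THEN conjunct1, rule_format]
lemmas ax_un_cop = ax7[THEN conjunct1, rule_format]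
lemmas ax_mul_eps = ax8[THEN conjunct1, rule_format]
lemmas ax_un_eps = ax9[THEN conjunct1, rule_format]
lemmas ax_antl = ax10[THEN conjunct1, rule_format]
lemmas ax_antr = ax11[rule_format]

abbreviation d :: nat where "d \<equiv> hdim H"

abbreviation eps :: "nat \<Rightarrow> 'k" where "eps \<equiv> hcounit H"

text \<open>Sweedler calculus with continuations: \<open>F\<close> stands for the (multi)linear form with the given values
  on basis vectors, and \<open>mul i j F\<close>, \<open>cop k F\<close>, \<open>ant k F\<close>, \<open>un F\<close> are its values on \<open>e\<^sub>i e\<^sub>j\<close>, on
  \<open>\<Delta>(e\<^sub>k)\<close>, on \<open>S(e\<^sub>k)\<close> and on \<open>1\<close>.\<close>
definition mul :: "nat \<Rightarrow> nat \<Rightarrow> (nat \<Rightarrow> 'k) \<Rightarrow> 'k" where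
  "mul i j F = (\<Sum>k<d. hmu H i j k * F k)"

definition cop :: "nat \<Rightarrow> (nat \<Rightarrow> nat \<Rightarrow> 'k) \<Rightarrow> 'k" where
  "cop k F = (\<Sum>i<d. \<Sum>j<d. hdelta H k i j * F i j)"

definition ant :: "nat \<Rightarrow> (nat \<Rightarrow> 'k) \<Rightarrow> 'k" where
  "ant k F = (\<Sum>l<d. hanti H k l * F l)"

definition un :: "(nat \<Rightarrow> 'k) \<Rightarrow> 'k" where
  "un F = (\<Sum>k<d. hunit H k * F k)"

lemma mul_cong [cong]: "i = i' \<Longrightarrow> j = j' \<Longrightarrow> (\<And>k. k < d \<Longrightarrow> F k = G k) \<Longrightarrow> mul i j F = mul i' j' G"
  by (simp add: mul_def)

lemma cop_cong [cong]: "k = k' \<Longrightarrow> (\<And>i j. i < d \<Longrightarrow> j < d \<Longrightarrow> F i j = G i j) \<Longrightarrow> cop k F = cop k' G"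
  by (simp add: cop_def)

lemma ant_cong [cong]: "k = k' \<Longrightarrow> (\<And>l. l < d \<Longrightarrow> F l = G l) \<Longrightarrow> ant k F = ant k' G"
  by (simp add: ant_def)

lemma un_cong [cong]: "(\<And>l. l < d \<Longrightarrow> F l = G l) \<Longrightarrow> un F = un G"
  by (simp add: un_def)

section \<open>Linearity of the continuation operators and their interchange\<close>

lemma mul_scale: "mul i j (\<lambda>x. c * F x) = c * mul i j F" "mul i j (\<lambda>x. F x * c) = mul i j F * c"
  by (simp_all add: mul_def sum_distrib_left sum_distrib_right mult_ac)

lemma cop_scale: "cop i (\<lambda>x y. c * F2 x y) = c * cop i F2" "cop i (\<lambda>x y. F2 x y * c) = cop i F2 * c"
  by (simp_all add: cop_def sum_distrib_left sum_distrib_right mult_ac)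

lemma ant_scale: "ant i (\<lambda>x. c * F x) = c * ant i F" "ant i (\<lambda>x. F x * c) = ant i F * c"
  by (simp_all add: ant_def sum_distrib_left sum_distrib_right mult_ac)

lemma un_scale: "un (\<lambda>x. c * F x) = c * un F" "un (\<lambda>x. F x * c) = un F * c"
  by (simp_all add: un_def sum_distrib_left sum_distrib_right mult_ac)

lemma mul_sum: "mul i j (\<lambda>x. \<Sum>a\<in>A. F a x) = (\<Sum>a\<in>A. mul i j (F a))"
  by (simp add: mul_def sum_distrib_left) (rule sum.swap)

lemma ant_sum: "ant i (\<lambda>x. \<Sum>a\<in>A. F a x) = (\<Sum>a\<in>A. ant i (F a))"
  by (simp add: ant_def sum_distrib_left) (rule sum.swap)

lemma cop_sum: "cop i (\<lambda>x y. \<Sum>a\<in>A. F a x y) = (\<Sum>a\<in>A. cop i (F a))"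
proof -
  have "cop i (\<lambda>x y. \<Sum>a\<in>A. F a x y) = (\<Sum>x<d. \<Sum>a\<in>A. \<Sum>y<d. hdelta H i x y * F a x y)"
    unfolding cop_def sum_distrib_left by (intro sum.cong refl) (rule sum.swap)
  also have "\<dots> = (\<Sum>a\<in>A. cop i (F a))"
    unfolding cop_def by (rule sum.swap)
  finally show ?thesis .
qed

lemma mul_ant: "mul i j (\<lambda>x. ant k (\<lambda>y. F x y)) = ant k (\<lambda>y. mul i j (\<lambda>x. F x y))"
  unfolding ant_def[of k] by (simp add: mul_sum mul_scale)

lemma cop_ant: "cop i (\<lambda>x x'. ant k (\<lambda>y. F2 x x' y)) = ant k (\<lambda>y. cop i (\<lambda>x x'. F2 x x' y))"
  unfolding ant_def[of k] by (simp add: cop_sum cop_scale)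

lemma cop_mul: "cop i (\<lambda>x x'. mul k l (\<lambda>y. F2 x x' y)) = mul k l (\<lambda>y. cop i (\<lambda>x x'. F2 x x' y))"
  unfolding mul_def[of k l] by (simp add: cop_sum cop_scale)

lemma mul_mul: "mul i j (\<lambda>x. mul k l (\<lambda>y. F x y)) = mul k l (\<lambda>y. mul i j (\<lambda>x. F x y))"
  unfolding mul_def[of i j] by (simp add: mul_sum mul_scale)

lemma ant_ant: "ant i (\<lambda>x. ant k (\<lambda>y. F x y)) = ant k (\<lambda>y. ant i (\<lambda>x. F x y))"
  unfolding ant_def[of i] by (simp add: ant_sum ant_scale)

lemma mul_un: "mul i j (\<lambda>x. un (\<lambda>y. F x y)) = un (\<lambda>y. mul i j (\<lambda>x. F x y))"
  unfolding un_def by (simp add: mul_sum mul_scale)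

lemma ant_un: "ant i (\<lambda>x. un (\<lambda>y. F x y)) = un (\<lambda>y. ant i (\<lambda>x. F x y))"
  unfolding un_def by (simp add: ant_sum ant_scale)

lemma cop_cop: "cop i (\<lambda>x x'. cop j (\<lambda>y y'. F x x' y y')) = cop j (\<lambda>y y'. cop i (\<lambda>x x'. F x x' y y'))"
  unfolding cop_def[of i] by (simp add: cop_sum cop_scale)

section \<open>Bialgebra and antipode axioms in Sweedler form\<close>

lemma mul_assoc:
  assumes "i < d" "j < d" "l < d"
  shows "mul i j (\<lambda>k. mul k l F) = mul j l (\<lambda>k. mul i k F)"
proof -
  have "mul i j (\<lambda>k. mul k l F) = (\<Sum>m<d. (\<Sum>k<d. hmu H i j k * hmu H k l m) * F m)"
    unfolding mul_def sum_distrib_left sum_distrib_right by (subst sum.swap) (simp add: mult_ac)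
  also have "\<dots> = (\<Sum>m<d. (\<Sum>k<d. hmu H j l k * hmu H i k m) * F m)"
    by (intro sum.cong refl arg_cong2[where f = times] ax_assoc) (use assms  in auto)
  also have "\<dots> = mul j l (\<lambda>k. mul i k F)"
    unfolding mul_def sum_distrib_left sum_distrib_right by (subst sum.swap) (simp add: mult_ac)
  finally show ?thesis .
qed

lemma sum_delta: "j < (n::nat) \<Longrightarrow> (\<Sum>k<n. (if j = k then 1 else 0) * F k) = (F j :: 'k)"
  by (simp add: if_distrib[of "\<lambda>x. x * _"] sum.delta' cong: if_cong)

lemma un_mul_left: "j < d \<Longrightarrow> un (\<lambda>i. mul i j F) = F j"
proof -
  assume j: "j < d"
  have "un (\<lambda>i. mul i j F) = (\<Sum>m<d. (\<Sum>k<d. hunit H k * hmu H k j m) * F m)"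
    unfolding mul_def un_def sum_distrib_left sum_distrib_right by (subst sum.swap) (simp add: mult_ac)
  also have "\<dots> = (\<Sum>m<d. (if j = m then 1 else 0) * F m)"
    by (intro sum.cong refl arg_cong2[where f = times] ax_unitl) (use j  in auto)
  finally show ?thesis using j by (simp only: sum_delta)
qed

lemma un_mul_right: "j < d \<Longrightarrow> un (\<lambda>i. mul j i F) = F j"
proof -
  assume j: "j < d"
  have "un (\<lambda>i. mul j i F) = (\<Sum>m<d. (\<Sum>k<d. hunit H k * hmu H j k m) * F m)"
    unfolding mul_def un_def sum_distrib_left sum_distrib_right by (subst sum.swap) (simp add: mult_ac)
  also have "\<dots> = (\<Sum>m<d. (if j = m then 1 else 0) * F m)"
    by (intro sum.cong refl arg_cong2[where f = times] ax_unitr) (use j  in auto)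
  finally show ?thesis using j by (simp only: sum_delta)
qed

lemma cop_alt: "cop m (\<lambda>k c. F k c) = (\<Sum>c<d. \<Sum>k<d. hdelta H m k c * F k c)"
  unfolding cop_def by (rule sum.swap)

lemma cop_coassoc:
  assumes "m < d"
  shows "cop m (\<lambda>k c. cop k (\<lambda>a b. F a b c)) = cop m (\<lambda>a k. cop k (\<lambda>b c. F a b c))"
proof -
  have "cop m (\<lambda>k c. cop k (\<lambda>a b. F a b c)) = (\<Sum>c<d. \<Sum>k<d. \<Sum>a<d. \<Sum>b<d. hdelta H m k c * hdelta H k a b * F a b c)"
    unfolding cop_alt[of m] by (simp add: cop_def sum_distrib_left mult_ac)
  also have "\<dots> = (\<Sum>c<d. \<Sum>a<d. \<Sum>k<d. \<Sum>b<d. hdelta H m k c * hdelta H k a b * F a b c)"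
    by (rule sum.cong[OF refl], rule sum.swap)
  also have "\<dots> = (\<Sum>c<d. \<Sum>a<d. \<Sum>b<d. \<Sum>k<d. hdelta H m k c * hdelta H k a b * F a b c)"
    by (rule sum.cong[OF refl], rule sum.cong[OF refl], rule sum.swap)
  also have "\<dots> = (\<Sum>c<d. \<Sum>a<d. \<Sum>b<d. (\<Sum>k<d. hdelta H m k c * hdelta H k a b) * F a b c)"
    by (simp add: sum_distrib_right)
  also have "\<dots> = (\<Sum>c<d. \<Sum>a<d. \<Sum>b<d. (\<Sum>k<d. hdelta H m a k * hdelta H k b c) * F a b c)"
    by (intro sum.cong refl arg_cong2[where f = times] ax_coassoc) (use assms  in auto)
  also have "\<dots> = (\<Sum>a<d. \<Sum>c<d. \<Sum>b<d. \<Sum>k<d. hdelta H m a k * hdelta H k b c * F a b c)"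
    by (subst sum.swap) (simp add: sum_distrib_right)
  also have "\<dots> = (\<Sum>a<d. \<Sum>b<d. \<Sum>c<d. \<Sum>k<d. hdelta H m a k * hdelta H k b c * F a b c)"
    by (rule sum.cong[OF refl], rule sum.swap)
  also have "\<dots> = (\<Sum>a<d. \<Sum>b<d. \<Sum>k<d. \<Sum>c<d. hdelta H m a k * hdelta H k b c * F a b c)"
    by (rule sum.cong[OF refl], rule sum.cong[OF refl], rule sum.swap)
  also have "\<dots> = (\<Sum>a<d. \<Sum>k<d. \<Sum>b<d. \<Sum>c<d. hdelta H m a k * hdelta H k b c * F a b c)"
    by (rule sum.cong[OF refl], rule sum.swap)
  also have "\<dots> = cop m (\<lambda>a k. cop k (\<lambda>b c. F a b c))"
    by (simp add: cop_def sum_distrib_left mult_ac)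
  finally show ?thesis .
qed

lemma cop_eps_left: "m < d \<Longrightarrow> cop m (\<lambda>i j. eps i * F j) = F m"
proof -
  assume m: "m < d"
  have "cop m (\<lambda>i j. eps i * F j) = (\<Sum>j<d. (\<Sum>i<d. eps i * hdelta H m i j) * F j)"
    unfolding cop_alt by (simp add: sum_distrib_right sum_distrib_left mult_ac)
  also have "\<dots> = (\<Sum>j<d. (if m = j then 1 else 0) * F j)"
    by (intro sum.cong refl arg_cong2[where f = times] ax_counitl) (use m  in auto)
  finally show ?thesis using m by (simp only: sum_delta)
qed

lemma cop_eps_right: "m < d \<Longrightarrow> cop m (\<lambda>i j. eps j * F i) = F m"
proof -
  assume m: "m < d"
  have "cop m (\<lambda>i j. eps j * F i) = (\<Sum>i<d. (\<Sum>j<d. eps j * hdelta H m i j) * F i)"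
    unfolding cop_def by (simp add: sum_distrib_right sum_distrib_left mult_ac)
  also have "\<dots> = (\<Sum>j<d. (if m = j then 1 else 0) * F j)"
    by (intro sum.cong refl arg_cong2[where f = times] ax_counitr) (use m  in auto)
  finally show ?thesis using m by (simp only: sum_delta)
qed

lemma mul_cop:
  assumes "i < d" "j < d"
  shows "mul i j (\<lambda>k. cop k F) = cop i (\<lambda>p q. cop j (\<lambda>r t. mul p r (\<lambda>a. mul q t (\<lambda>b. F a b))))"
proof -
  have "mul i j (\<lambda>k. cop k F) = (\<Sum>a<d. \<Sum>k<d. \<Sum>b<d. hmu H i j k * hdelta H k a b * F a b)"
    unfolding mul_def cop_def sum_distrib_left by (subst sum.swap) (simp add: mult_ac)
  also have "\<dots> = (\<Sum>a<d. \<Sum>b<d. \<Sum>k<d. hmu H i j k * hdelta H k a b * F a b)"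
    by (rule sum.cong[OF refl], rule sum.swap)
  also have "\<dots> = (\<Sum>a<d. \<Sum>b<d. (\<Sum>k<d. hmu H i j k * hdelta H k a b) * F a b)"
    by (simp add: sum_distrib_right)
  also have "\<dots> = (\<Sum>a<d. \<Sum>b<d. (\<Sum>p<d. \<Sum>q<d. \<Sum>r<d. \<Sum>t<d. hdelta H i p q * hdelta H j r t * hmu H p r a * hmu H q t b) * F a b)"
    by (intro sum.cong refl arg_cong2[where f = times] ax_mul_cop) (use assms  in auto)
  also have "\<dots> = (\<Sum>a<d. \<Sum>b<d. cop i (\<lambda>p q. cop j (\<lambda>r t. hmu H p r a * hmu H q t b)) * F a b)"
    by (simp add: cop_def sum_distrib_left mult_ac)
  also have "\<dots> = (\<Sum>a<d. \<Sum>b<d. cop i (\<lambda>p q. cop j (\<lambda>r t. hmu H p r a * (hmu H q t b * F a b))))"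
    by (simp only: cop_scale(2)[symmetric] mult.assoc)
  also have "\<dots> = cop i (\<lambda>p q. cop j (\<lambda>r t. \<Sum>a<d. \<Sum>b<d. hmu H p r a * (hmu H q t b * F a b)))"
    by (simp add: cop_sum)
  also have "\<dots> = cop i (\<lambda>p q. cop j (\<lambda>r t. mul p r (\<lambda>a. mul q t (\<lambda>b. F a b))))"
    by (simp add: mul_def sum_distrib_left)
  finally show ?thesis .
qed

lemma un_cop: "un (\<lambda>k. cop k F) = un (\<lambda>a. un (\<lambda>b. F a b))"
proof -
  have "un (\<lambda>k. cop k F) = (\<Sum>a<d. \<Sum>k<d. \<Sum>b<d. hunit H k * hdelta H k a b * F a b)"
    unfolding un_def cop_def sum_distrib_left by (subst sum.swap) (simp add: mult_ac)
  also have "\<dots> = (\<Sum>a<d. \<Sum>b<d. \<Sum>k<d. hunit H k * hdelta H k a b * F a b)"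
    by (rule sum.cong[OF refl], rule sum.swap)
  also have "\<dots> = (\<Sum>a<d. \<Sum>b<d. (\<Sum>k<d. hunit H k * hdelta H k a b) * F a b)"
    by (simp add: sum_distrib_right)
  also have "\<dots> = (\<Sum>a<d. \<Sum>b<d. (hunit H a * hunit H b) * F a b)"
    by (intro sum.cong refl arg_cong2[where f = times] ax_un_cop) (use hopf in auto)
  finally show ?thesis by (simp add: un_def sum_distrib_left mult_ac)
qed

lemma mul_eps: "i < d \<Longrightarrow> j < d \<Longrightarrow> mul i j eps = eps i * eps j"
  unfolding mul_def by (rule ax_mul_eps)

lemma un_eps: "un eps = 1"
  unfolding un_def by (rule ax_un_eps)

lemma antipode_left:
  assumes "k < d"
  shows "cop k (\<lambda>i j. ant i (\<lambda>l. mul l j F)) = eps k * un F"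
proof -
  have "cop k (\<lambda>i j. ant i (\<lambda>l. mul l j F)) = (\<Sum>m<d. cop k (\<lambda>i j. ant i (\<lambda>l. hmu H l j m)) * F m)"
    unfolding mul_def by (simp add: ant_sum cop_sum ant_scale cop_scale)
  also have "\<dots> = (\<Sum>m<d. (eps k * hunit H m) * F m)"
    by (intro sum.cong refl arg_cong2[where f = times]) (use assms in \<open>simp add: cop_def ant_def sum_distrib_left mult.assoc ax_antl[symmetric]\<close>)
  finally show ?thesis by (simp add: un_def sum_distrib_left mult_ac)
qed

lemma antipode_right:
  assumes "k < d"
  shows "cop k (\<lambda>i j. ant j (\<lambda>l. mul i l F)) = eps k * un F"
proof -
  have "cop k (\<lambda>i j. ant j (\<lambda>l. mul i l F)) = (\<Sum>m<d. cop k (\<lambda>i j. ant j (\<lambda>l. hmu H i l m)) * F m)"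
    unfolding mul_def by (simp add: ant_sum cop_sum ant_scale cop_scale)
  also have "\<dots> = (\<Sum>m<d. (eps k * hunit H m) * F m)"
    by (intro sum.cong refl arg_cong2[where f = times]) (use assms in \<open>simp add: cop_def ant_def sum_distrib_left mult.assoc ax_antr[symmetric]\<close>)
  finally show ?thesis by (simp add: un_def sum_distrib_left mult_ac)
qed

text \<open>The map \<open>x \<otimes> y \<mapsto> S(y) S(x)\<close> is right convolution inverse to
  multiplication: in \<open>p r S(t) S(q)\<close> the inner pair \<open>r S(t)\<close> contracts
  first, then \<open>p S(q)\<close>.\<close>

lemma antipode_tensor:
  assumes "i < d" "j < d"
  shows "cop i (\<lambda>p q. cop j (\<lambda>r t. mul p r (\<lambda>y. ant t (\<lambda>s. ant q (\<lambda>u. mul s u (\<lambda>z. mul y z F))))))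
    = eps i * eps j * un F"
proof -
  have "cop i (\<lambda>p q. cop j (\<lambda>r t. mul p r (\<lambda>y. ant t (\<lambda>s. ant q (\<lambda>u. mul s u (\<lambda>z. mul y z F))))))
    = cop i (\<lambda>p q. cop j (\<lambda>r t. ant t (\<lambda>s. ant q (\<lambda>u. mul p r (\<lambda>y. mul y s (\<lambda>k. mul k u F))))))"
    by (simp add: mul_ant mul_assoc)
  also have "\<dots> = cop i (\<lambda>p q. cop j (\<lambda>r t. ant t (\<lambda>s. ant q (\<lambda>u. mul r s (\<lambda>m. mul p m (\<lambda>k. mul k u F))))))"
    using assms by (intro cop_cong ant_cong refl) (simp only: mul_assoc)
  also have "\<dots> = cop i (\<lambda>p q. ant q (\<lambda>u. cop j (\<lambda>r t. ant t (\<lambda>s. mul r s (\<lambda>m. mul p m (\<lambda>k. mul k u F))))))"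
  proof (intro cop_cong refl)
    fix p q
    show "cop j (\<lambda>r t. ant t (\<lambda>s. ant q (\<lambda>u. mul r s (\<lambda>m. mul p m (\<lambda>k. mul k u F))))) =
      ant q (\<lambda>u. cop j (\<lambda>r t. ant t (\<lambda>s. mul r s (\<lambda>m. mul p m (\<lambda>k. mul k u F)))))"
      by (simp only: ant_ant[of _ q] cop_ant[of j q])
  qed
  also have "\<dots> = cop i (\<lambda>p q. ant q (\<lambda>u. eps j * mul p u F))"
    using assms by (simp add: antipode_right un_mul_right)
  also have "\<dots> = eps i * eps j * un F"
    using assms by (simp add: ant_scale cop_scale antipode_right)
  finally show ?thesis .
qed

text \<open>Both sides are convolution inverse to the multiplication \<open>A \<otimes> A \<rightarrow> A\<close>.\<close>
lemma ant_mul: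
  assumes i: "i < d" and j: "j < d"
  shows "mul i j (\<lambda>k. ant k F) = ant i (\<lambda>u. ant j (\<lambda>s. mul s u F))"
proof -
  \<comment> \<open>The triple convolution of \<open>S(x y)\<close>, \<open>x y\<close> and
    \<open>S(y) S(x)\<close>. Contracting the last two factors leaves the left-hand side of the
    claim, contracting the first two leaves the right-hand side.\<close>
  define T where "T = cop i (\<lambda>a1 a2. cop j (\<lambda>b1 b2. mul a1 b1 (\<lambda>x. ant x (\<lambda>sx. 
     cop a2 (\<lambda>p q. cop b2 (\<lambda>r t. mul p r (\<lambda>y. ant t (\<lambda>s. ant q (\<lambda>u. mul s u (\<lambda>z. mul y z (\<lambda>w. mul sx w F)))))))))))"
  have "T = cop i (\<lambda>a1 a2. cop j (\<lambda>b1 b2. mul a1 b1 (\<lambda>x. ant x (\<lambda>sx. eps a2 * eps b2 * F sx))))"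
    unfolding T_def by (simp add: antipode_tensor un_mul_right)
  also have "\<dots> = cop i (\<lambda>a1 a2. eps a2 * cop j (\<lambda>b1 b2. eps b2 * mul a1 b1 (\<lambda>x. ant x F)))"
    by (simp add: ant_scale mul_scale cop_scale mult.assoc)
  also have "\<dots> = mul i j (\<lambda>k. ant k F)"
    using i j by (simp add: cop_eps_right)
  finally have 1: "T = mul i j (\<lambda>k. ant k F)" .
  have inner: "mul y z (\<lambda>w. mul sx w F) = mul sx y (\<lambda>w. mul w z F)" if "sx < d" "y < d" "z < d" for sx y z
    using that by (simp only: mul_assoc)
  have "T = cop i (\<lambda>a1 a2. cop j (\<lambda>b1 b2. mul a1 b1 (\<lambda>x. ant x (\<lambda>sx. 
     cop a2 (\<lambda>p q. cop b2 (\<lambda>r t. mul p r (\<lambda>y. ant t (\<lambda>s. ant q (\<lambda>u. mul s u (\<lambda>z. mul sx y (\<lambda>w. mul w z F)))))))))))"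
    unfolding T_def by (simp add: inner)
  also have "\<dots> = cop i (\<lambda>a1 a2. cop j (\<lambda>b1 b2. mul a1 b1 (\<lambda>x. ant x (\<lambda>sx. 
     cop a2 (\<lambda>p q. cop b2 (\<lambda>r t. mul p r (\<lambda>y. mul sx y (\<lambda>w. ant q (\<lambda>u. ant t (\<lambda>s. mul s u (\<lambda>z. mul w z F)))))))))))"
  proof (intro cop_cong mul_cong ant_cong refl)
    fix p q r t y sx
    show "ant t (\<lambda>s. ant q (\<lambda>u. mul s u (\<lambda>z. mul sx y (\<lambda>w. mul w z F)))) =
      mul sx y (\<lambda>w. ant q (\<lambda>u. ant t (\<lambda>s. mul s u (\<lambda>z. mul w z F))))"
      by (subst ant_ant, subst mul_mul) (simp only: mul_ant)
  qed
  also have "\<dots> = cop i (\<lambda>a1 a2. cop a2 (\<lambda>p q. cop j (\<lambda>b1 b2. cop b2 (\<lambda>r t. mul a1 b1 (\<lambda>x. mul p r (\<lambda>y. ant x (\<lambda>sx. 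
     mul sx y (\<lambda>w. ant q (\<lambda>u. ant t (\<lambda>s. mul s u (\<lambda>z. mul w z F)))))))))))"
    (is "cop i ?L = cop i ?R")
  proof (rule cop_cong[OF refl])
    fix a1 a2
    let ?W = "\<lambda>sx y q t. mul sx y (\<lambda>w. ant q (\<lambda>u. ant t (\<lambda>s. mul s u (\<lambda>z. mul w z F))))"
    have "?L a1 a2 = cop j (\<lambda>b1 b2. cop a2 (\<lambda>p q. cop b2 (\<lambda>r t. mul a1 b1 (\<lambda>x. ant x (\<lambda>sx. mul p r (\<lambda>y. ?W sx y q t))))))"
      by (simp only: cop_mul[of a2, symmetric] cop_mul[of _ a1, symmetric] cop_ant[symmetric])
    also have "\<dots> = cop j (\<lambda>b1 b2. cop a2 (\<lambda>p q. cop b2 (\<lambda>r t. mul a1 b1 (\<lambda>x. mul p r (\<lambda>y. ant x (\<lambda>sx. ?W sx y q t))))))"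
      by (simp only: mul_ant)
    also have "\<dots> = ?R a1 a2"
      by (rule cop_cop)
    finally show "?L a1 a2 = ?R a1 a2" .
  qed
  \<comment> \<open>Coassociativity pairs \<open>a1\<close> with \<open>p\<close> and
    \<open>b1\<close> with \<open>r\<close>. By \<open>mul_cop\<close> the factors
    \<open>S(a1 b1)\<close> and \<open>p r\<close> then stem from one coproduct of the product
    \<open>c e\<close>, and the antipode axiom contracts them.\<close>
  also have "\<dots> = cop i (\<lambda>c q. cop c (\<lambda>a1 p. cop j (\<lambda>e t. cop e (\<lambda>b1 r. mul a1 b1 (\<lambda>x. mul p r (\<lambda>y. ant x (\<lambda>sx. 
     mul sx y (\<lambda>w. ant q (\<lambda>u. ant t (\<lambda>s. mul s u (\<lambda>z. mul w z F)))))))))))"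
    using i j by (simp add: cop_coassoc)
  also have "\<dots> = cop i (\<lambda>c q. cop j (\<lambda>e t. cop c (\<lambda>a1 p. cop e (\<lambda>b1 r. mul a1 b1 (\<lambda>x. mul p r (\<lambda>y. ant x (\<lambda>sx. 
     mul sx y (\<lambda>w. ant q (\<lambda>u. ant t (\<lambda>s. mul s u (\<lambda>z. mul w z F)))))))))))"
    by (rule cop_cong[OF refl], rule cop_cop)
  also have "\<dots> = cop i (\<lambda>c q. cop j (\<lambda>e t. mul c e (\<lambda>k. eps k * ant q (\<lambda>u. ant t (\<lambda>s. mul s u F)))))"
    by (simp add: mul_cop[symmetric] antipode_left un_mul_left ant_un[symmetric] mul_un[symmetric])
  also have "\<dots> = cop i (\<lambda>c q. cop j (\<lambda>e t. eps c * (eps e * ant q (\<lambda>u. ant t (\<lambda>s. mul s u F)))))"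
    by (simp add: mul_scale mul_eps mult.assoc)
  also have "\<dots> = ant i (\<lambda>u. ant j (\<lambda>s. mul s u F))"
    using i j by (simp add: cop_scale cop_eps_left)
  finally show ?thesis using 1 by simp
qed

text \<open>\<open>S(1) = S(1) 1\<close>, and \<open>1 \<otimes> 1\<close> is the coproduct of 1, so
  the antipode axiom applies.\<close>

lemma un_ant: "un (\<lambda>k. ant k F) = un F"
proof -
  have "un (\<lambda>k. ant k F) = un (\<lambda>a. un (\<lambda>b. ant a (\<lambda>x. mul x b F)))"
    by (simp add: ant_un[symmetric] un_mul_right)
  also have "\<dots> = un F"
    by (simp add: un_cop[symmetric] antipode_left un_scale un_eps)
  finally show ?thesis .
qed

end

section \<open>The dual Hopf algebra, which turns identities for products into identities for
  coproducts\<close>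

definition hopf_dual :: "'k::field hopf \<Rightarrow> 'k hopf" where
  "hopf_dual H = \<lparr>hdim = hdim H, hmu = \<lambda>i j k. hdelta H k i j, hunit = hcounit H,
     hdelta = \<lambda>k i j. hmu H i j k, hcounit = hunit H, hanti = \<lambda>k l. hanti H l k\<rparr>"

context hopf_alg
begin

lemma hopf_algebra_dual: "hopf_algebra (hopf_dual H)"
  unfolding hopf_algebra_def Let_def hopf_dual_def hopf.simps
proof (intro conjI allI impI)
  fix i j k m assume a: "i < d" "j < d" "k < d" "m < d"
  show "(\<Sum>q<d. hdelta H q i j * hdelta H m q k) = (\<Sum>q<d. hdelta H q j k * hdelta H m i q)"
    using ax_coassoc[OF a(4) a(1-3)] by (simp add: mult.commute)
  show "(\<Sum>q<d. hmu H q k m * hmu H i j q) = (\<Sum>q<d. hmu H i q m * hmu H j k q)"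
    using ax_assoc[OF a] by (simp add: mult.commute)
next
  fix i j a b assume A: "i < d" "j < d" "a < d" "b < d"
  show "(\<Sum>k<d. hdelta H k i j * hmu H a b k) =
       (\<Sum>p<d. \<Sum>q<d. \<Sum>r<d. \<Sum>t<d. hmu H p q i * hmu H r t j * hdelta H a p r * hdelta H b q t)" (is "?l = ?r")
  proof -
    have "?l = (\<Sum>p<d. \<Sum>q<d. \<Sum>r<d. \<Sum>t<d. hdelta H a p q * hdelta H b r t * hmu H p r i * hmu H q t j)"
      using ax_mul_cop[OF A(3,4,1,2)] by (simp add: mult.commute)
    also have "\<dots> = (\<Sum>p<d. \<Sum>r<d. \<Sum>q<d. \<Sum>t<d. hdelta H a p q * hdelta H b r t * hmu H p r i * hmu H q t j)"
      by (rule sum.cong[OF refl], rule sum.swap)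
    finally show ?thesis by (simp add: mult_ac)
  qed
next
  fix k m assume a: "k < d" "m < d"
  have "(\<Sum>i<d. \<Sum>j<d. \<Sum>l<d. hmu H i j k * hanti H l i * hdelta H m l j) =
     (\<Sum>j<d. \<Sum>i<d. \<Sum>l<d. hmu H i j k * hanti H l i * hdelta H m l j)"
    by (rule sum.swap)
  also have "\<dots> = (\<Sum>j<d. \<Sum>l<d. \<Sum>i<d. hmu H i j k * hanti H l i * hdelta H m l j)"
    by (rule sum.cong[OF refl], rule sum.swap)
  also have "\<dots> = (\<Sum>l<d. \<Sum>j<d. \<Sum>i<d. hmu H i j k * hanti H l i * hdelta H m l j)"
    by (rule sum.swap)
  finally show "(\<Sum>i<d. \<Sum>j<d. \<Sum>l<d. hmu H i j k * hanti H l i * hdelta H m l j) = hunit H k * eps m"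
    using ax_antl[OF a(2,1)] by (simp add: mult_ac)
  have "(\<Sum>i<d. \<Sum>j<d. \<Sum>l<d. hmu H i j k * hanti H l j * hdelta H m i l) =
     (\<Sum>i<d. \<Sum>l<d. \<Sum>j<d. hmu H i j k * hanti H l j * hdelta H m i l)"
    by (rule sum.cong[OF refl], rule sum.swap)
  then show "(\<Sum>i<d. \<Sum>j<d. \<Sum>l<d. hmu H i j k * hanti H l j * hdelta H m i l) = hunit H k * eps m"
    using ax_antr[OF a(2,1)] by (simp add: mult_ac)
next
  fix j k assume a: "j < d" "k < d"
  show "(\<Sum>i<d. eps i * hdelta H k i j) = (if j = k then 1 else 0)"
    by (subst eq_commute[of j]) (rule ax_counitl[OF a(2,1)])
  show "(\<Sum>i<d. eps i * hdelta H k j i) = (if j = k then 1 else 0)"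
    by (subst eq_commute[of j]) (rule ax_counitr[OF a(2,1)])
  show "(\<Sum>i<d. hunit H i * hmu H i k j) = (if j = k then 1 else 0)"
    by (subst eq_commute[of j]) (rule ax_unitl[OF a(2,1)])
  show "(\<Sum>i<d. hunit H i * hmu H k i j) = (if j = k then 1 else 0)"
    by (subst eq_commute[of j]) (rule ax_unitr[OF a(2,1)])
  show "(\<Sum>i<d. eps i * hmu H j k i) = eps j * eps k"
    using ax_mul_eps[OF a] by (simp only: mult.commute)
  show "(\<Sum>i<d. hdelta H i j k * hunit H i) = hunit H j * hunit H k"
    using ax_un_cop[OF a] by (simp only: mult.commute)
next
  show "(\<Sum>k<d. eps k * hunit H k) = 1"
    using ax_un_eps by (simp only: mult.commute)
qed

text \<open>This is antimultiplicativity of the antipode of the dual Hopf algebra.\<close>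
lemma ant_cop:
  assumes k: "k < d"
  shows "ant k (\<lambda>l. cop l F) = cop k (\<lambda>i j. ant i (\<lambda>a. ant j (\<lambda>b. F b a)))"
proof -
  interpret D: hopf_alg "hopf_dual H" by unfold_locales (rule hopf_algebra_dual)
  have *: "(\<Sum>l<d. hanti H k l * hdelta H l x y) = cop k (\<lambda>i j. hanti H i y * hanti H j x)" 
    if "x < d" "y < d" for x y
  proof -
    have dd: "hdim (hopf_dual H) = d" by (simp add: hopf_dual_def)
    \<comment> \<open>Antimultiplicativity in the dual, read off at coordinate \<open>k\<close>, is
      an identity between structure constants of the original algebra: the coefficient of
      \<open>e_x \<otimes> e_y\<close> in the claim.\<close>
    have "D.mul x y (\<lambda>z. D.ant z (\<lambda>c. if c = k then 1 else 0)) = D.ant x (\<lambda>u. D.ant y (\<lambda>s. D.mul s u (\<lambda>c. if c = k then 1 else 0)))"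
      using that by (intro D.ant_mul) (simp_all add: hopf_dual_def)
    then have "(\<Sum>l<d. hdelta H l x y * hanti H k l) = (\<Sum>u<d. hanti H u x * (\<Sum>s<d. hanti H s y * hdelta H k s u))"
      using k unfolding D.mul_def D.ant_def dd by (simp add: hopf_dual_def if_distrib cong: if_cong)
    also have "\<dots> = (\<Sum>s<d. \<Sum>u<d. hanti H u x * hanti H s y * hdelta H k s u)"
      by (subst sum.swap) (simp add: sum_distrib_left mult_ac)
    finally show ?thesis by (simp add: cop_def mult_ac)
  qed
  have "ant k (\<lambda>l. cop l F) = (\<Sum>x<d. \<Sum>l<d. \<Sum>y<d. hanti H k l * hdelta H l x y * F x y)"
    unfolding ant_def cop_def sum_distrib_left by (subst sum.swap) (simp add: mult_ac)
  also have "\<dots> = (\<Sum>x<d. \<Sum>y<d. \<Sum>l<d. hanti H k l * hdelta H l x y * F x y)"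
    by (rule sum.cong[OF refl], rule sum.swap)
  also have "\<dots> = (\<Sum>x<d. \<Sum>y<d. cop k (\<lambda>i j. hanti H i y * hanti H j x) * F x y)"
    by (simp add: sum_distrib_right[symmetric] *)
  also have "\<dots> = cop k (\<lambda>i j. \<Sum>x<d. \<Sum>y<d. hanti H i y * (hanti H j x * F x y))"
    by (simp add: cop_sum cop_scale(2)[symmetric] mult.assoc)
  also have "\<dots> = cop k (\<lambda>i j. \<Sum>y<d. \<Sum>x<d. hanti H i y * (hanti H j x * F x y))"
    by (intro cop_cong refl) (rule sum.swap)
  also have "\<dots> = cop k (\<lambda>i j. ant i (\<lambda>a. ant j (\<lambda>b. F b a)))"
    by (simp add: ant_def sum_distrib_left)
  finally show ?thesis .
qed

end

subsection \<open>Integrals\<close>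

abbreviation dlt :: "nat \<Rightarrow> nat \<Rightarrow> 'k::field" where
  "dlt i j \<equiv> (if i = j then 1 else 0)"

context hopf_alg
begin

text \<open>Inserts a basis, so that the matrix coefficients needed to form a trace become
  visible.\<close>

lemma mul_expand: "mul b t U = (\<Sum>k<d. mul b t (\<lambda>r. dlt r k) * U k)"
proof -
  have "(\<Sum>k<d. mul b t (\<lambda>r. dlt r k) * U k) = mul b t (\<lambda>r. \<Sum>k<d. dlt r k * U k)"
    by (simp only: mul_sum mul_scale(2))
  also have "\<dots> = mul b t U"
    by (rule mul_cong[OF refl refl]) (simp only: sum_delta)
  finally show ?thesis by simp
qed

text \<open>The coefficient of \<open>e\<^sub>k\<close> in \<open>b S\<^sup>2(e\<^sub>p)\<close>.\<close>
definition kappa :: "nat \<Rightarrow> nat \<Rightarrow> nat \<Rightarrow> 'k" where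
  "kappa k b p = ant p (\<lambda>s. ant s (\<lambda>t. mul b t (\<lambda>r. dlt r k)))"

text \<open>The trace of \<open>x \<mapsto> b S\<^sup>2(x\<^sub>1) f(x\<^sub>2)\<close>; this is the projection of \<open>f\<close> onto the
  coinvariants of the right Hopf module \<open>A\<^sup>*\<close>.\<close>
definition integral_of :: "(nat \<Rightarrow> 'k) \<Rightarrow> nat \<Rightarrow> 'k" where
  "integral_of f b = (\<Sum>i<d. cop i (\<lambda>p q. kappa i b p * f q))"

text \<open>\<open>S(c_2) S\<^sup>2(c_1) = S(S(c_1) c_2) = \<epsilon>(c) 1\<close>: the square of
  the antipode in \<open>kappa\<close> is there for this cancellation.\<close>

lemma kappa_conv:
  assumes "b < d" "c < d"
  shows "cop c (\<lambda>p p'. ant p' (\<lambda>s. mul b s (\<lambda>x. kappa i x p))) = eps c * dlt b i"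
proof -
  let ?G = "\<lambda>k. mul b k (\<lambda>r. dlt r i)"
  have "cop c (\<lambda>p p'. ant p' (\<lambda>s. mul b s (\<lambda>x. kappa i x p)))
    = cop c (\<lambda>p p'. ant p' (\<lambda>s. ant p (\<lambda>s'. ant s' (\<lambda>t. mul b s (\<lambda>x. mul x t (\<lambda>r. dlt r i))))))"
    unfolding kappa_def by (simp only: mul_ant)
  also have "\<dots> = cop c (\<lambda>p p'. ant p' (\<lambda>s. ant p (\<lambda>s'. ant s' (\<lambda>t. mul s t ?G))))"
    using assms by (simp add: mul_assoc)
  also have "\<dots> = cop c (\<lambda>p p'. ant p (\<lambda>s'. ant s' (\<lambda>t. ant p' (\<lambda>s. mul s t ?G))))"
  proof (rule cop_cong[OF refl])
    fix p p'
    have "ant p' (\<lambda>s. ant p (\<lambda>s'. ant s' (\<lambda>t. mul s t ?G))) = ant p (\<lambda>s'. ant p' (\<lambda>s. ant s' (\<lambda>t. mul s t ?G)))"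
      by (rule ant_ant)
    also have "\<dots> = ant p (\<lambda>s'. ant s' (\<lambda>t. ant p' (\<lambda>s. mul s t ?G)))"
      by (rule ant_cong[OF refl], rule ant_ant)
    finally show "ant p' (\<lambda>s. ant p (\<lambda>s'. ant s' (\<lambda>t. mul s t ?G))) = ant p (\<lambda>s'. ant s' (\<lambda>t. ant p' (\<lambda>s. mul s t ?G)))" .
  qed
  also have "\<dots> = cop c (\<lambda>p p'. ant p (\<lambda>s'. mul s' p' (\<lambda>k. ant k ?G)))"
    by (simp add: ant_mul)
  also have "\<dots> = eps c * dlt b i"
    using assms by (simp add: antipode_left un_ant un_mul_right)
  finally show ?thesis .
qed

text \<open>One half of the structure theorem for the Hopf module \<open>A\<^sup>*\<close>: every
  functional is recovered from the projections of the coordinate functionals. Its purpose is to show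
  that these projections cannot all vanish.\<close>

lemma integral_of_reconstruct:
  assumes b: "b < d"
  shows "(\<Sum>j<d. cop j (\<lambda>p q. ant p (\<lambda>s. mul b s (\<lambda>x. integral_of (\<lambda>m. dlt m j) x)) * f q)) = f b"
proof -
  let ?X = "\<lambda>i p p'. ant p' (\<lambda>s. mul b s (\<lambda>x. kappa i x p))"
  have 1: "cop j (\<lambda>p' q'. ant p' (\<lambda>s. mul b s (\<lambda>x. integral_of (\<lambda>m. dlt m j) x)) * f q')
     = (\<Sum>i<d. cop i (\<lambda>p q. dlt q j * cop j (\<lambda>p' q'. ?X i p p' * f q')))" for j
  proof -
    have "cop j (\<lambda>p' q'. ant p' (\<lambda>s. mul b s (\<lambda>x. integral_of (\<lambda>m. dlt m j) x)) * f q')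
      = cop j (\<lambda>p' q'. (\<Sum>i<d. cop i (\<lambda>p q. ?X i p p' * dlt q j)) * f q')"
      unfolding integral_of_def
      by (simp only: mul_sum ant_sum cop_mul[symmetric] cop_ant[symmetric] mul_scale(2) ant_scale(2))
    also have "\<dots> = cop j (\<lambda>p' q'. \<Sum>i<d. cop i (\<lambda>p q. dlt q j * (?X i p p' * f q')))"
      by (simp only: sum_distrib_right sum_distrib_left cop_scale[symmetric] mult_ac)
    also have "\<dots> = (\<Sum>i<d. cop i (\<lambda>p q. cop j (\<lambda>p' q'. dlt q j * (?X i p p' * f q'))))"
      by (simp only: cop_sum cop_cop[of j])
    finally show ?thesis by (simp only: cop_scale(1))
  qed
  have "(\<Sum>j<d. cop j (\<lambda>p q. ant p (\<lambda>s. mul b s (\<lambda>x. integral_of (\<lambda>m. dlt m j) x)) * f q))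
    = (\<Sum>i<d. cop i (\<lambda>p q. \<Sum>j<d. dlt q j * cop j (\<lambda>p' q'. ?X i p p' * f q')))"
    unfolding 1 cop_sum by (rule sum.swap)
  also have "\<dots> = (\<Sum>i<d. cop i (\<lambda>p q. cop q (\<lambda>p' q'. ?X i p p' * f q')))"
    by (intro sum.cong refl cop_cong) (simp only: sum_delta)
  also have "\<dots> = (\<Sum>i<d. cop i (\<lambda>c q'. cop c (\<lambda>p p'. ?X i p p' * f q')))"
    by (intro sum.cong refl cop_coassoc[symmetric]) simp
  also have "\<dots> = (\<Sum>i<d. cop i (\<lambda>c q'. eps c * (dlt b i * f q')))"
    unfolding cop_scale(2) by (intro sum.cong refl cop_cong) (simp only: kappa_conv[OF b] mult.assoc)
  also have "\<dots> = (\<Sum>i<d. dlt b i * f i)"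
    by (intro sum.cong refl) (simp only: cop_eps_left lessThan_iff)
  also have "\<dots> = f b" using b by (simp only: sum_delta)
  finally show ?thesis .
qed

text \<open>\<open>b_1 \<otimes> b_2 S(a) = (b S(a_1))_1 a_2 \<otimes> (b S(a_1))_2\<close>.
  Expanding the coproduct on the right gives \<open>b_1 S(a_2) a_3 \<otimes> b_2 S(a_1)\<close>,
  because the antipode reverses coproducts, and \<open>S(a_2) a_3\<close> contracts. This moves a
  coproduct from \<open>b\<close> to the whole product \<open>b S(a)\<close>.\<close>

lemma cop_mul_ant_shift:
  assumes "b < d" "a < d"
  shows "cop b (\<lambda>x y. ant a (\<lambda>s. mul y s (\<lambda>z. W x z)))
    = cop a (\<lambda>a1 a2. ant a1 (\<lambda>s. mul b s (\<lambda>k. cop k (\<lambda>x z. mul x a2 (\<lambda>x'. W x' z)))))"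
proof -
  have "cop a (\<lambda>a1 a2. ant a1 (\<lambda>s. mul b s (\<lambda>k. cop k (\<lambda>x z. mul x a2 (\<lambda>x'. W x' z)))))
    = cop a (\<lambda>a1 a2. ant a1 (\<lambda>s. cop b (\<lambda>p q. cop s (\<lambda>r t. mul p r (\<lambda>x. mul q t (\<lambda>z. mul x a2 (\<lambda>x'. W x' z)))))))"
    using assms by (simp add: mul_cop)
  also have "\<dots> = cop a (\<lambda>a1 a2. cop b (\<lambda>p q. ant a1 (\<lambda>s. cop s (\<lambda>r t. mul p r (\<lambda>x. mul q t (\<lambda>z. mul x a2 (\<lambda>x'. W x' z)))))))"
    by (simp only: cop_ant)
  also have "\<dots> = cop a (\<lambda>a1 a2. cop b (\<lambda>p q. cop a1 (\<lambda>i j. ant i (\<lambda>t. ant j (\<lambda>r. mul p r (\<lambda>x. mul q t (\<lambda>z. mul x a2 (\<lambda>x'. W x' z))))))))"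
    by (simp add: ant_cop)
  also have "\<dots> = cop a (\<lambda>a1 a2. cop b (\<lambda>p q. cop a1 (\<lambda>i j. ant i (\<lambda>t. ant j (\<lambda>r. mul q t (\<lambda>z. mul p r (\<lambda>x. mul x a2 (\<lambda>x'. W x' z))))))))"
  proof (intro cop_cong[OF refl] ant_cong[OF refl])
    fix p q r t a2
    show "mul p r (\<lambda>x. mul q t (\<lambda>z. mul x a2 (\<lambda>x'. W x' z))) = mul q t (\<lambda>z. mul p r (\<lambda>x. mul x a2 (\<lambda>x'. W x' z)))"
      by (rule mul_mul)
  qed
  also have "\<dots> = cop a (\<lambda>a1 a2. cop b (\<lambda>p q. cop a1 (\<lambda>i j. ant i (\<lambda>t. ant j (\<lambda>r. mul q t (\<lambda>z. mul r a2 (\<lambda>y. mul p y (\<lambda>x'. W x' z))))))))"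
    by (simp add: mul_assoc)
  also have "\<dots> = cop a (\<lambda>a1 a2. cop b (\<lambda>p q. cop a1 (\<lambda>i j. ant i (\<lambda>t. mul q t (\<lambda>z. ant j (\<lambda>r. mul r a2 (\<lambda>y. mul p y (\<lambda>x'. W x' z))))))))"
    by (simp only: mul_ant)
  also have "\<dots> = cop b (\<lambda>p q. cop a (\<lambda>a1 a2. cop a1 (\<lambda>i j. ant i (\<lambda>t. mul q t (\<lambda>z. ant j (\<lambda>r. mul r a2 (\<lambda>y. mul p y (\<lambda>x'. W x' z))))))))"
    by (rule cop_cop)
  also have "\<dots> = cop b (\<lambda>p q. cop a (\<lambda>i m. cop m (\<lambda>j a2. ant i (\<lambda>t. mul q t (\<lambda>z. ant j (\<lambda>r. mul r a2 (\<lambda>y. mul p y (\<lambda>x'. W x' z))))))))"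
    using assms by (simp add: cop_coassoc)
  also have "\<dots> = cop b (\<lambda>p q. cop a (\<lambda>i m. ant i (\<lambda>t. mul q t (\<lambda>z. cop m (\<lambda>j a2. ant j (\<lambda>r. mul r a2 (\<lambda>y. mul p y (\<lambda>x'. W x' z))))))))"
    by (intro cop_cong[OF refl]) (simp only: cop_ant[of _ i for i] cop_mul[of _ q for q])
  also have "\<dots> = cop b (\<lambda>p q. cop a (\<lambda>i m. eps m * ant i (\<lambda>t. mul q t (\<lambda>z. W p z))))"
    by (simp add: antipode_left un_mul_right mul_scale ant_scale)
  also have "\<dots> = cop b (\<lambda>p q. ant a (\<lambda>t. mul q t (\<lambda>z. W p z)))"
    using assms by (simp add: cop_eps_right)
  finally show ?thesis by simp
qed

text \<open>After rewriting \<open>b\<^sub>1 \<otimes> b\<^sub>2 S\<^sup>2(x)\<close>, cyclicity of the trace moves the comultiplication to the other end,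
  where the antipode axiom applies.\<close>
lemma integral_of_integral:
  assumes b: "b < d"
  shows "cop b (\<lambda>x y. G x * integral_of f y) = un G * integral_of f b"
proof -
  \<comment> \<open>\<open>R c U\<close> is \<open>U(b S\<^sup>2(c_1)) f(c_2)\<close> and
    \<open>r c k\<close> are its coefficients, so the trace \<open>integral_of f b\<close> is the
    sum of the \<open>r k k\<close>.\<close>
  define R where "R c U = cop c (\<lambda>n q. ant n (\<lambda>a1. ant a1 (\<lambda>t. mul b t U)) * f q)" for c U
  define r where "r c k = cop c (\<lambda>n q. kappa k b n * f q)" for c k
  have R: "R c U = (\<Sum>k<d. r c k * U k)" for c U
    unfolding R_def r_def kappa_def
    by (subst mul_expand) (simp only: ant_sum sum_distrib_right sum_distrib_left cop_sum cop_scale[symmetric] ant_scale[symmetric] mult_ac)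
  have "cop b (\<lambda>x y. G x * integral_of f y)
    = (\<Sum>i<d. cop i (\<lambda>p q. cop b (\<lambda>x y. G x * kappa i y p) * f q))"
    unfolding integral_of_def
    by (simp only: sum_distrib_left cop_sum cop_scale[symmetric] cop_cop[of b] mult_ac)
  also have "\<dots> = (\<Sum>i<d. cop i (\<lambda>p q. cop p (\<lambda>m n. ant m (\<lambda>a2. ant n (\<lambda>a1. ant a1 (\<lambda>t. mul b t (\<lambda>k. cop k (\<lambda>x z. mul x a2 G * dlt z i)))))) * f q))"
  proof (rule sum.cong[OF refl], rule cop_cong[OF refl], rule arg_cong2[where f = times, OF _ refl])
    fix i p assume p: "p < d"
    have "cop b (\<lambda>x y. G x * kappa i y p) = ant p (\<lambda>s. cop b (\<lambda>x y. ant s (\<lambda>t. mul y t (\<lambda>z. G x * dlt z i))))"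
      unfolding kappa_def by (simp only: mul_scale ant_scale cop_ant[of b p, symmetric])
    also have "\<dots> = ant p (\<lambda>s. cop s (\<lambda>a1 a2. ant a1 (\<lambda>t. mul b t (\<lambda>k. cop k (\<lambda>x z. mul x a2 (\<lambda>x'. G x' * dlt z i))))))"
      using b by (simp add: cop_mul_ant_shift)
    also have "\<dots> = cop p (\<lambda>m n. ant m (\<lambda>a2. ant n (\<lambda>a1. ant a1 (\<lambda>t. mul b t (\<lambda>k. cop k (\<lambda>x z. mul x a2 G * dlt z i))))))"
      using p by (simp only: ant_cop mul_scale(2))
    finally show "cop b (\<lambda>x y. G x * kappa i y p) = cop p (\<lambda>m n. ant m (\<lambda>a2. ant n (\<lambda>a1. ant a1 (\<lambda>t. mul b t (\<lambda>k. cop k (\<lambda>x z. mul x a2 G * dlt z i))))))" .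
  qed
  also have "\<dots> = (\<Sum>i<d. cop i (\<lambda>m c. cop c (\<lambda>n q. ant m (\<lambda>a2. ant n (\<lambda>a1. ant a1 (\<lambda>t. mul b t (\<lambda>k. cop k (\<lambda>x z. mul x a2 G * dlt z i))))) * f q)))"
    by (intro sum.cong refl) (simp add: cop_scale(2)[symmetric] cop_coassoc)
  also have "\<dots> = (\<Sum>i<d. cop i (\<lambda>m c. ant m (\<lambda>a2. R c (\<lambda>k. cop k (\<lambda>x z. mul x a2 G * dlt z i)))))"
    unfolding R_def by (intro sum.cong refl cop_cong) (simp only: ant_scale(2)[symmetric] cop_ant)
  also have "\<dots> = (\<Sum>i<d. \<Sum>k<d. cop k (\<lambda>x z. dlt z i * cop i (\<lambda>m c. r c k * ant m (\<lambda>a2. mul x a2 G))))"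
  proof (intro sum.cong refl)
    fix i
    have "cop i (\<lambda>m c. ant m (\<lambda>a2. R c (\<lambda>k. cop k (\<lambda>x z. mul x a2 G * dlt z i))))
      = cop i (\<lambda>m c. \<Sum>k<d. cop k (\<lambda>x z. r c k * (ant m (\<lambda>a2. mul x a2 G) * dlt z i)))"
      unfolding R by (simp only: ant_sum ant_scale cop_scale cop_ant[symmetric])
    also have "\<dots> = (\<Sum>k<d. cop k (\<lambda>x z. cop i (\<lambda>m c. r c k * (ant m (\<lambda>a2. mul x a2 G) * dlt z i))))"
      by (simp only: cop_sum) (rule sum.cong[OF refl], rule cop_cop)
    also have "\<dots> = (\<Sum>k<d. cop k (\<lambda>x z. dlt z i * cop i (\<lambda>m c. r c k * ant m (\<lambda>a2. mul x a2 G))))"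
      by (simp only: cop_scale(1)[symmetric] mult_ac)
    finally show "cop i (\<lambda>m c. ant m (\<lambda>a2. R c (\<lambda>k. cop k (\<lambda>x z. mul x a2 G * dlt z i))))
      = (\<Sum>k<d. cop k (\<lambda>x z. dlt z i * cop i (\<lambda>m c. r c k * ant m (\<lambda>a2. mul x a2 G))))" .
  qed
  \<comment> \<open>Cyclicity of the trace: the sum over the input index \<open>i\<close> is carried
    out first and substitutes \<open>z\<close> for it, leaving a trace over \<open>k\<close>. Now
    \<open>x\<close> and \<open>m\<close> are adjacent legs of one coproduct, and
    \<open>x S(m)\<close> contracts.\<close>
  also have "\<dots> = (\<Sum>k<d. cop k (\<lambda>x z. \<Sum>i<d. dlt z i * cop i (\<lambda>m c. r c k * ant m (\<lambda>a2. mul x a2 G))))"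
    unfolding cop_sum by (rule sum.swap)
  also have "\<dots> = (\<Sum>k<d. cop k (\<lambda>x z. cop z (\<lambda>m c. r c k * ant m (\<lambda>a2. mul x a2 G))))"
    by (intro sum.cong refl cop_cong) (simp only: sum_delta)
  also have "\<dots> = (\<Sum>k<d. cop k (\<lambda>e c. cop e (\<lambda>x m. r c k * ant m (\<lambda>a2. mul x a2 G))))"
    by (intro sum.cong refl cop_coassoc[symmetric]) simp
  also have "\<dots> = (\<Sum>k<d. cop k (\<lambda>e c. eps e * (r c k * un G)))"
    by (intro sum.cong refl cop_cong) (simp add: cop_scale antipode_right mult_ac)
  also have "\<dots> = (\<Sum>k<d. r k k * un G)"
    by (intro sum.cong refl cop_eps_left) simp
  also have "\<dots> = un G * integral_of f b"
    unfolding integral_of_def r_def by (simp only: sum_distrib_left mult.commute)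
  finally show ?thesis .
qed

text \<open>If all the projections \<open>integral_of f\<close> were zero, reconstruction would give
  \<open>\<epsilon> = 0\<close>, against \<open>\<epsilon>(1) = 1\<close>.\<close>

lemma ex_nonzero_integral:
  "\<exists>la. (\<forall>b<d. \<forall>G. cop b (\<lambda>x y. G x * la y) = un G * la b) \<and> (\<exists>b<d. la b \<noteq> 0)"
proof (rule ccontr)
  assume neg: "\<not> ?thesis"
  have zero: "integral_of f b = 0" if "b < d" for f b
  proof (rule ccontr)
    assume "integral_of f b \<noteq> 0"
    with neg integral_of_integral that show False by blast
  qed
  have "eps b = 0" if "b < d" for b
    using integral_of_reconstruct[OF that, of eps, symmetric]
    by (simp add: zero mul_def ant_def cop_def)
  then have "un eps = 0" by (simp add: un_def)
  with un_eps show False by simp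
qed

text \<open>For an integral, \<open>b_1 \<lambda>(b_2 S(v)) = \<lambda>(b S(v_1)) v_2\<close>, so
  the right-hand side vanishes for every \<open>b\<close> once \<open>v\<close> is in the kernel.
  Replacing \<open>b\<close> by \<open>b S\<^sup>2(v_2)\<close> inside one more coproduct gives
  \<open>\<lambda>(b S(v_1 S(v_2))) v_3 = \<lambda>(b) v\<close>, and some
  \<open>\<lambda>(b)\<close> is nonzero.\<close>

lemma integral_faithful:
  assumes int: "\<And>b G. b < d \<Longrightarrow> cop b (\<lambda>x y. G x * la y) = un G * la b"
    and nz: "b < d" "la b \<noteq> 0"
    and ker: "\<And>b. b < d \<Longrightarrow> (\<Sum>a<d. v a * ant a (\<lambda>s. mul b s la)) = 0"
    and j: "j < d"
  shows "v j = 0"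
proof -
  have i: "(\<Sum>a<d. v a * cop a (\<lambda>a1 a2. ant a1 (\<lambda>s. mul b s la) * G a2)) = 0" if b: "b < d" for b G
  proof -
    have "cop a (\<lambda>a1 a2. ant a1 (\<lambda>s. mul b s la) * G a2) = cop b (\<lambda>x y. G x * ant a (\<lambda>s. mul y s la))" if a: "a < d" for a
    proof -
      have "cop b (\<lambda>x y. G x * ant a (\<lambda>s. mul y s la)) = cop b (\<lambda>x y. ant a (\<lambda>s. mul y s (\<lambda>z. G x * la z)))"
        by (simp only: mul_scale ant_scale)
      also have "\<dots> = cop a (\<lambda>a1 a2. ant a1 (\<lambda>s. mul b s (\<lambda>k. cop k (\<lambda>x z. mul x a2 G * la z))))"
        using cop_mul_ant_shift[OF b a, of "\<lambda>x z. G x * la z"] by (simp only: mul_scale(2))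
      also have "\<dots> = cop a (\<lambda>a1 a2. ant a1 (\<lambda>s. mul b s la) * G a2)"
        by (simp add: int un_mul_left mul_scale ant_scale) (simp add: mult.commute)
      finally show ?thesis by simp
    qed
    then have "(\<Sum>a<d. v a * cop a (\<lambda>a1 a2. ant a1 (\<lambda>s. mul b s la) * G a2))
      = (\<Sum>a<d. v a * cop b (\<lambda>x y. G x * ant a (\<lambda>s. mul y s la)))"
      by simp
    also have "\<dots> = cop b (\<lambda>x y. G x * (\<Sum>a<d. v a * ant a (\<lambda>s. mul y s la)))"
      by (simp only: sum_distrib_left cop_sum cop_scale[symmetric] mult.left_commute)
    also have "\<dots> = 0" using b by (simp add: ker) (simp add: cop_def)
    finally show ?thesis .
  qed
  have "la b * (\<Sum>a<d. v a * G a) = 0" for G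
  proof -
    define X where "X a = cop a (\<lambda>a1 c. cop c (\<lambda>a2 a3. ant a2 (\<lambda>p. ant p (\<lambda>p'. ant a1 (\<lambda>s. mul b p' (\<lambda>b'. mul b' s la)))) * G a3))" for a
    have "X a = cop a (\<lambda>a1 c. cop c (\<lambda>a2 a3. \<Sum>b'<d. ant a1 (\<lambda>s. mul b' s la) * (kappa b' b a2 * G a3)))" for a
      unfolding X_def kappa_def
      by (subst mul_expand) (simp only: ant_sum ant_scale sum_distrib_right sum_distrib_left mult_ac)
    then have "X a = (\<Sum>b'<d. cop a (\<lambda>a1 c. ant a1 (\<lambda>s. mul b' s la) * cop c (\<lambda>a2 a3. kappa b' b a2 * G a3)))" for a
      by (simp only: cop_sum cop_scale)
    then have "(\<Sum>a<d. v a * X a) = (\<Sum>b'<d. \<Sum>a<d. v a * cop a (\<lambda>a1 c. ant a1 (\<lambda>s. mul b' s la) * cop c (\<lambda>a2 a3. kappa b' b a2 * G a3)))"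
      by (simp only: sum_distrib_left) (rule sum.swap)
    then have 0: "(\<Sum>a<d. v a * X a) = 0" by (simp add: i)
    have "X a = la b * G a" if a: "a < d" for a
    proof -
      have "X a = cop a (\<lambda>e a3. cop e (\<lambda>a1 a2. ant a2 (\<lambda>p. ant p (\<lambda>p'. ant a1 (\<lambda>s. mul b p' (\<lambda>b'. mul b' s la))))) * G a3)"
        using a unfolding X_def by (simp add: cop_coassoc[symmetric] cop_scale)
      also have "\<dots> = cop a (\<lambda>e a3. cop e (\<lambda>a1 a2. ant a2 (\<lambda>p. ant a1 (\<lambda>s. ant p (\<lambda>p'. mul b p' (\<lambda>b'. mul b' s la))))) * G a3)"
        by (subst (2) ant_ant) (rule refl)
      also have "\<dots> = cop a (\<lambda>e a3. cop e (\<lambda>a1 a2. ant a2 (\<lambda>p. mul a1 p (\<lambda>k. ant k (\<lambda>k. mul b k la)))) * G a3)"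
        using nz by (simp add: mul_assoc ant_mul)
      also have "\<dots> = cop a (\<lambda>e a3. eps e * (la b * G a3))"
        using nz by (simp add: antipode_right un_ant un_mul_right mult.assoc)
      finally show ?thesis using a by (simp add: cop_eps_left)
    qed
    then have "(\<Sum>a<d. v a * X a) = la b * (\<Sum>a<d. v a * G a)"
      by (simp add: sum_distrib_left mult.left_commute)
    with 0 show ?thesis by simp
  qed
  from this[of "\<lambda>a. dlt j a"] have "la b * (\<Sum>a<d. dlt j a * v a) = 0"
    by (simp only: mult.commute)
  with j nz show ?thesis by (simp only: sum_delta) simp
qed

end

subsection \<open>Ranks of idempotent matrices\<close>

lemma mult_index_carrier:
  "A \<in> carrier_mat n m \<Longrightarrow> B \<in> carrier_mat m l \<Longrightarrow> i < n \<Longrightarrow> j < l \<Longrightarrow>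
    (A * B) $$ (i, j) = (\<Sum>k<m. A $$ (i, k) * B $$ (k, j))"
  by (auto simp: scalar_prod_def atLeast0LessThan intro!: sum.cong)

lemma mult_vec_index_carrier:
  "A \<in> carrier_mat n m \<Longrightarrow> v \<in> carrier_vec m \<Longrightarrow> i < n \<Longrightarrow>
    (A *\<^sub>v v) $ i = (\<Sum>k<m. A $$ (i, k) * v $ k)"
  by (auto simp: scalar_prod_def atLeast0LessThan intro!: sum.cong)

text \<open>The side conditions are equations between dimensions: unlike carrier premises they
  contain no size variable absent from the left-hand side, so they can be discharged by
  rewriting.\<close>

lemma mult_assoc_dim:
  fixes A :: "'a::semiring_0 mat"
  shows "dim_col A = dim_row B \<Longrightarrow> dim_col B = dim_row C \<Longrightarrow> A * B * C = A * (B * C)"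
  by (rule assoc_mult_mat) auto

lemma mult_plus_dim:
  fixes A :: "'a::semiring_0 mat"
  shows "dim_col A = dim_row B \<Longrightarrow> dim_row C = dim_row B \<Longrightarrow> dim_col C = dim_col B \<Longrightarrow> A * (B + C) = A * B + A * C"
  by (rule mult_add_distrib_mat) auto

lemma plus_mult_dim:
  fixes A :: "'a::semiring_0 mat"
  shows "dim_row A = dim_row B \<Longrightarrow> dim_col A = dim_col B \<Longrightarrow> dim_col B = dim_row C \<Longrightarrow> (A + B) * C = A * C + B * C"
  by (rule add_mult_distrib_mat) auto

lemma mult_minus_dim:
  fixes A :: "'a::ring mat"
  shows "dim_col A = dim_row B \<Longrightarrow> dim_row C = dim_row B \<Longrightarrow> dim_col C = dim_col B \<Longrightarrow> A * (B - C) = A * B - A * C"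
  by (rule mult_minus_distrib_mat) auto

lemma minus_mult_dim:
  fixes A :: "'a::ring mat"
  shows "dim_row A = dim_row B \<Longrightarrow> dim_col A = dim_col B \<Longrightarrow> dim_col B = dim_row C \<Longrightarrow> (A - B) * C = A * C - B * C"
  by (rule minus_mult_distrib_mat) auto

lemma sum_lessThan_add: "(\<Sum>k<r + s. F k) = (\<Sum>k<r. F k) + (\<Sum>k<s. F (r + k :: nat))"
  for F :: "nat \<Rightarrow> 'a::comm_monoid_add"
  by (induction s) (simp_all add: add.assoc)

section \<open>Block matrices\<close>

definition hcat :: "'a mat \<Rightarrow> 'a mat \<Rightarrow> 'a mat" where
  "hcat A B = mat (dim_row A) (dim_col A + dim_col B) (\<lambda>(i, j). if j < dim_col A then A $$ (i, j) else B $$ (i, j - dim_col A))"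

definition vcat :: "'a mat \<Rightarrow> 'a mat \<Rightarrow> 'a mat" where
  "vcat A B = mat (dim_row A + dim_row B) (dim_col A) (\<lambda>(i, j). if i < dim_row A then A $$ (i, j) else B $$ (i - dim_row A, j))"

lemma dim_hcat [simp]: "dim_row (hcat A B) = dim_row A" "dim_col (hcat A B) = dim_col A + dim_col B"
  by (simp_all add: hcat_def)

lemma dim_vcat [simp]: "dim_row (vcat A B) = dim_row A + dim_row B" "dim_col (vcat A B) = dim_col A"
  by (simp_all add: vcat_def)

lemma hcat_mult_vcat:
  fixes A :: "'a::semiring_0 mat"
  assumes "A \<in> carrier_mat n r" "B \<in> carrier_mat n s" "C \<in> carrier_mat r m" "D \<in> carrier_mat s m"
  shows "hcat A B * vcat C D = A * C + B * D"
proof (rule eq_matI)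
  fix i j assume "i < dim_row (A * C + B * D)" "j < dim_col (A * C + B * D)"
  then have ij: "i < n" "j < m" using assms by auto
  have "(hcat A B * vcat C D) $$ (i, j) = (\<Sum>k<r + s. hcat A B $$ (i, k) * vcat C D $$ (k, j))"
    using assms ij by (intro mult_index_carrier[where n = n and l = m]) (auto simp: hcat_def vcat_def)
  also have "\<dots> = (\<Sum>k<r. A $$ (i, k) * C $$ (k, j)) + (\<Sum>k<s. B $$ (i, k) * D $$ (k, j))"
    unfolding sum_lessThan_add using assms ij by (auto simp: hcat_def vcat_def)
  also have "\<dots> = (A * C + B * D) $$ (i, j)"
    using assms ij by (simp add: mult_index_carrier[OF assms(1,3)] mult_index_carrier[OF assms(2,4)] del: index_mult_mat(1))
  finally show "(hcat A B * vcat C D) $$ (i, j) = (A * C + B * D) $$ (i, j)" .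
qed (use assms in auto)

lemma vcat_mult_hcat_one:
  fixes A :: "'a::semiring_1 mat"
  assumes c: "A \<in> carrier_mat r n" "B \<in> carrier_mat s n" "C \<in> carrier_mat n r" "D \<in> carrier_mat n s"
    and e: "A * C = 1\<^sub>m r" "A * D = 0\<^sub>m r s" "B * C = 0\<^sub>m s r" "B * D = 1\<^sub>m s"
  shows "vcat A B * hcat C D = 1\<^sub>m (r + s)"
proof (rule eq_matI)
  fix i j assume "i < dim_row (1\<^sub>m (r + s) :: 'a mat)" "j < dim_col (1\<^sub>m (r + s) :: 'a mat)"
  then have ij: "i < r + s" "j < r + s" by auto
  have *: "(vcat A B * hcat C D) $$ (i, j) = (\<Sum>k<n. vcat A B $$ (i, k) * hcat C D $$ (k, j))"
    using c ij by (intro mult_index_carrier[where n = "r + s" and l = "r + s"]) (auto simp: hcat_def vcat_def)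
  consider "i < r" "j < r" | "i < r" "\<not> j < r" | "\<not> i < r" "j < r" | "\<not> i < r" "\<not> j < r" by blast
  then show "(vcat A B * hcat C D) $$ (i, j) = 1\<^sub>m (r + s) $$ (i, j)"
  proof cases
    case 1
    then have "(vcat A B * hcat C D) $$ (i, j) = (A * C) $$ (i, j)"
      unfolding * mult_index_carrier[OF c(1,3) 1] using c ij by (auto simp: hcat_def vcat_def)
    then show ?thesis unfolding e using 1 by simp
  next
    case 2
    then have "(vcat A B * hcat C D) $$ (i, j) = (A * D) $$ (i, j - r)"
      unfolding * using c ij by (subst mult_index_carrier[OF c(1,4)]) (auto simp: hcat_def vcat_def)
    then show ?thesis unfolding e using 2 ij by simp
  next
    case 3
    then have "(vcat A B * hcat C D) $$ (i, j) = (B * C) $$ (i - r, j)"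
      unfolding * using c ij by (subst mult_index_carrier[OF c(2,3)]) (auto simp: hcat_def vcat_def)
    then show ?thesis unfolding e using 3 ij by simp
  next
    case 4
    then have "(vcat A B * hcat C D) $$ (i, j) = (B * D) $$ (i - r, j - r)"
      unfolding * using c ij by (subst mult_index_carrier[OF c(2,4)]) (auto simp: hcat_def vcat_def)
    then show ?thesis unfolding e using 4 ij by auto
  qed
qed (use c in auto)

text \<open>If \<open>r\<close> exceeded \<open>n\<close>, padding with zeros would make both
  matrices square with product 1. The product in the other order would then also be 1, although it
  has a zero row.\<close>

lemma left_inverse_dim_le:
  fixes f :: "'a::field mat"
  assumes f: "f \<in> carrier_mat n r" and f': "f' \<in> carrier_mat r n" and one: "f' * f = 1\<^sub>m r"
  shows "r \<le> n"
proof (rule ccontr)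
  assume "\<not> r \<le> n"
  define s where "s = r - n"
  have r: "r = n + s" and s: "0 < s" using \<open>\<not> r \<le> n\<close> by (auto simp: s_def)
  have v: "vcat f (0\<^sub>m s r) \<in> carrier_mat r r" and h: "hcat f' (0\<^sub>m r s) \<in> carrier_mat r r"
    using f f' r by auto
  have "hcat f' (0\<^sub>m r s) * vcat f (0\<^sub>m s r) = 1\<^sub>m r"
    using hcat_mult_vcat[OF f' zero_carrier_mat f zero_carrier_mat] one by simp
  with v h have "vcat f (0\<^sub>m s r) * hcat f' (0\<^sub>m r s) = 1\<^sub>m r"
    using mat_mult_left_right_inverse[OF h v] by simp
  moreover have "(vcat f (0\<^sub>m s r) * hcat f' (0\<^sub>m r s)) $$ (n, n) = 0"
    using f f' r s by (subst mult_index_carrier[OF v h]) (auto simp: vcat_def intro!: sum.neutral)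
  ultimately show False using r s by simp
qed

text \<open>The rank of an idempotent matrix; junk on matrices that are not idempotent.\<close>
definition idem_rank :: "'a::field mat \<Rightarrow> nat" where
  "idem_rank E = (THE r. \<exists>f f'. f \<in> carrier_mat (dim_row E) r \<and> f' \<in> carrier_mat r (dim_row E) \<and> f * f' = E \<and> f' * f = 1\<^sub>m r)"

text \<open>Applied with \<open>THEN\<close>, this makes an equation for a product
  \<open>A * B\<close> usable as a rewrite rule inside right-nested products.\<close>

lemma mult_eq_assoc:
  fixes A :: "'a::semiring_0 mat"
  shows "A * B = D \<Longrightarrow> dim_col A = dim_row B \<Longrightarrow> dim_col B = dim_row C \<Longrightarrow> A * (B * C) = D * C"
  by (simp add: mult_assoc_dim[symmetric])

text \<open>Two factorisations of one idempotent are compared through \<open>f2' * f1\<close>, which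
  has the left inverse \<open>f1' * f2\<close>.\<close>

lemma idem_rank_le:
  fixes f1 :: "'a::field mat"
  assumes c: "f1 \<in> carrier_mat n r1" "f1' \<in> carrier_mat r1 n" "f2 \<in> carrier_mat n r2" "f2' \<in> carrier_mat r2 n"
    and one: "f1' * f1 = 1\<^sub>m r1" and eq: "f1 * f1' = f2 * f2'"
  shows "r1 \<le> r2"
proof (rule left_inverse_dim_le)
  show "f2' * f1 \<in> carrier_mat r2 r1" "f1' * f2 \<in> carrier_mat r1 r2" using c by auto
  have "f1' * f2 * (f2' * f1) = f1' * ((f2 * f2') * f1)"
    using c by (simp add: mult_assoc_dim)
  also have "\<dots> = 1\<^sub>m r1"
    unfolding eq[symmetric] using c by (simp add: mult_assoc_dim one one[THEN mult_eq_assoc])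
  finally show "f1' * f2 * (f2' * f1) = 1\<^sub>m r1" .
qed

lemma idem_rank_eq:
  fixes f :: "'a::field mat"
  assumes f: "f \<in> carrier_mat n r" and f': "f' \<in> carrier_mat r n" and one: "f' * f = 1\<^sub>m r"
  shows "idem_rank (f * f') = r"
proof -
  have d: "dim_row (f * f') = n" using f by simp
  show ?thesis unfolding idem_rank_def d
  proof (rule the_equality)
    show "\<exists>h h'. h \<in> carrier_mat n r \<and> h' \<in> carrier_mat r n \<and> h * h' = f * f' \<and> h' * h = 1\<^sub>m r"
      using assms by blast
    fix s assume "\<exists>h h'. h \<in> carrier_mat n s \<and> h' \<in> carrier_mat s n \<and> h * h' = f * f' \<and> h' * h = 1\<^sub>m s"
    then obtain h h' where h: "h \<in> carrier_mat n s" "h' \<in> carrier_mat s n" "h * h' = f * f'" "h' * h = 1\<^sub>m s" by blast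
    show "s = r" using idem_rank_le[OF h(1,2) f f' h(4,3)] idem_rank_le[OF f f' h(1,2) one h(3)[symmetric]] by simp
  qed
qed

lemma idem_rank_one [simp]: "idem_rank (1\<^sub>m n :: 'a::field mat) = n"
  using idem_rank_eq[of "1\<^sub>m n :: 'a mat" n n "1\<^sub>m n"] by simp

lemma idem_rank_zero [simp]: "idem_rank (0\<^sub>m n n :: 'a::field mat) = 0"
  proof -
  have "0\<^sub>m 0 n * 0\<^sub>m n 0 = (1\<^sub>m 0 :: 'a mat)" by (rule eq_matI) auto
  moreover have "0\<^sub>m n 0 * 0\<^sub>m 0 n = (0\<^sub>m n n :: 'a mat)" by simp
  ultimately show ?thesis using idem_rank_eq[of "0\<^sub>m n 0 :: 'a mat" n 0 "0\<^sub>m 0 n"] zero_carrier_mat by metis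
qed

section \<open>Subspaces and factorisations of idempotents\<close>

lemma mult_zero_vec: "A \<in> carrier_mat n m \<Longrightarrow> A *\<^sub>v 0\<^sub>v m = (0\<^sub>v n :: 'a::semiring_0 vec)"
  by (rule eq_vecI) (simp_all add: scalar_prod_def)

definition subspace_vec :: "nat \<Rightarrow> 'a::field vec set \<Rightarrow> bool" where
  "subspace_vec n W \<longleftrightarrow> W \<subseteq> carrier_vec n \<and> 0\<^sub>v n \<in> W \<and> (\<forall>x\<in>W. \<forall>y\<in>W. x + y \<in> W) \<and> (\<forall>c. \<forall>x\<in>W. c \<cdot>\<^sub>v x \<in> W)"

definition colm :: "'a vec \<Rightarrow> 'a mat" where
  "colm v = mat (dim_vec v) 1 (\<lambda>(i, _). v $ i)"

lemma colm_carrier [simp]: "v \<in> carrier_vec n \<Longrightarrow> colm v \<in> carrier_mat n 1"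
  by (auto simp: colm_def)

lemma dim_colm [simp]: "dim_row (colm v) = dim_vec v" "dim_col (colm v) = 1"
  by (simp_all add: colm_def)

lemma colm_index [simp]: "i < dim_vec v \<Longrightarrow> colm v $$ (i, 0) = v $ i"
  by (simp add: colm_def)

lemma mult_colm: "dim_vec v = dim_col A \<Longrightarrow> A * colm v = colm (A *\<^sub>v v)"
  by (rule eq_matI) (auto simp: colm_def scalar_prod_def)

lemma hcat_colm_mult:
  fixes f :: "'a::field mat"
  assumes f: "f \<in> carrier_mat n r" and w: "w \<in> carrier_vec n" and v: "v \<in> carrier_vec (r + 1)"
  shows "hcat f (colm w) *\<^sub>v v = f *\<^sub>v vec r (\<lambda>i. v $ i) + (v $ r) \<cdot>\<^sub>v w"
proof (rule eq_vecI)
  fix i assume "i < dim_vec (f *\<^sub>v vec r (\<lambda>i. v $ i) + (v $ r) \<cdot>\<^sub>v w)"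
  then have i: "i < n" using w by simp
  have c: "hcat f (colm w) \<in> carrier_mat n (r + 1)" using f w by auto
  have "(hcat f (colm w) *\<^sub>v v) $ i = (\<Sum>k<r + 1. hcat f (colm w) $$ (i, k) * v $ k)"
    by (rule mult_vec_index_carrier[OF c v i])
  also have "\<dots> = (\<Sum>k<r. f $$ (i, k) * v $ k) + w $ i * v $ r"
    unfolding sum_lessThan_add using f w i by (auto simp: hcat_def)
  also have "\<dots> = (f *\<^sub>v vec r (\<lambda>i. v $ i) + (v $ r) \<cdot>\<^sub>v w) $ i"
    using f w i by (simp add: mult_vec_index_carrier[OF f] del: index_mult_mat_vec)
  finally show "(hcat f (colm w) *\<^sub>v v) $ i = (f *\<^sub>v vec r (\<lambda>i. v $ i) + (v $ r) \<cdot>\<^sub>v w) $ i" .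
qed (use f w in auto)

text \<open>Choice of a basis: the columns of \<open>f\<close> are a basis of W and
  \<open>f'\<close> reads off coordinates. Among all left invertible \<open>f\<close> with image in
  W one with the most columns is taken; a vector \<open>w\<close> of W outside its image would
  supply a further column \<open>w - f f' w\<close>, which \<open>f'\<close> annihilates.\<close>

lemma subspace_factor:
  fixes W :: "'a::field vec set"
  assumes W: "subspace_vec n W"
  obtains r f f' where "f \<in> carrier_mat n r" "f' \<in> carrier_mat r n" "f' * f = 1\<^sub>m r"
    "\<And>v. v \<in> carrier_vec r \<Longrightarrow> f *\<^sub>v v \<in> W" "\<And>w. w \<in> W \<Longrightarrow> f *\<^sub>v (f' *\<^sub>v w) = w"
proof -
  define P where "P r \<longleftrightarrow> (\<exists>f f'. f \<in> carrier_mat n r \<and> f' \<in> carrier_mat r n \<and> f' * f = 1\<^sub>m r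
     \<and> (\<forall>v\<in>carrier_vec r. f *\<^sub>v v \<in> W))" for r
  have "P 0" unfolding P_def
  proof (intro exI conjI ballI)
    show "0\<^sub>m n 0 \<in> carrier_mat n 0" "0\<^sub>m 0 n \<in> carrier_mat 0 n" by simp_all
    show "0\<^sub>m 0 n * 0\<^sub>m n 0 = 1\<^sub>m 0" by (rule eq_matI) auto
    fix v :: "'a vec" assume "v \<in> carrier_vec 0"
    have "0\<^sub>m n 0 *\<^sub>v v = 0\<^sub>v n" using carrier_vecD[OF \<open>v \<in> carrier_vec 0\<close>] by (intro eq_vecI) (simp_all add: scalar_prod_def del: vec_of_dim_0)
    then show "0\<^sub>m n 0 *\<^sub>v v \<in> W" using W by (simp add: subspace_vec_def)
  qed
  moreover have "\<forall>r. P r \<longrightarrow> r \<le> n" unfolding P_def using left_inverse_dim_le by blast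
  ultimately obtain r where Pr: "P r" and max: "\<And>s. P s \<Longrightarrow> s \<le> r"
    by (metis GreatestI_nat Greatest_le_nat)
  from Pr obtain f f' where f: "f \<in> carrier_mat n r" and f': "f' \<in> carrier_mat r n" and one: "f' * f = 1\<^sub>m r"
    and fW: "\<And>v. v \<in> carrier_vec r \<Longrightarrow> f *\<^sub>v v \<in> W" unfolding P_def by blast
  have "f *\<^sub>v (f' *\<^sub>v w) = w" if w: "w \<in> W" for w
  proof (rule ccontr)
    assume ne: "f *\<^sub>v (f' *\<^sub>v w) \<noteq> w"
    have wc: "w \<in> carrier_vec n" using W w by (auto simp: subspace_vec_def)
    define z where "z = w + (-1) \<cdot>\<^sub>v (f *\<^sub>v (f' *\<^sub>v w))"
    have zc: "z \<in> carrier_vec n" unfolding z_def using f f' wc by simp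
    have zW: "z \<in> W" using W w fW[of "f' *\<^sub>v w"] f' wc unfolding z_def subspace_vec_def by auto
    have "\<exists>j<n. z $ j \<noteq> 0"
    proof (rule ccontr)
      assume "\<not> ?thesis"
      then have "f *\<^sub>v (f' *\<^sub>v w) = w"
        using f wc by (intro eq_vecI) (auto simp: z_def)
      with ne show False by simp
    qed
    then obtain j where j: "j < n" "z $ j \<noteq> 0" by blast
    have f'z: "f' *\<^sub>v z = 0\<^sub>v r"
    proof -
      have "f' *\<^sub>v (f *\<^sub>v (f' *\<^sub>v w)) = f' *\<^sub>v w"
        using f f' wc one by (simp add: assoc_mult_mat_vec[symmetric, of _ r n _ r])
      then show ?thesis unfolding z_def using f f' wc
        by (subst mult_add_distrib_mat_vec[of _ r n]) (auto simp: mult_mat_vec[of _ r n])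
    qed
    \<comment> \<open>Coordinate \<open>j\<close> of the component along the kernel of
      \<open>f'\<close>, scaled so that it is 1 on \<open>z\<close>; it vanishes on the columns of
      \<open>f\<close> and so serves as the new row of the left inverse.\<close>
    define phi where "phi = inverse (z $ j) \<cdot>\<^sub>m (mat 1 n (\<lambda>(_, k). if k = j then 1 else 0) * (1\<^sub>m n - f * f'))"
    have phi: "phi \<in> carrier_mat 1 n" unfolding phi_def using f f' by auto
    have phif: "phi * f = 0\<^sub>m 1 r"
    proof -
      have "(1\<^sub>m n - f * f') * f = 0\<^sub>m n r"
        using f f' by (simp add: minus_mult_dim mult_assoc_dim one)
      then show ?thesis unfolding phi_def using f f'
        by (subst mult_smult_assoc_mat[of _ 1 n _ r]) (auto simp: mult_assoc_dim)
    qed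
    have phiz: "phi * colm z = 1\<^sub>m 1"
    proof -
      have a: "f' * colm z = 0\<^sub>m r 1" using f'z f' zc by (subst mult_colm) (auto simp: colm_def)
      have "(1\<^sub>m n - f * f') * colm z = colm z"
        using f f' zc a by (simp add: minus_mult_dim mult_assoc_dim) (rule eq_matI; simp)
      then have "phi * colm z = inverse (z $ j) \<cdot>\<^sub>m (mat 1 n (\<lambda>(_, k). if k = j then 1 else 0) * colm z)"
        unfolding phi_def using f f' zc
        by (subst mult_smult_assoc_mat[of _ 1 n _ 1]) (auto simp: mult_assoc_dim)
      also have "\<dots> = 1\<^sub>m 1"
      proof -
        have "(mat 1 n (\<lambda>(_, k). if k = j then 1 else 0) * colm z) $$ (0, 0) = (\<Sum>k<n. (if k = j then 1 else 0) * z $ k)"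
          using zc by (subst mult_index_carrier[of _ 1 n _ 1]) auto
        also have "\<dots> = z $ j"
          using j by (simp add: if_distrib[of "\<lambda>x. x * _"] cong: if_cong)
        finally show ?thesis using j by (intro eq_matI) (auto simp del: index_mult_mat(1))
      qed
      finally show ?thesis .
    qed
    have f'z': "f' * colm z = 0\<^sub>m r 1" using f'z f' zc by (subst mult_colm) (auto simp: colm_def)
    have "P (r + 1)" unfolding P_def
    proof (intro exI conjI ballI)
      show "hcat f (colm z) \<in> carrier_mat n (r + 1)" "vcat f' phi \<in> carrier_mat (r + 1) n"
        using f f' zc phi by auto
      show "vcat f' phi * hcat f (colm z) = 1\<^sub>m (r + 1)"
        using vcat_mult_hcat_one[OF f' phi f colm_carrier[OF zc] one f'z' phif phiz] .
      fix v :: "'a vec" assume v: "v \<in> carrier_vec (r + 1)"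
      show "hcat f (colm z) *\<^sub>v v \<in> W"
        unfolding hcat_colm_mult[OF f zc v] using W fW[of "vec r (\<lambda>i. v $ i)"] zW by (simp add: subspace_vec_def)
    qed
    from max[OF this] show False by simp
  qed
  with f f' one fW show ?thesis using that by blast
qed

lemma mult_col: "j < dim_col B \<Longrightarrow> col (A * B) j = A *\<^sub>v col B j"
  by (rule eq_vecI) auto

lemma mat_from_cols:
  fixes A :: "'a::field mat"
  assumes A: "A \<in> carrier_mat n m" and B: "B \<in> carrier_mat n k"
    and ex: "\<And>j. j < k \<Longrightarrow> \<exists>x\<in>carrier_vec m. A *\<^sub>v x = col B j"
  obtains X where "X \<in> carrier_mat m k" "A * X = B"
proof -
  have "\<forall>j. \<exists>x. j < k \<longrightarrow> x \<in> carrier_vec m \<and> A *\<^sub>v x = col B j" using ex by blast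
  then obtain x where x: "\<And>j. j < k \<Longrightarrow> x j \<in> carrier_vec m \<and> A *\<^sub>v x j = col B j" by metis
  define X where "X = mat m k (\<lambda>(i, j). x j $ i)"
  have c: "col X j = x j" if "j < k" for j
    using x[OF that] that unfolding X_def by (intro eq_vecI) auto
  have X: "X \<in> carrier_mat m k" by (simp add: X_def)
  have "A * X = B"
    by (rule mat_col_eqI) (use A B X x c in \<open>auto simp: mult_col simp del: col_mult\<close>)
  with X show ?thesis by (rule that)
qed

lemma mat_eq_if_cols:
  fixes A :: "'a::field mat"
  assumes "A \<in> carrier_mat n m" "B \<in> carrier_mat n m" "\<And>v. v \<in> carrier_vec m \<Longrightarrow> A *\<^sub>v v = B *\<^sub>v v"
  shows "A = B"
proof (rule mat_col_eqI)
  fix j assume "j < dim_col B"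
  then have j: "j < m" using assms by simp
  have "A *\<^sub>v unit_vec m j = col A j" "B *\<^sub>v unit_vec m j = col B j"
    using assms(1,2) j by (auto intro!: eq_vecI)
  then show "col A j = col B j" using assms(3)[of "unit_vec m j"] by simp
qed (use assms in auto)

lemma vec_eq_if_minus_zero:
  fixes v :: "'a::field vec"
  assumes "v \<in> carrier_vec n" "w \<in> carrier_vec n" "v - w = 0\<^sub>v n"
  shows "v = w"
proof (rule eq_vecI)
  fix i assume i: "i < dim_vec w"
  have "(v - w) $ i = 0" unfolding assms(3) using i assms(2) by simp
  then show "v $ i = w $ i" using i by simp
qed (use assms(1,2) in auto)

text \<open>The columns of \<open>f\<close> are a basis of the column space, and \<open>y\<close>
  records preimages of them. Writing \<open>f\<close> as \<open>A * y\<close> later transports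
  properties of \<open>A\<close>, such as commuting with an action, to \<open>f\<close>.\<close>

lemma image_factor:
  fixes A :: "'a::field mat"
  assumes A: "A \<in> carrier_mat n n"
  obtains r f f' y where "f \<in> carrier_mat n r" "f' \<in> carrier_mat r n" "y \<in> carrier_mat n r"
    "f' * f = 1\<^sub>m r" "f * (f' * A) = A" "f = A * y"
proof -
  let ?W = "{A *\<^sub>v v | v. v \<in> carrier_vec n}"
  have W: "subspace_vec n ?W" unfolding subspace_vec_def
  proof (intro conjI ballI allI)
    show "?W \<subseteq> carrier_vec n" using A by auto
    show "0\<^sub>v n \<in> ?W" using mult_zero_vec[OF A] zero_carrier_vec by (metis (mono_tags, lifting) mem_Collect_eq)
    fix x assume "x \<in> ?W"
    then obtain v where v: "v \<in> carrier_vec n" "x = A *\<^sub>v v" by blast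
    show "c \<cdot>\<^sub>v x \<in> ?W" for c
      using v A mult_mat_vec[OF A v(1), of c] by (auto intro!: exI[of _ "c \<cdot>\<^sub>v v"])
    fix y assume "y \<in> ?W"
    then obtain w where w: "w \<in> carrier_vec n" "y = A *\<^sub>v w" by blast
    show "x + y \<in> ?W"
      using v w mult_add_distrib_mat_vec[OF A v(1) w(1)] by (auto intro!: exI[of _ "v + w"])
  qed
  obtain r f f' where f: "f \<in> carrier_mat n r" and f': "f' \<in> carrier_mat r n" and one: "f' * f = 1\<^sub>m r"
    and im: "\<And>v. v \<in> carrier_vec r \<Longrightarrow> f *\<^sub>v v \<in> ?W" and fx: "\<And>w. w \<in> ?W \<Longrightarrow> f *\<^sub>v (f' *\<^sub>v w) = w"
    by (rule subspace_factor[OF W]) blast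
  have 1: "f * (f' * A) = A"
  proof (rule mat_eq_if_cols)
    fix v :: "'a vec" assume v: "v \<in> carrier_vec n"
    have "f *\<^sub>v (f' *\<^sub>v (A *\<^sub>v v)) = A *\<^sub>v v" using v by (intro fx) blast
    moreover have "(f * (f' * A)) *\<^sub>v v = f *\<^sub>v ((f' * A) *\<^sub>v v)"
      using f f' A v by (intro assoc_mult_mat_vec) auto
    ultimately show "(f * (f' * A)) *\<^sub>v v = A *\<^sub>v v"
      using assoc_mult_mat_vec[OF f' A v] by simp
  qed (use f f' A in auto)
  have "\<exists>x\<in>carrier_vec n. A *\<^sub>v x = col f j" if j: "j < r" for j
  proof -
    have "f *\<^sub>v unit_vec r j = col f j" using f j by (intro eq_vecI) auto
    then have "col f j \<in> ?W" using im[of "unit_vec r j"] by simp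
    then show ?thesis by force
  qed
  then obtain y where y: "y \<in> carrier_mat n r" "A * y = f" by (rule mat_from_cols[OF A f])
  show ?thesis by (rule that[OF f f' y(1) one 1 y(2)[symmetric]])
qed

text \<open>\<open>f = E * y\<close> makes \<open>E\<close> fix \<open>f\<close>, so
  \<open>f' * E\<close> is still a left inverse of \<open>f\<close>.\<close>

lemma idem_factor:
  fixes E :: "'a::field mat"
  assumes E: "E \<in> carrier_mat n n" and EE: "E * E = E"
  obtains r f f' where "f \<in> carrier_mat n r" "f' \<in> carrier_mat r n" "f * f' = E" "f' * f = 1\<^sub>m r"
proof -
  obtain r f f' y where f: "f \<in> carrier_mat n r" "f' \<in> carrier_mat r n" "y \<in> carrier_mat n r"
    "f' * f = 1\<^sub>m r" "f * (f' * E) = E" "f = E * y" by (rule image_factor[OF E])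
  have Ef: "E * f = f" unfolding f(6) using E f(3) by (simp add: EE[THEN mult_eq_assoc])
  show ?thesis
  proof (rule that)
    show "f \<in> carrier_mat n r" "f' * E \<in> carrier_mat r n" using f(1,2) E by auto
    show "f * (f' * E) = E" by (rule f(5))
    show "f' * E * f = 1\<^sub>m r" using f(1,2,4) E by (simp add: mult_assoc_dim Ef)
  qed
qed

text \<open>The complementary idempotent \<open>1 - f f'\<close> is factored in the same
  way.\<close>

lemma idem_complement:
  fixes f :: "'a::field mat"
  assumes f: "f \<in> carrier_mat n r" and f': "f' \<in> carrier_mat r n" and one: "f' * f = 1\<^sub>m r"
  obtains s g g' where "g \<in> carrier_mat s n" "g' \<in> carrier_mat n s" "g * g' = 1\<^sub>m s" "g * f = 0\<^sub>m s r"
    "f * f' + g' * g = 1\<^sub>m n"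
proof -
  let ?E = "1\<^sub>m n - f * f'"
  have c: "?E \<in> carrier_mat n n" using f f' by auto
  have ff: "f * f' * (f * f') = f * f'" using f f' by (simp add: mult_assoc_dim one[THEN mult_eq_assoc])
  have EE: "?E * ?E = ?E"
    using f f' by (simp add: mult_minus_dim minus_mult_dim ff) (rule eq_matI; simp)
  obtain s g' g where g: "g' \<in> carrier_mat n s" "g \<in> carrier_mat s n" "g' * g = ?E" "g * g' = 1\<^sub>m s"
    by (rule idem_factor[OF c EE])
  show ?thesis
  proof (rule that[OF g(2,1,4)])
    have "g * f = g * (g' * g) * f" using f g(1,2) by (simp add: mult_assoc_dim g(4)[THEN mult_eq_assoc])
    also have "\<dots> = g * (?E * f)" unfolding g(3) using f f' g by (simp add: mult_assoc_dim)
    also have "?E * f = 0\<^sub>m n r" using f f' by (simp add: minus_mult_dim mult_assoc_dim one)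
    finally show "g * f = 0\<^sub>m s r" using g by simp
    show "f * f' + g' * g = 1\<^sub>m n" unfolding g(3) using f f' by (intro eq_matI) auto
  qed
qed

text \<open>A basis of the image on U together with lifts of a basis of the image on W is a basis of
  the image on V. Since \<open>f'\<close> and \<open>g'\<close> are only linear, the lifts by
  \<open>g'\<close> leave the image of \<open>EV\<close> and are brought back by applying
  \<open>EV\<close>.\<close>

lemma idem_rank_exact:
  fixes f :: "'a::field mat"
  assumes c: "f \<in> carrier_mat n u" "f' \<in> carrier_mat u n" "g \<in> carrier_mat w n" "g' \<in> carrier_mat n w"
    and f'f: "f' * f = 1\<^sub>m u" and gg': "g * g' = 1\<^sub>m w" and gf: "g * f = 0\<^sub>m w u" and sum: "f * f' + g' * g = 1\<^sub>m n"
    and E: "EU \<in> carrier_mat u u" "EV \<in> carrier_mat n n" "EW \<in> carrier_mat w w"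
    and idem: "EU * EU = EU" "EV * EV = EV" "EW * EW = EW"
    and hf: "EV * f = f * EU" and hg: "g * EV = EW * g"
  shows "idem_rank EV = idem_rank EU + idem_rank EW"
proof -
  obtain r a a' where a: "a \<in> carrier_mat u r" "a' \<in> carrier_mat r u" "a * a' = EU" "a' * a = 1\<^sub>m r"
    by (rule idem_factor[OF E(1) idem(1)])
  obtain s b b' where b: "b \<in> carrier_mat w s" "b' \<in> carrier_mat s w" "b * b' = EW" "b' * b = 1\<^sub>m s"
    by (rule idem_factor[OF E(3) idem(3)])
  have rU: "idem_rank EU = r" using idem_rank_eq[OF a(1,2,4)] a(3) by simp
  have rW: "idem_rank EW = s" using idem_rank_eq[OF b(1,2,4)] b(3) by simp
  \<comment> \<open>\<open>F1\<close> and \<open>F2\<close> are the two halves of the basis,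
    \<open>P1\<close> and \<open>P2\<close> the dual coordinates. \<open>Z\<close> is the U-part of
    the lifted half; subtracting \<open>Z * P2\<close> makes \<open>P1\<close> vanish on
    \<open>F2\<close>.\<close>
  define F1 F2 P2 Z P1 where "F1 = f * a" and "F2 = EV * (g' * b)" and "P2 = b' * g" 
    and "Z = a' * (f' * (EV * (g' * b)))" and "P1 = a' * (f' * EV) - Z * P2"
  note dims = carrier_matD[OF c(1)] carrier_matD[OF c(2)] carrier_matD[OF c(3)] carrier_matD[OF c(4)]
    carrier_matD[OF E(1)] carrier_matD[OF E(2)] carrier_matD[OF E(3)] carrier_matD[OF a(1)] carrier_matD[OF a(2)]
    carrier_matD[OF b(1)] carrier_matD[OF b(2)]
  have F: "F1 \<in> carrier_mat n r" "F2 \<in> carrier_mat n s" "P1 \<in> carrier_mat r n" "P2 \<in> carrier_mat s n" "Z \<in> carrier_mat r s"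
    unfolding F1_def F2_def P1_def P2_def Z_def using dims by (auto intro!: carrier_matI)
  have EUa: "EU * a = a" unfolding a(3)[symmetric] using dims by (simp add: mult_assoc_dim a(4))
  have EWb: "EW * b = b" unfolding b(3)[symmetric] using dims by (simp add: mult_assoc_dim b(4))
  note as = f'f[THEN mult_eq_assoc] gg'[THEN mult_eq_assoc] gf[THEN mult_eq_assoc] a(4)[THEN mult_eq_assoc] b(4)[THEN mult_eq_assoc]
    hf[THEN mult_eq_assoc] hg[THEN mult_eq_assoc] idem[THEN mult_eq_assoc] EUa EWb EUa[THEN mult_eq_assoc] EWb[THEN mult_eq_assoc]
  have P2F1: "P2 * F1 = 0\<^sub>m s r"
    unfolding P2_def F1_def using dims by (simp add: mult_assoc_dim as)
  have P2F2: "P2 * F2 = 1\<^sub>m s"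
    unfolding P2_def F2_def using dims by (simp add: mult_assoc_dim as b(4) del: assoc_mult_mat)
  have P1F1: "P1 * F1 = 1\<^sub>m r"
  proof -
    have "a' * (f' * EV) * F1 = 1\<^sub>m r"
      unfolding F1_def using dims by (simp add: mult_assoc_dim as a(4) del: assoc_mult_mat)
    moreover have "Z * P2 * F1 = 0\<^sub>m r r" using F by (simp add: mult_assoc_dim P2F1)
    ultimately show ?thesis unfolding P1_def using F dims by (simp add: minus_mult_dim) (rule eq_matI; simp)
  qed
  have P1F2: "P1 * F2 = 0\<^sub>m r s"
  proof -
    have "a' * (f' * EV) * F2 = Z"
      unfolding F2_def Z_def using dims by (simp add: mult_assoc_dim as del: assoc_mult_mat)
    moreover have "Z * P2 * F2 = Z" using F by (simp add: mult_assoc_dim P2F2)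
    ultimately show ?thesis unfolding P1_def using F dims by (simp add: minus_mult_dim)
  qed
  have sum': "g' * g = 1\<^sub>m n - f * f'" unfolding sum[symmetric] using dims by (intro eq_matI) auto
  have F1P1: "F1 * P1 = EV * (f * (f' * EV))"
  proof -
    have "F1 * P1 = f * (EU * (f' * EV)) - f * (EU * (f' * (EV * (g' * (EW * g)))))"
      unfolding F1_def P1_def Z_def P2_def a(3)[symmetric] b(3)[symmetric]
      using dims by (simp add: mult_minus_dim mult_assoc_dim del: assoc_mult_mat)
    also have "EW * g = g * EV" by (rule hg[symmetric])
    also have "g' * (g * EV) = EV - f * (f' * EV)"
      using dims by (simp add: mult_assoc_dim[symmetric] sum' minus_mult_dim)
    also have "f * (EU * (f' * (EV * (EV - f * (f' * EV))))) = f * (EU * (f' * EV)) - f * (EU * (f' * EV))"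
      using dims by (simp add: mult_minus_dim mult_assoc_dim as idem del: assoc_mult_mat)
    also have "f * (EU * (f' * EV)) - (f * (EU * (f' * EV)) - f * (EU * (f' * EV))) = f * (EU * (f' * EV))"
      using dims by (intro eq_matI) auto
    also have "\<dots> = EV * (f * (f' * EV))"
      using dims by (simp add: mult_assoc_dim[symmetric] hf del: assoc_mult_mat)
    finally show ?thesis .
  qed
  have F2P2: "F2 * P2 = EV * (g' * (g * EV))"
    unfolding F2_def P2_def hg b(3)[symmetric] using dims by (simp add: mult_assoc_dim del: assoc_mult_mat)
  have "hcat F1 F2 * vcat P1 P2 = EV"
  proof -
    have "hcat F1 F2 * vcat P1 P2 = EV * (f * (f' * EV)) + EV * (g' * (g * EV))"
      using hcat_mult_vcat[OF F(1,2,3,4)] F1P1 F2P2 by simp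
    also have "\<dots> = EV * ((f * f' + g' * g) * EV)"
      using dims by (simp add: plus_mult_dim mult_plus_dim mult_assoc_dim del: assoc_mult_mat)
    also have "\<dots> = EV" unfolding sum using dims idem by simp
    finally show ?thesis .
  qed
  moreover have "vcat P1 P2 * hcat F1 F2 = 1\<^sub>m (r + s)"
    by (rule vcat_mult_hcat_one[OF F(3,4,1,2) P1F1 P1F2 P2F1 P2F2])
  moreover have "hcat F1 F2 \<in> carrier_mat n (r + s)" "vcat P1 P2 \<in> carrier_mat (r + s) n"
    using F by auto
  ultimately show ?thesis unfolding rU rW
    using idem_rank_eq[of "hcat F1 F2" n "r + s" "vcat P1 P2"] by metis
qed

lemma idem_rank_transpose:
  fixes E :: "'a::field mat"
  assumes E: "E \<in> carrier_mat n n" and EE: "E * E = E"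
  shows "idem_rank (transpose_mat E) = idem_rank E"
proof -
  obtain r f f' where f: "f \<in> carrier_mat n r" "f' \<in> carrier_mat r n" "f * f' = E" "f' * f = 1\<^sub>m r"
    by (rule idem_factor[OF E EE])
  have "idem_rank (transpose_mat f' * transpose_mat f) = r"
    using f transpose_mult[of f' r n f r] by (intro idem_rank_eq[where n = n]) auto
  moreover have "transpose_mat f' * transpose_mat f = transpose_mat E"
    using f transpose_mult[of f n r f' n] by simp
  ultimately show ?thesis using idem_rank_eq[OF f(1,2,4)] f(3) by simp
qed

lemma idem_rank_similar:
  fixes E :: "'a::field mat"
  assumes E: "E \<in> carrier_mat n n" and EE: "E * E = E"
    and P: "P \<in> carrier_mat n n" "Q \<in> carrier_mat n n" "Q * P = 1\<^sub>m n"
  shows "idem_rank (P * E * Q) = idem_rank E"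
proof -
  obtain r f f' where f: "f \<in> carrier_mat n r" "f' \<in> carrier_mat r n" "f * f' = E" "f' * f = 1\<^sub>m r"
    by (rule idem_factor[OF E EE])
  have "idem_rank (P * f * (f' * Q)) = r"
    using f P by (intro idem_rank_eq[where n = n]) (auto simp: mult_assoc_dim P(3)[THEN mult_eq_assoc])
  moreover have "P * f * (f' * Q) = P * E * Q"
    unfolding f(3)[symmetric] using f(1,2) P by (simp add: mult_assoc_dim)
  ultimately show ?thesis using idem_rank_eq[OF f(1,2,4)] f(3) by simp
qed

subsection \<open>Modules, submodules and quotients\<close>

text \<open>The linear combination of matrices with coefficients \<open>c\<close>. The size is an
  argument because there is no zero matrix of unspecified size to start a sum with.\<close>

definition lincomb :: "nat \<Rightarrow> nat \<Rightarrow> nat \<Rightarrow> (nat \<Rightarrow> 'a) \<Rightarrow> (nat \<Rightarrow> 'a mat) \<Rightarrow> 'a::field mat" where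
  "lincomb d n m c A = mat n m (\<lambda>(i, j). \<Sum>k<d. c k * A k $$ (i, j))"

lemma lincomb_carrier [simp]: "lincomb d n m c A \<in> carrier_mat n m"
  by (simp add: lincomb_def)

lemma dim_lincomb [simp]: "dim_row (lincomb d n m c A) = n" "dim_col (lincomb d n m c A) = m"
  by (simp_all add: lincomb_def)

lemma lincomb_index [simp]: "i < n \<Longrightarrow> j < m \<Longrightarrow> lincomb d n m c A $$ (i, j) = (\<Sum>k<d. c k * A k $$ (i, j))"
  by (simp add: lincomb_def)

lemma lincomb_cong: "(\<And>k. k < d \<Longrightarrow> A k = B k) \<Longrightarrow> (\<And>k. k < d \<Longrightarrow> c k = c' k) \<Longrightarrow> lincomb d n m c A = lincomb d n m c' B"
  by (rule eq_matI) auto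

lemma mult_lincomb:
  assumes X: "X \<in> carrier_mat r n" and A: "\<And>k. k < d \<Longrightarrow> A k \<in> carrier_mat n m"
  shows "X * lincomb d n m c A = lincomb d r m c (\<lambda>k. X * A k)"
proof (rule eq_matI)
  fix i j assume "i < dim_row (lincomb d r m c (\<lambda>k. X * A k))" "j < dim_col (lincomb d r m c (\<lambda>k. X * A k))"
  then have ij: "i < r" "j < m" by auto
  have "(X * lincomb d n m c A) $$ (i, j) = (\<Sum>l<n. \<Sum>k<d. c k * (X $$ (i, l) * A k $$ (l, j)))"
    using ij by (subst mult_index_carrier[OF X lincomb_carrier]) (auto simp: sum_distrib_left mult_ac intro!: sum.cong)
  also have "\<dots> = (\<Sum>k<d. c k * (\<Sum>l<n. X $$ (i, l) * A k $$ (l, j)))"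
    by (subst sum.swap) (simp add: sum_distrib_left)
  also have "\<dots> = (\<Sum>k<d. c k * (X * A k) $$ (i, j))"
    using ij by (auto simp: mult_index_carrier[OF X A] simp del: index_mult_mat(1) intro!: sum.cong)
  finally show "(X * lincomb d n m c A) $$ (i, j) = lincomb d r m c (\<lambda>k. X * A k) $$ (i, j)"
    using ij by simp
qed (use X in auto)

lemma lincomb_mult:
  assumes Y: "Y \<in> carrier_mat m r" and A: "\<And>k. k < d \<Longrightarrow> A k \<in> carrier_mat n m"
  shows "lincomb d n m c A * Y = lincomb d n r c (\<lambda>k. A k * Y)"
proof (rule eq_matI)
  fix i j assume "i < dim_row (lincomb d n r c (\<lambda>k. A k * Y))" "j < dim_col (lincomb d n r c (\<lambda>k. A k * Y))"
  then have ij: "i < n" "j < r" by auto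
  have "(lincomb d n m c A * Y) $$ (i, j) = (\<Sum>l<m. \<Sum>k<d. c k * (A k $$ (i, l) * Y $$ (l, j)))"
    using ij by (subst mult_index_carrier[OF lincomb_carrier Y]) (auto simp: sum_distrib_right sum_distrib_left mult_ac intro!: sum.cong)
  also have "\<dots> = (\<Sum>k<d. c k * (\<Sum>l<m. A k $$ (i, l) * Y $$ (l, j)))"
    by (subst sum.swap) (simp add: sum_distrib_left)
  also have "\<dots> = (\<Sum>k<d. c k * (A k * Y) $$ (i, j))"
    using ij by (auto simp: mult_index_carrier[OF A Y] simp del: index_mult_mat(1) intro!: sum.cong)
  finally show "(lincomb d n m c A * Y) $$ (i, j) = lincomb d n r c (\<lambda>k. A k * Y) $$ (i, j)"
    using ij by simp
qed (use Y in auto)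

lemma right_inverse_if_surj:
  fixes g :: "'a::field mat"
  assumes g: "g \<in> carrier_mat w n" and s: "surj_mat g"
  obtains g' where "g' \<in> carrier_mat n w" "g * g' = 1\<^sub>m w"
proof -
  have "\<exists>v\<in>carrier_vec n. g *\<^sub>v v = col (1\<^sub>m w) j" if "j < w" for j
    using s g that unfolding surj_mat_def by (metis carrier_matD col_one unit_vec_carrier)
  then obtain X where "X \<in> carrier_mat n w" "g * X = 1\<^sub>m w"
    by (rule mat_from_cols[OF g one_carrier_mat])
  then show ?thesis by (rule that)
qed

lemma surj_if_right_inverse:
  fixes g :: "'a::field mat"
  assumes "g \<in> carrier_mat w n" "g' \<in> carrier_mat n w" "g * g' = 1\<^sub>m w"
  shows "surj_mat g"
  unfolding surj_mat_def
proof
  fix x assume x: "(x :: 'a vec) \<in> carrier_vec (dim_row g)"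
  then have "g *\<^sub>v (g' *\<^sub>v x) = x" using assms by (metis assoc_mult_mat_vec carrier_matD(1) one_mult_mat_vec)
  then show "\<exists>v\<in>carrier_vec (dim_col g). g *\<^sub>v v = x"
    using assms x by (metis carrier_matD mult_mat_vec_carrier)
qed

lemma ex_nonzero_mult_vec:
  fixes A :: "'a::field mat"
  assumes A: "A \<in> carrier_mat n m" "A \<noteq> 0\<^sub>m n m"
  obtains v where "v \<in> carrier_vec m" "A *\<^sub>v v \<noteq> 0\<^sub>v n"
proof -
  have "(0\<^sub>m n m :: 'a mat) *\<^sub>v v = 0\<^sub>v n" if "v \<in> carrier_vec m" for v
    using that by (intro eq_vecI) (auto simp: scalar_prod_def)
  then show ?thesis using mat_eq_if_cols[OF A(1) zero_carrier_mat] A(2) that by metis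
qed

section \<open>Actions, homomorphisms, submodules and quotients\<close>

context hopf_alg
begin

definition act :: "'k rep \<Rightarrow> (nat \<Rightarrow> 'k) \<Rightarrow> 'k mat" where
  "act M a = lincomb d (fst M) (fst M) a (snd M)"

definition amul :: "(nat \<Rightarrow> 'k) \<Rightarrow> (nat \<Rightarrow> 'k) \<Rightarrow> nat \<Rightarrow> 'k" where
  "amul a b k = (\<Sum>i<d. \<Sum>j<d. a i * b j * hmu H i j k)"

lemma act_carrier [simp]: "act M a \<in> carrier_mat (fst M) (fst M)"
  by (simp add: act_def)

lemma dim_act [simp]: "dim_row (act M a) = fst M" "dim_col (act M a) = fst M"
  by (simp_all add: act_def)

lemma is_module_iff: "is_module H M \<longleftrightarrow> (\<forall>i<d. snd M i \<in> carrier_mat (fst M) (fst M)) \<and>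
    (\<forall>i<d. \<forall>j<d. snd M i * snd M j = act M (hmu H i j)) \<and> act M (hunit H) = 1\<^sub>m (fst M)"
  by (simp add: is_module_def act_def lincomb_def Let_def)

lemma module_carrier: "is_module H M \<Longrightarrow> i < d \<Longrightarrow> snd M i \<in> carrier_mat (fst M) (fst M)"
  and module_mult: "is_module H M \<Longrightarrow> i < d \<Longrightarrow> j < d \<Longrightarrow> snd M i * snd M j = act M (hmu H i j)"
  and module_unit: "is_module H M \<Longrightarrow> act M (hunit H) = 1\<^sub>m (fst M)"
  by (auto simp: is_module_iff)

lemma module_dims: "is_module H M \<Longrightarrow> i < d \<Longrightarrow> dim_row (snd M i) = fst M"
   "is_module H M \<Longrightarrow> i < d \<Longrightarrow> dim_col (snd M i) = fst M"
  by (drule (1) module_carrier, simp)+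

lemma act_mult:
  assumes M: "is_module H M"
  shows "act M a * act M b = act M (amul a b)"
proof -
  have "act M a * act M b = lincomb d (fst M) (fst M) a (\<lambda>i. snd M i * act M b)"
    unfolding act_def[of M a] by (rule lincomb_mult) (use M module_carrier in auto)
  also have "\<dots> = lincomb d (fst M) (fst M) a (\<lambda>i. lincomb d (fst M) (fst M) b (\<lambda>j. act M (hmu H i j)))"
    unfolding act_def[of M b] by (intro lincomb_cong refl) (use M in \<open>simp add: mult_lincomb[OF module_carrier module_carrier] module_mult cong: lincomb_cong\<close>)
  also have "\<dots> = act M (amul a b)"
  proof (rule eq_matI)
    fix r c assume "r < dim_row (act M (amul a b))" "c < dim_col (act M (amul a b))"
    then have rc: "r < fst M" "c < fst M" by auto
    have "(\<Sum>i<d. a i * (\<Sum>j<d. b j * (\<Sum>k<d. hmu H i j k * snd M k $$ (r, c))))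
      = (\<Sum>i<d. \<Sum>j<d. \<Sum>k<d. a i * b j * hmu H i j k * snd M k $$ (r, c))"
      by (simp add: sum_distrib_left mult_ac)
    also have "\<dots> = (\<Sum>i<d. \<Sum>k<d. \<Sum>j<d. a i * b j * hmu H i j k * snd M k $$ (r, c))"
      by (rule sum.cong[OF refl], rule sum.swap)
    also have "\<dots> = (\<Sum>k<d. \<Sum>i<d. \<Sum>j<d. a i * b j * hmu H i j k * snd M k $$ (r, c))"
      by (rule sum.swap)
    also have "\<dots> = (\<Sum>k<d. amul a b k * snd M k $$ (r, c))"
      by (simp add: amul_def sum_distrib_right)
    finally show "lincomb d (fst M) (fst M) a (\<lambda>i. lincomb d (fst M) (fst M) b (\<lambda>j. act M (hmu H i j))) $$ (r, c)
       = act M (amul a b) $$ (r, c)"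
      using rc by (simp add: act_def)
  qed auto
  finally show ?thesis .
qed

lemma hom_carrier: "mod_hom H M N f \<Longrightarrow> f \<in> carrier_mat (fst N) (fst M)"
  and hom_comm: "mod_hom H M N f \<Longrightarrow> i < d \<Longrightarrow> f * snd M i = snd N i * f"
  by (auto simp: mod_hom_def)

lemma hom_act:
  assumes f: "mod_hom H M N f" and "is_module H M" "is_module H N"
  shows "f * act M a = act N a * f"
  unfolding act_def using assms
  by (simp add: mult_lincomb[OF hom_carrier[OF f]] lincomb_mult[OF hom_carrier[OF f]] module_carrier hom_comm cong: lincomb_cong)

lemma mod_hom_comp:
  assumes "is_module H M" "is_module H N" "is_module H L" "mod_hom H M N f" "mod_hom H N L g"
  shows "mod_hom H M L (g * f)"
  unfolding mod_hom_def
proof (intro conjI allI impI)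
  note c = hom_carrier[OF assms(4)] hom_carrier[OF assms(5)]
  show "g * f \<in> carrier_mat (fst L) (fst M)" using c by auto
  fix i assume i: "i < d"
  have "g * f * snd M i = g * (snd N i * f)"
    using c i assms by (simp add: mult_assoc_dim module_dims hom_comm)
  also have "\<dots> = snd L i * (g * f)"
    using c i assms by (simp add: mult_assoc_dim[symmetric] module_dims hom_comm)
  finally show "g * f * snd M i = snd L i * (g * f)" .
qed

lemma mod_hom_id: "is_module H M \<Longrightarrow> mod_hom H M M (1\<^sub>m (fst M))"
  by (auto simp: mod_hom_def module_dims)

lemma mod_hom_minus:
  assumes "is_module H M" "is_module H N" "mod_hom H M N f" "mod_hom H M N g"
  shows "mod_hom H M N (f - g)"
  using assms by (auto simp: mod_hom_def minus_mult_dim mult_minus_dim module_dims minus_carrier_mat)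

lemma mod_hom_smult:
  assumes "is_module H M" "is_module H N" "mod_hom H M N f"
  shows "mod_hom H M N (c \<cdot>\<^sub>m f)"
  unfolding mod_hom_def
proof (intro conjI allI impI)
  note cf = hom_carrier[OF assms(3)]
  show "c \<cdot>\<^sub>m f \<in> carrier_mat (fst N) (fst M)" using cf by auto
  fix i assume "i < d"
  then show "c \<cdot>\<^sub>m f * snd M i = snd N i * (c \<cdot>\<^sub>m f)"
    using mult_smult_assoc_mat[OF cf module_carrier[OF assms(1)], of i c] mult_smult_distrib[OF module_carrier[OF assms(2)] cf, of i c]
    by (simp add: hom_comm[OF assms(3)])
qed

lemma mod_hom_pow:
  assumes "is_module H M" "mod_hom H M M f"
  shows "mod_hom H M M (f ^\<^sub>m k)"
proof (induction k)
  case 0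
  then show ?case using assms mod_hom_id hom_carrier[OF assms(2)] by simp
next
  case (Suc k)
  have "f ^\<^sub>m Suc k = f ^\<^sub>m k * f" by simp
  then show ?case using mod_hom_comp[OF assms(1,1,1) assms(2) Suc] by simp
qed

text \<open>The compression of a module along \<open>X Y = 1\<close> covers both submodules and quotients.\<close>
lemma is_module_compress:
  assumes M: "is_module H M" and X: "X \<in> carrier_mat r (fst M)" and Y: "Y \<in> carrier_mat (fst M) r"
    and XY: "X * Y = 1\<^sub>m r"
    and comp: "\<And>i j. i < d \<Longrightarrow> j < d \<Longrightarrow> X * (snd M i * (Y * (X * (snd M j * Y)))) = X * (snd M i * (snd M j * Y))"
  shows "is_module H (r, \<lambda>i. X * (snd M i * Y))"
proof -
  have act: "act (r, \<lambda>i. X * (snd M i * Y)) a = X * (act M a * Y)" for a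
    unfolding act_def using M
    by (simp add: lincomb_mult[OF Y module_carrier] mult_lincomb[OF X] module_carrier mult_carrier_mat[OF module_carrier Y])
  show ?thesis unfolding is_module_iff
  proof (intro conjI allI impI)
    fix i j assume ij: "i < d" "j < d"
    show "snd (r, \<lambda>i. X * (snd M i * Y)) i \<in> carrier_mat (fst (r, \<lambda>i. X * (snd M i * Y))) (fst (r, \<lambda>i. X * (snd M i * Y)))"
      using ij M X Y module_carrier[OF M] by auto
    have "X * (snd M i * Y) * (X * (snd M j * Y)) = X * (snd M i * (snd M j * Y))"
      using ij X Y comp[OF ij] by (simp add: mult_assoc_dim module_dims M)
    also have "\<dots> = X * (act M (hmu H i j) * Y)"
      using ij X Y module_mult[OF M ij, THEN mult_eq_assoc, of Y] by (simp add: module_dims M)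
    finally show "snd (r, \<lambda>i. X * (snd M i * Y)) i * snd (r, \<lambda>i. X * (snd M i * Y)) j
      = act (r, \<lambda>i. X * (snd M i * Y)) (hmu H i j)"
      unfolding act by simp
  next
    show "act (r, \<lambda>i. X * (snd M i * Y)) (hunit H) = 1\<^sub>m (fst (r, \<lambda>i. X * (snd M i * Y)))"
      unfolding act using X Y by (simp add: module_unit[OF M] XY)
  qed
qed

text \<open>A linear factorisation of \<open>E\<close> consists of module maps as soon as
  \<open>E\<close> commutes with the action, because \<open>E * a = a\<close> and
  \<open>a' * E = a'\<close>.\<close>

lemma summand_module:
  assumes M: "is_module H M" and E: "mod_hom H M M E" and EE: "E * E = E"
  obtains U a a' where "is_module H U" "mod_hom H U M a" "mod_hom H M U a'" "a * a' = E" "a' * a = 1\<^sub>m (fst U)"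
proof -
  obtain r a a' where a: "a \<in> carrier_mat (fst M) r" "a' \<in> carrier_mat r (fst M)" "a * a' = E" "a' * a = 1\<^sub>m r"
    by (rule idem_factor[OF hom_carrier[OF E] EE])
  let ?U = "(r, \<lambda>i. a' * (snd M i * a))"
  have Ea: "E * a = a" unfolding a(3)[symmetric] using a(1,2,4) by (simp add: mult_assoc_dim)
  have a'E: "a' * E = a'" unfolding a(3)[symmetric] using a(1,2,4) by (simp add: mult_assoc_dim[symmetric])
  have k1: "a * (a' * (snd M i * a)) = snd M i * a" if i: "i < d" for i
  proof -
    have "a * (a' * (snd M i * a)) = E * snd M i * a"
      unfolding a(3)[symmetric] using a(1,2) i by (simp add: mult_assoc_dim module_dims M)
    also have "\<dots> = snd M i * a"
      unfolding hom_comm[OF E i] using a(1,2) i hom_carrier[OF E] by (simp add: mult_assoc_dim module_dims M Ea)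
    finally show ?thesis .
  qed
  have k2: "a' * (snd M i * (a * a')) = a' * snd M i" if i: "i < d" for i
  proof -
    have "a' * (snd M i * (a * a')) = a' * E * snd M i"
      unfolding a(3) hom_comm[OF E i, symmetric] using a(1,2) i hom_carrier[OF E] by (simp add: mult_assoc_dim module_dims M)
    then show ?thesis unfolding a'E .
  qed
  show ?thesis
  proof (rule that)
    show "is_module H ?U"
      by (rule is_module_compress[OF M a(2,1,4)]) (simp add: k1)
    show "mod_hom H ?U M a" unfolding mod_hom_def using a(1) by (auto simp: k1)
    show "mod_hom H M ?U a'" unfolding mod_hom_def
      using a(1,2) by (auto simp: k2[symmetric] mult_assoc_dim module_dims M)
    show "a * a' = E" "a' * a = 1\<^sub>m (fst ?U)" using a by auto
  qed
qed

lemma inv_subspaceD: "inv_subspace H M W \<Longrightarrow> subspace_vec (fst M) W"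
  by (simp add: inv_subspace_def subspace_vec_def)

text \<open>Exactness in the matrix-split form: the maps \<open>f'\<close> and \<open>g'\<close> are only linear.\<close>
definition split_exact :: "'k rep \<Rightarrow> 'k rep \<Rightarrow> 'k rep \<Rightarrow> 'k mat \<Rightarrow> 'k mat \<Rightarrow> 'k mat \<Rightarrow> 'k mat \<Rightarrow> bool" where
  "split_exact U V W f g f' g' \<longleftrightarrow> is_module H U \<and> is_module H V \<and> is_module H W \<and>
     mod_hom H U V f \<and> mod_hom H V W g \<and> f' \<in> carrier_mat (fst U) (fst V) \<and> g' \<in> carrier_mat (fst V) (fst W) \<and>
     f' * f = 1\<^sub>m (fst U) \<and> g * g' = 1\<^sub>m (fst W) \<and> g * f = 0\<^sub>m (fst W) (fst U) \<and> f * f' + g' * g = 1\<^sub>m (fst V)"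

text \<open>Invariance of W means that \<open>f * f'\<close> fixes \<open>snd M i * f\<close>.
  Consequently \<open>g\<close> annihilates \<open>snd M i * f\<close>, and the compressions to W
  and to a linear complement carry the submodule and the quotient structure.\<close>

lemma inv_subspace_split:
  assumes M: "is_module H M" and W: "inv_subspace H M W"
  obtains U Q f g f' g' where "split_exact U M Q f g f' g'" "W = {f *\<^sub>v v | v. v \<in> carrier_vec (fst U)}"
proof -
  obtain r f f' where f: "f \<in> carrier_mat (fst M) r" "f' \<in> carrier_mat r (fst M)" "f' * f = 1\<^sub>m r"
    and im: "\<And>v. v \<in> carrier_vec r \<Longrightarrow> f *\<^sub>v v \<in> W" and fx: "\<And>w. w \<in> W \<Longrightarrow> f *\<^sub>v (f' *\<^sub>v w) = w"
    by (rule subspace_factor[OF inv_subspaceD[OF W]]) blast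
  obtain s g g' where g: "g \<in> carrier_mat s (fst M)" "g' \<in> carrier_mat (fst M) s" "g * g' = 1\<^sub>m s" "g * f = 0\<^sub>m s r"
    "f * f' + g' * g = 1\<^sub>m (fst M)"
    by (rule idem_complement[OF f])
  have WM: "W \<subseteq> carrier_vec (fst M)" using W by (simp add: inv_subspace_def)
  have k1: "f * (f' * (snd M i * f)) = snd M i * f" if i: "i < d" for i
  proof (rule mat_eq_if_cols)
    show "f * (f' * (snd M i * f)) \<in> carrier_mat (fst M) r" "snd M i * f \<in> carrier_mat (fst M) r"
      using f module_carrier[OF M i] by auto
    fix v :: "'k vec" assume v: "v \<in> carrier_vec r"
    have c: "snd M i * f \<in> carrier_mat (fst M) r" "f' * (snd M i * f) \<in> carrier_mat r r" using f module_carrier[OF M i] by auto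
    have "(snd M i * f) *\<^sub>v v = snd M i *\<^sub>v (f *\<^sub>v v)"
      by (rule assoc_mult_mat_vec[OF module_carrier[OF M i] f(1) v])
    also have "\<dots> \<in> W" using W im[OF v] i by (simp add: inv_subspace_def)
    finally have "f *\<^sub>v (f' *\<^sub>v ((snd M i * f) *\<^sub>v v)) = (snd M i * f) *\<^sub>v v" by (rule fx)
    then show "(f * (f' * (snd M i * f))) *\<^sub>v v = (snd M i * f) *\<^sub>v v"
      by (simp only: assoc_mult_mat_vec[OF f(1) c(2) v] assoc_mult_mat_vec[OF f(2) c(1) v])
  qed
  have gsf: "g * (snd M i * f) = 0\<^sub>m s r" if i: "i < d" for i
  proof -
    have "g * (snd M i * f) = g * f * (f' * (snd M i * f))"
      using f(1,2) g(1) i k1[OF i] by (simp add: mult_assoc_dim module_dims M)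
    then show ?thesis unfolding g(4) using f i by (simp add: module_dims M)
  qed
  have k2: "g * (snd M i * (g' * g)) = g * snd M i" if i: "i < d" for i
  proof -
    have "g * snd M i = g * (snd M i * (f * f' + g' * g))"
      unfolding g(5) using g(1) i by (simp add: module_dims M)
    also have "\<dots> = g * (snd M i * f) * f' + g * (snd M i * (g' * g))"
      using g(1,2) f(1,2) i by (simp add: module_dims M mult_plus_dim mult_assoc_dim)
    also have "\<dots> = g * (snd M i * (g' * g))"
      unfolding gsf[OF i] using f g(1,2) by (intro eq_matI) auto
    finally show ?thesis by simp
  qed
  let ?U = "(r, \<lambda>i. f' * (snd M i * f))" and ?Q = "(s, \<lambda>i. g * (snd M i * g'))"
  have "split_exact ?U M ?Q f g f' g'" unfolding split_exact_def fst_conv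
  proof (intro conjI)
    show "is_module H ?U"
      by (rule is_module_compress[OF M f(2,1,3)]) (simp add: k1)
    show "is_module H ?Q"
    proof (rule is_module_compress[OF M g(1,2,3)])
      fix i j assume ij: "i < d" "j < d"
      have "g * (snd M i * (g' * (g * (snd M j * g')))) = g * (snd M i * (g' * g)) * (snd M j * g')"
        using g(1,2) ij by (simp add: module_dims M mult_assoc_dim)
      then show "g * (snd M i * (g' * (g * (snd M j * g')))) = g * (snd M i * (snd M j * g'))"
        unfolding k2[OF ij(1)] using g(1,2) ij by (simp add: module_dims M mult_assoc_dim)
    qed
    show "mod_hom H ?U M f" unfolding mod_hom_def using f(1) by (auto simp: k1)
    show "mod_hom H M ?Q g" unfolding mod_hom_def
      using g(1,2) by (auto simp: k2[symmetric] mult_assoc_dim module_dims M)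
  qed (use f g M in auto)
  moreover have "W = {f *\<^sub>v v | v. v \<in> carrier_vec (fst ?U)}"
  proof
    show "{f *\<^sub>v v | v. v \<in> carrier_vec (fst ?U)} \<subseteq> W" using im by auto
    show "W \<subseteq> {f *\<^sub>v v | v. v \<in> carrier_vec (fst ?U)}"
    proof
      fix w assume w: "w \<in> W"
      then have "f' *\<^sub>v w \<in> carrier_vec r" using WM f(2) by auto
      then show "w \<in> {f *\<^sub>v v | v. v \<in> carrier_vec (fst ?U)}"
        using fx[OF w] by (auto intro!: exI[of _ "f' *\<^sub>v w"])
    qed
  qed
  ultimately show ?thesis by (rule that)
qed

lemma inv_subspace_image:
  assumes M: "is_module H M" and N: "is_module H N" and f: "mod_hom H M N f"
    and W: "inv_subspace H M W"
  shows "inv_subspace H N {f *\<^sub>v v | v. v \<in> W}"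
proof -
  note fc = hom_carrier[OF f]
  have WM: "\<And>v. v \<in> W \<Longrightarrow> v \<in> carrier_vec (fst M)" using W by (auto simp: inv_subspace_def)
  show ?thesis unfolding inv_subspace_def
  proof (intro conjI ballI allI impI)
    show "{f *\<^sub>v v | v. v \<in> W} \<subseteq> carrier_vec (fst N)" using fc WM by auto
    show "0\<^sub>v (fst N) \<in> {f *\<^sub>v v | v. v \<in> W}"
      using mult_zero_vec[OF fc] W unfolding inv_subspace_def by (metis (mono_tags, lifting) mem_Collect_eq)
    fix x assume "x \<in> {f *\<^sub>v v | v. v \<in> W}"
    then obtain v where v: "v \<in> W" "x = f *\<^sub>v v" by blast
    { fix y assume "y \<in> {f *\<^sub>v v | v. v \<in> W}"
      then obtain w where w: "w \<in> W" "y = f *\<^sub>v w" by blast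
      have "x + y = f *\<^sub>v (v + w)" using mult_add_distrib_mat_vec[OF fc WM[OF v(1)] WM[OF w(1)]] v w by simp
      then show "x + y \<in> {f *\<^sub>v v | v. v \<in> W}" using W v w by (auto simp: inv_subspace_def) }
    { fix c
      have "c \<cdot>\<^sub>v x = f *\<^sub>v (c \<cdot>\<^sub>v v)" using mult_mat_vec[OF fc WM[OF v(1)]] v by simp
      then show "c \<cdot>\<^sub>v x \<in> {f *\<^sub>v v | v. v \<in> W}" using W v by (auto simp: inv_subspace_def) }
    { fix i assume i: "i < d"
      have "snd N i *\<^sub>v x = (snd N i * f) *\<^sub>v v"
        unfolding v(2) by (rule assoc_mult_mat_vec[OF module_carrier[OF N i] fc WM[OF v(1)], symmetric])
      also have "\<dots> = f *\<^sub>v (snd M i *\<^sub>v v)"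
        unfolding hom_comm[OF f i, symmetric] by (rule assoc_mult_mat_vec[OF fc module_carrier[OF M i] WM[OF v(1)]])
      finally show "snd N i *\<^sub>v x \<in> {f *\<^sub>v v | v. v \<in> W}" using W v i by (auto simp: inv_subspace_def) }
  qed
qed

lemma inv_subspace_kernel:
  assumes M: "is_module H M" and N: "is_module H N" and f: "mod_hom H M N f"
  shows "inv_subspace H M {v \<in> carrier_vec (fst M). f *\<^sub>v v = 0\<^sub>v (fst N)}"
proof -
  note fc = hom_carrier[OF f]
  show ?thesis unfolding inv_subspace_def
  proof (intro conjI ballI allI impI)
    show "0\<^sub>v (fst M) \<in> {v \<in> carrier_vec (fst M). f *\<^sub>v v = 0\<^sub>v (fst N)}"
      using mult_zero_vec[OF fc] by simp
    fix x assume x: "x \<in> {v \<in> carrier_vec (fst M). f *\<^sub>v v = 0\<^sub>v (fst N)}"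
    { fix y assume "y \<in> {v \<in> carrier_vec (fst M). f *\<^sub>v v = 0\<^sub>v (fst N)}"
      then show "x + y \<in> {v \<in> carrier_vec (fst M). f *\<^sub>v v = 0\<^sub>v (fst N)}"
        using x mult_add_distrib_mat_vec[OF fc, of x y] by auto }
    { fix c show "c \<cdot>\<^sub>v x \<in> {v \<in> carrier_vec (fst M). f *\<^sub>v v = 0\<^sub>v (fst N)}"
        using x mult_mat_vec[OF fc, of x c] by auto }
    { fix i assume i: "i < d"
      have "f *\<^sub>v (snd M i *\<^sub>v x) = (f * snd M i) *\<^sub>v x"
        using x by (intro assoc_mult_mat_vec[OF fc module_carrier[OF M i], symmetric]) auto
      also have "\<dots> = snd N i *\<^sub>v (f *\<^sub>v x)"
        unfolding hom_comm[OF f i] using x by (intro assoc_mult_mat_vec[OF module_carrier[OF N i] fc]) auto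
      also have "\<dots> = 0\<^sub>v (fst N)" using x mult_zero_vec[OF module_carrier[OF N i]] by simp
      finally show "snd M i *\<^sub>v x \<in> {v \<in> carrier_vec (fst M). f *\<^sub>v v = 0\<^sub>v (fst N)}"
        using x module_carrier[OF M i] by auto }
  qed auto
qed

lemma inv_subspace_full: "is_module H M \<Longrightarrow> inv_subspace H M (carrier_vec (fst M))"
  unfolding inv_subspace_def by (auto intro: mult_mat_vec_carrier[OF module_carrier])

end

subsection \<open>Simple modules and projective covers\<close>

lemma zero_mult_vec: "v \<in> carrier_vec m \<Longrightarrow> 0\<^sub>m n m *\<^sub>v v = (0\<^sub>v n :: 'a::field vec)"
  by (intro eq_vecI) (auto simp: scalar_prod_def)

context hopf_alg
begin

lemma simple_hom_surj:
  assumes M: "is_module H M" and S: "simple_mod H S" and f: "mod_hom H M S f" and nz: "f \<noteq> 0\<^sub>m (fst S) (fst M)"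
  shows "surj_mat f"
proof -
  have Sm: "is_module H S" using S by (simp add: simple_mod_def)
  let ?W = "{f *\<^sub>v v | v. v \<in> carrier_vec (fst M)}"
  have "inv_subspace H S ?W"
    by (rule inv_subspace_image[OF M Sm f inv_subspace_full[OF M]])
  then have "?W = {0\<^sub>v (fst S)} \<or> ?W = carrier_vec (fst S)" using S by (simp add: simple_mod_def)
  moreover obtain v where "v \<in> carrier_vec (fst M)" "f *\<^sub>v v \<noteq> 0\<^sub>v (fst S)"
    by (rule ex_nonzero_mult_vec[OF hom_carrier[OF f] nz])
  ultimately have "?W = carrier_vec (fst S)" by blast
  then have "\<exists>v\<in>carrier_vec (fst M). f *\<^sub>v v = w" if "w \<in> carrier_vec (fst S)" for w
  proof -
    have "w \<in> ?W" using that \<open>?W = carrier_vec (fst S)\<close> by simp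
    then show ?thesis by blast
  qed
  then show ?thesis unfolding surj_mat_def using hom_carrier[OF f] by auto
qed

lemma hom_right_cancel:
  fixes f :: "'k mat"
  assumes f: "f \<in> carrier_mat n m" "surj_mat f" and c: "x \<in> carrier_mat r n" "y \<in> carrier_mat r n" and e: "x * f = y * f"
  shows "x = y"
proof -
  obtain f' where f': "f' \<in> carrier_mat m n" "f * f' = 1\<^sub>m n" by (rule right_inverse_if_surj[OF f])
  have "x * f * f' = y * f * f'" using e by simp
  then show ?thesis using f(1) c f' by (simp add: mult_assoc_dim)
qed

text \<open>Equivariance of \<open>h\<close> is checked after composing with the surjection
  \<open>f\<close>, which can be cancelled.\<close>

lemma hom_descend:
  assumes M: "is_module H M" "is_module H S" "is_module H N"
    and f: "mod_hom H M S f" "surj_mat f" and g: "mod_hom H M N g" and h: "h \<in> carrier_mat (fst N) (fst S)" "h * f = g"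
  shows "mod_hom H S N h"
  unfolding mod_hom_def
proof (intro conjI allI impI)
  fix i assume i: "i < d"
  note fc = hom_carrier[OF f(1)]
  have "h * snd S i * f = h * (f * snd M i)"
    using h(1) fc i M by (simp add: mult_assoc_dim module_dims hom_comm[OF f(1) i])
  also have "\<dots> = g * snd M i" using h fc i M by (simp add: mult_assoc_dim[symmetric] module_dims)
  also have "\<dots> = snd N i * g" by (rule hom_comm[OF g i])
  also have "\<dots> = snd N i * h * f" unfolding h(2)[symmetric]
    using h(1) fc i M by (simp add: mult_assoc_dim module_dims)
  finally have e: "h * snd S i * f = snd N i * h * f" .
  have "h * snd S i \<in> carrier_mat (fst N) (fst S)" "snd N i * h \<in> carrier_mat (fst N) (fst S)"
    using h(1) module_carrier[OF M(2) i] module_carrier[OF M(3) i] by auto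
  then show "h * snd S i = snd N i * h" using e by (rule hom_right_cancel[OF fc f(2)])
qed (rule h(1))

lemma simple_hom_iso:
  assumes S: "simple_mod H S" and S': "simple_mod H S'" and h: "mod_hom H S S' h" and nz: "h \<noteq> 0\<^sub>m (fst S') (fst S)"
  shows "mod_iso H S S'"
proof -
  have m: "is_module H S" "is_module H S'" using S S' by (auto simp: simple_mod_def)
  note hc = hom_carrier[OF h]
  obtain h' where h': "h' \<in> carrier_mat (fst S) (fst S')" "h * h' = 1\<^sub>m (fst S')"
    by (rule right_inverse_if_surj[OF hc simple_hom_surj[OF m(1) S' h nz]])
  let ?K = "{v \<in> carrier_vec (fst S). h *\<^sub>v v = 0\<^sub>v (fst S')}"
  obtain v where "v \<in> carrier_vec (fst S)" "h *\<^sub>v v \<noteq> 0\<^sub>v (fst S')"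
    by (rule ex_nonzero_mult_vec[OF hc nz])
  then have K: "?K = {0\<^sub>v (fst S)}"
    using S inv_subspace_kernel[OF m h] unfolding simple_mod_def by blast
  have "h' * h = 1\<^sub>m (fst S)"
  proof (rule mat_eq_if_cols)
    fix v :: "'k vec" assume v: "v \<in> carrier_vec (fst S)"
    have c: "(h' * h) *\<^sub>v v \<in> carrier_vec (fst S)" using h' hc v by auto
    have e: "h *\<^sub>v ((h' * h) *\<^sub>v v) = h *\<^sub>v v"
    proof -
      have "h *\<^sub>v ((h' * h) *\<^sub>v v) = (h * (h' * h)) *\<^sub>v v"
        using h' hc v by (intro assoc_mult_mat_vec[symmetric]) auto
      also have "h * (h' * h) = h" using h' hc by (simp add: h'(2)[THEN mult_eq_assoc])
      finally show ?thesis .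
    qed
    have "(h' * h) *\<^sub>v v - v \<in> ?K"
      using c v e mult_minus_distrib_mat_vec[OF hc c v] hc by auto
    then have z: "(h' * h) *\<^sub>v v - v = 0\<^sub>v (fst S)" using K by blast
    have "(h' * h) *\<^sub>v v = v" by (rule vec_eq_if_minus_zero[OF c v z])
    then show "(h' * h) *\<^sub>v v = 1\<^sub>m (fst S) *\<^sub>v v" using v by simp
  qed (use h' hc in auto)
  with h h' show ?thesis unfolding mod_iso_def by blast
qed

lemma indecomposable_idem:
  assumes P: "indecomposable_mod H P" and E: "mod_hom H P P E" and EE: "E * E = E"
  shows "E = 0\<^sub>m (fst P) (fst P) \<or> E = 1\<^sub>m (fst P)"
proof -
  have M: "is_module H P" using P by (simp add: indecomposable_mod_def)
  note Ec = hom_carrier[OF E]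
  let ?F = "1\<^sub>m (fst P) - E"
  have F: "mod_hom H P P ?F" by (rule mod_hom_minus[OF M M mod_hom_id[OF M] E])
  have FE: "?F * E = 0\<^sub>m (fst P) (fst P)" and EF: "E * ?F = 0\<^sub>m (fst P) (fst P)"
    using Ec EE by (simp_all add: minus_mult_dim mult_minus_dim)
  have EpF: "x = E *\<^sub>v x + ?F *\<^sub>v x" if "x \<in> carrier_vec (fst P)" for x
    using Ec that minus_mult_distrib_mat_vec[OF one_carrier_mat Ec that] by (intro eq_vecI) (auto)
  define W1 where "W1 = {E *\<^sub>v v | v. v \<in> carrier_vec (fst P)}"
  define W2 where "W2 = {?F *\<^sub>v v | v. v \<in> carrier_vec (fst P)}"
  have i1: "inv_subspace H P W1" unfolding W1_def by (rule inv_subspace_image[OF M M E inv_subspace_full[OF M]])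
  have i2: "inv_subspace H P W2" unfolding W2_def by (rule inv_subspace_image[OF M M F inv_subspace_full[OF M]])
  have "W1 \<inter> W2 = {0\<^sub>v (fst P)}"
  proof
    show "{0\<^sub>v (fst P)} \<subseteq> W1 \<inter> W2" using i1 i2 by (auto simp: inv_subspace_def)
    show "W1 \<inter> W2 \<subseteq> {0\<^sub>v (fst P)}"
    proof
      fix x assume "x \<in> W1 \<inter> W2"
      then obtain v w where v: "v \<in> carrier_vec (fst P)" "x = E *\<^sub>v v" and w: "w \<in> carrier_vec (fst P)" "x = ?F *\<^sub>v w"
        by (auto simp: W1_def W2_def)
      have "E *\<^sub>v x = x" unfolding v(2) by (metis assoc_mult_mat_vec[OF Ec Ec v(1)] EE)
      moreover have "E *\<^sub>v x = (E * ?F) *\<^sub>v w"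
        unfolding w(2) by (rule assoc_mult_mat_vec[OF Ec hom_carrier[OF F] w(1), symmetric])
      ultimately have "x = 0\<^sub>m (fst P) (fst P) *\<^sub>v w" using EF by simp
      then show "x \<in> {0\<^sub>v (fst P)}" using zero_mult_vec[OF w(1)] by simp
    qed
  qed
  moreover have "\<forall>x\<in>carrier_vec (fst P). \<exists>a\<in>W1. \<exists>b\<in>W2. x = a + b"
    using EpF by (auto simp: W1_def W2_def)
  ultimately have "W1 = {0\<^sub>v (fst P)} \<or> W2 = {0\<^sub>v (fst P)}"
    using P i1 i2 by (simp add: indecomposable_mod_def)
  then show ?thesis
  proof
    assume "W1 = {0\<^sub>v (fst P)}"
    then have "E *\<^sub>v v = 0\<^sub>v (fst P)" if "v \<in> carrier_vec (fst P)" for v using that by (auto simp: W1_def)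
    then have "E = 0\<^sub>m (fst P) (fst P)" using ex_nonzero_mult_vec[OF Ec] by metis
    then show ?thesis ..
  next
    assume "W2 = {0\<^sub>v (fst P)}"
    then have "?F *\<^sub>v v = 0\<^sub>v (fst P)" if "v \<in> carrier_vec (fst P)" for v using that by (auto simp: W2_def)
    then have "?F = 0\<^sub>m (fst P) (fst P)" using ex_nonzero_mult_vec[OF hom_carrier[OF F]] by metis
    then have "(1\<^sub>m (fst P) - E) $$ (i, j) = 0" if "i < fst P" "j < fst P" for i j using that by simp
    then have "E = 1\<^sub>m (fst P)" using Ec by (intro eq_matI) auto
    then show ?thesis ..
  qed
qed

text \<open>The definition speaks of pairs of invariant subspaces, whereas later decompositions
  arise from idempotents. The projection onto W1 along W2 is chosen vector by vector; uniqueness of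
  the decomposition makes it linear and equivariant, hence an idempotent endomorphism.\<close>

lemma indecomposableI:
  assumes M: "is_module H P" "0 < fst P"
    and idem: "\<And>E. mod_hom H P P E \<Longrightarrow> E * E = E \<Longrightarrow> E = 0\<^sub>m (fst P) (fst P) \<or> E = 1\<^sub>m (fst P)"
  shows "indecomposable_mod H P"
  unfolding indecomposable_mod_def
proof (intro conjI allI impI)
  fix W1 W2 assume i1: "inv_subspace H P W1" and i2: "inv_subspace H P W2" and int: "W1 \<inter> W2 = {0\<^sub>v (fst P)}"
    and sum: "\<forall>x\<in>carrier_vec (fst P). \<exists>a\<in>W1. \<exists>b\<in>W2. x = a + b"
  have W1: "\<And>x. x \<in> W1 \<Longrightarrow> x \<in> carrier_vec (fst P)" and W2: "\<And>x. x \<in> W2 \<Longrightarrow> x \<in> carrier_vec (fst P)"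
    using i1 i2 by (auto simp: inv_subspace_def)
  have uniq: "a = a'" if "a \<in> W1" "b \<in> W2" "a' \<in> W1" "b' \<in> W2" "a + b = a' + b'" for a b a' b'
  proof -
    have c: "a \<in> carrier_vec (fst P)" "a' \<in> carrier_vec (fst P)" "b \<in> carrier_vec (fst P)" "b' \<in> carrier_vec (fst P)"
      using that W1 W2 by auto
    have e: "a $ i + b $ i = a' $ i + b' $ i" if "i < fst P" for i
      using arg_cong[OF \<open>a + b = a' + b'\<close>, of "\<lambda>x. x $ i"] c that by simp
    have "a + (-1) \<cdot>\<^sub>v a' = b' + (-1) \<cdot>\<^sub>v b"
      using c e by (intro eq_vecI) (auto simp: algebra_simps)
    moreover have "a + (-1) \<cdot>\<^sub>v a' \<in> W1" using i1 that by (auto simp: inv_subspace_def)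
    moreover have "b' + (-1) \<cdot>\<^sub>v b \<in> W2" using i2 that by (auto simp: inv_subspace_def)
    ultimately have "a + (-1) \<cdot>\<^sub>v a' = 0\<^sub>v (fst P)" using int by auto
    then have "(a + (-1) \<cdot>\<^sub>v a') $ i = 0" if "i < fst P" for i using that by simp
    then show ?thesis using c by (intro eq_vecI) auto
  qed
  have "\<forall>x. \<exists>a. x \<in> carrier_vec (fst P) \<longrightarrow> a \<in> W1 \<and> (\<exists>b\<in>W2. x = a + b)" using sum by blast
  then obtain p where p: "\<And>x. x \<in> carrier_vec (fst P) \<Longrightarrow> p x \<in> W1 \<and> (\<exists>b\<in>W2. x = p x + b)" by metis
  have p_eq: "p x = a" if "a \<in> W1" "b \<in> W2" "x = a + b" for x a b
  proof -
    have "x \<in> carrier_vec (fst P)" using that W1 W2 by auto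
    then show ?thesis using p uniq that by metis
  qed
  have p_add: "p (x + y) = p x + p y" if xy: "x \<in> carrier_vec (fst P)" "y \<in> carrier_vec (fst P)" for x y
  proof -
    obtain b b' where b: "b \<in> W2" "x = p x + b" "b' \<in> W2" "y = p y + b'" using p xy by blast
    have c: "p x \<in> carrier_vec (fst P)" "p y \<in> carrier_vec (fst P)" "b \<in> carrier_vec (fst P)" "b' \<in> carrier_vec (fst P)"
      using p xy b W1 W2 by auto
    have "x + y = (p x + b) + (p y + b')" using b by simp
    also have "\<dots> = (p x + p y) + (b + b')"
      using c by (intro eq_vecI) auto
    finally show ?thesis
      using p xy b i1 i2 by (intro p_eq[of _ "b + b'"]) (auto simp: inv_subspace_def)
  qed
  have p_smult: "p (c \<cdot>\<^sub>v x) = c \<cdot>\<^sub>v p x" if x: "x \<in> carrier_vec (fst P)" for c x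
  proof -
    obtain b where b: "b \<in> W2" "x = p x + b" using p x by blast
    have c: "p x \<in> carrier_vec (fst P)" "b \<in> carrier_vec (fst P)" using p x b W1 W2 by auto
    have "c \<cdot>\<^sub>v x = c \<cdot>\<^sub>v (p x + b)" using b by simp
    also have "\<dots> = c \<cdot>\<^sub>v p x + c \<cdot>\<^sub>v b"
      using c by (intro smult_add_distrib_vec) auto
    finally show ?thesis
      using p x b i1 i2 by (intro p_eq[of _ "c \<cdot>\<^sub>v b"]) (auto simp: inv_subspace_def)
  qed
  have p_act: "p (snd P i *\<^sub>v x) = snd P i *\<^sub>v p x" if x: "x \<in> carrier_vec (fst P)" and i: "i < d" for i x
  proof -
    obtain b where b: "b \<in> W2" "x = p x + b" using p x by blast
    have c: "p x \<in> carrier_vec (fst P)" "b \<in> carrier_vec (fst P)" using p x b W1 W2 by auto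
    have "snd P i *\<^sub>v x = snd P i *\<^sub>v (p x + b)" using b by simp
    also have "\<dots> = snd P i *\<^sub>v p x + snd P i *\<^sub>v b"
      using c i by (intro mult_add_distrib_mat_vec[OF module_carrier[OF M(1)]]) auto
    finally show ?thesis
      using p x b i i1 i2 by (intro p_eq[of _ "snd P i *\<^sub>v b"]) (auto simp: inv_subspace_def)
  qed
  let ?n = "fst P"
  define E where "E = mat ?n ?n (\<lambda>(r, c). p (unit_vec ?n c) $ r)"
  have Ec: "E \<in> carrier_mat ?n ?n" by (simp add: E_def)
  have pc: "p x \<in> carrier_vec ?n" if "x \<in> carrier_vec ?n" for x using p W1 that by blast
  have E: "E *\<^sub>v x = p x" if x: "x \<in> carrier_vec ?n" for x
  proof -
    have p0: "p (0\<^sub>v ?n) = 0\<^sub>v ?n" using i1 i2 by (intro p_eq[of _ "0\<^sub>v ?n"]) (auto simp: inv_subspace_def)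
    \<comment> \<open>\<open>p\<close> is only a function known to be additive and homogeneous; its
      matrix is recovered by adding one coordinate at a time.\<close>
    define trunc where "trunc m = vec ?n (\<lambda>i. if i < m then x $ i else 0)" for m
    have "m \<le> ?n \<Longrightarrow> r < ?n \<Longrightarrow> p (trunc m) $ r = (\<Sum>c<m. x $ c * p (unit_vec ?n c) $ r)" for m r
    proof (induction m)
      case 0
      have "trunc 0 = 0\<^sub>v ?n" by (intro eq_vecI) (auto simp: trunc_def)
      then show ?case using p0 0 by simp
    next
      case (Suc m)
      have "trunc (Suc m) = trunc m + x $ m \<cdot>\<^sub>v unit_vec ?n m"
        using Suc.prems by (intro eq_vecI) (auto simp: trunc_def less_Suc_eq)
      then have "p (trunc (Suc m)) = p (trunc m) + x $ m \<cdot>\<^sub>v p (unit_vec ?n m)"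
        by (simp add: p_add p_smult trunc_def)
      moreover have "p (unit_vec ?n m) \<in> carrier_vec ?n" by (rule pc) simp
      ultimately show ?case using Suc by simp
    qed
    from this[of ?n] have 1: "r < ?n \<Longrightarrow> p (trunc ?n) $ r = (\<Sum>c<?n. x $ c * p (unit_vec ?n c) $ r)" for r by simp
    have 2: "trunc ?n = x" using x by (intro eq_vecI) (auto simp: trunc_def)
    show ?thesis
    proof (rule eq_vecI)
      fix r assume "r < dim_vec (p x)"
      then have r: "r < ?n" using pc[OF x] by simp
      show "(E *\<^sub>v x) $ r = p x $ r"
        using 1[OF r] r unfolding 2 mult_vec_index_carrier[OF Ec x r] by (simp add: E_def mult.commute)
    qed (use pc[OF x] Ec in auto)
  qed
  have homE: "mod_hom H P P E" unfolding mod_hom_def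
  proof (intro conjI allI impI)
    fix i assume i: "i < d"
    note ci = module_carrier[OF M(1) i]
    show "E * snd P i = snd P i * E"
    proof (rule mat_eq_if_cols)
      fix v :: "'k vec" assume v: "v \<in> carrier_vec ?n"
      have "(E * snd P i) *\<^sub>v v = E *\<^sub>v (snd P i *\<^sub>v v)" by (rule assoc_mult_mat_vec[OF Ec ci v])
      also have "\<dots> = snd P i *\<^sub>v (E *\<^sub>v v)" using ci v i by (simp add: E p_act)
      also have "\<dots> = (snd P i * E) *\<^sub>v v" by (rule assoc_mult_mat_vec[OF ci Ec v, symmetric])
      finally show "(E * snd P i) *\<^sub>v v = (snd P i * E) *\<^sub>v v" .
    qed (use Ec ci in auto)
  qed (rule Ec)
  have pW1: "p x = x" if "x \<in> W1" for x
    using that i2 W1[OF that] by (intro p_eq[of _ "0\<^sub>v ?n"]) (auto simp: inv_subspace_def)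
  have "E * E = E"
  proof (rule mat_eq_if_cols)
    fix v :: "'k vec" assume v: "v \<in> carrier_vec ?n"
    have "(E * E) *\<^sub>v v = E *\<^sub>v (E *\<^sub>v v)" by (rule assoc_mult_mat_vec[OF Ec Ec v])
    then show "(E * E) *\<^sub>v v = E *\<^sub>v v" using v p[OF v] W1 by (simp add: E pW1)
  qed (use Ec in auto)
  then consider "E = 0\<^sub>m ?n ?n" | "E = 1\<^sub>m ?n" using idem[OF homE] by blast
  then show "W1 = {0\<^sub>v ?n} \<or> W2 = {0\<^sub>v ?n}"
  proof cases
    case 1
    have "x = 0\<^sub>v ?n" if "x \<in> W1" for x
    proof -
      have "x = E *\<^sub>v x" using pW1[OF that] E[OF W1[OF that]] by simp
      then show ?thesis unfolding 1 using zero_mult_vec[OF W1[OF that]] by simp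
    qed
    then show ?thesis using i1 by (auto simp: inv_subspace_def)
  next
    case 2
    have "x = 0\<^sub>v ?n" if "x \<in> W2" for x
    proof -
      have "p x = 0\<^sub>v ?n" using that i1 W2[OF that] by (intro p_eq[of _ x]) (auto simp: inv_subspace_def)
      then show ?thesis using E[OF W2[OF that]] W2[OF that] unfolding 2 by simp
    qed
    then show ?thesis using i2 by (auto simp: inv_subspace_def)
  qed
qed (use M in auto)

end

text \<open>Several later steps reassociate to the left, and the default rule would undo
  this.\<close>

declare assoc_mult_mat [simp del]

section \<open>Fitting's lemma and projective covers\<close>

context hopf_alg
begin

lemma pow_mat_add:
  fixes A :: "'k mat"
  assumes A: "A \<in> carrier_mat n n"
  shows "A ^\<^sub>m (k + l) = A ^\<^sub>m k * A ^\<^sub>m l"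
  using A by (induction l) (simp_all add: mult_assoc_dim)

lemma square_inverse:
  fixes A :: "'k mat"
  shows "A \<in> carrier_mat n n \<Longrightarrow> B \<in> carrier_mat n n \<Longrightarrow> A * B = 1\<^sub>m n \<Longrightarrow> B * A = 1\<^sub>m n"
  by (rule mat_mult_left_right_inverse)

text \<open>The idempotent \<open>E\<close> is the projection onto the stable image of \<open>phi\<close>.\<close>
lemma fitting:
  assumes P: "indecomposable_mod H P" and phi: "mod_hom H P P phi"
  shows "(\<exists>k. phi ^\<^sub>m k = 0\<^sub>m (fst P) (fst P)) \<or>
    (\<exists>psi\<in>carrier_mat (fst P) (fst P). psi * phi = 1\<^sub>m (fst P) \<and> phi * psi = 1\<^sub>m (fst P))"
proof -
  have M: "is_module H P" using P by (simp add: indecomposable_mod_def)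
  let ?n = "fst P"
  note pc = hom_carrier[OF phi]
  define R where "R k r \<longleftrightarrow> 0 < k \<and> (\<exists>f f' y. f \<in> carrier_mat ?n r \<and> f' \<in> carrier_mat r ?n \<and> y \<in> carrier_mat ?n r \<and>
    f' * f = 1\<^sub>m r \<and> f * (f' * phi ^\<^sub>m k) = phi ^\<^sub>m k \<and> f = phi ^\<^sub>m k * y)" for k r
  have ex: "\<exists>r. R k r" if "0 < k" for k
  proof -
    obtain r f f' y where "f \<in> carrier_mat ?n r" "f' \<in> carrier_mat r ?n" "y \<in> carrier_mat ?n r"
      "f' * f = 1\<^sub>m r" "f * (f' * phi ^\<^sub>m k) = phi ^\<^sub>m k" "f = phi ^\<^sub>m k * y"
      by (rule image_factor[OF pow_carrier_mat[OF pc, of k]])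
    with that have "R k r" unfolding R_def by blast
    then show ?thesis ..
  qed
  \<comment> \<open>The smallest rank among the positive powers. If \<open>phi ^\<^sub>m k\<close>
    attains it, its square has the same image. Positivity of \<open>k\<close> allows a factor
    \<open>phi\<close> to be split off at the end.\<close>
  define r where "r = (LEAST r. \<exists>k. R k r)"
  have "\<exists>r k. R k r" using ex[of 1] by auto
  then have "\<exists>k. R k r" unfolding r_def by (rule LeastI_ex)
  then obtain k where Rk: "R k r" by blast
  have k0: "0 < k" using Rk by (simp add: R_def)
  obtain s where s: "R (k + k) s" using ex[of "k + k"] k0 by auto
  have "r \<le> s" unfolding r_def using s by (intro Least_le exI)
  define psi where "psi = phi ^\<^sub>m k"
  have psi2: "phi ^\<^sub>m (k + k) = psi * psi" unfolding psi_def by (rule pow_mat_add[OF pc])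
  have psih: "mod_hom H P P psi" unfolding psi_def by (rule mod_hom_pow[OF M phi])
  note psic = hom_carrier[OF psih]
  obtain f f' y where f: "f \<in> carrier_mat ?n r" and f': "f' \<in> carrier_mat r ?n" and y: "y \<in> carrier_mat ?n r"
    and f'f: "f' * f = 1\<^sub>m r" and ff: "f * (f' * psi) = psi" and fy: "f = psi * y"
    using Rk unfolding R_def psi_def by blast
  obtain h h' z where h: "h \<in> carrier_mat ?n s" and h': "h' \<in> carrier_mat s ?n" and z: "z \<in> carrier_mat ?n s"
    and h'h: "h' * h = 1\<^sub>m s" and hh: "h * (h' * (psi * psi)) = psi * psi" and hz: "h = psi * psi * z"
    using s unfolding R_def psi2 by blast
  have ffa: "f * (f' * (psi * C)) = psi * C" if "dim_row C = ?n" for C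
  proof -
    have "psi * C = f * (f' * psi) * C" unfolding ff ..
    also have "\<dots> = f * (f' * (psi * C))" using f f' psic that by (simp add: mult_assoc_dim)
    finally show ?thesis by simp
  qed
  have hf: "f * (f' * h) = h"
    unfolding hz using psic z by (simp add: mult_assoc_dim ffa)
  have inv1: "(h' * f) * (f' * h) = 1\<^sub>m s"
    using h h' f f' by (simp add: mult_assoc_dim hf h'h)
  have "s \<le> r" by (rule left_inverse_dim_le[OF _ _ inv1]) (use h h' f f' in auto)
  with \<open>r \<le> s\<close> have sr: "s = r" by simp
  have inv2: "(f' * h) * (h' * f) = 1\<^sub>m r"
    by (rule square_inverse[OF _ _ inv1[unfolded sr]]) (use h h' f f' sr in auto)
  have fhh: "h * (h' * f) = f"
  proof -
    have "h * (h' * f) = f * ((f' * h) * (h' * f))"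
      using h h' f f' by (subst hf[symmetric]) (simp add: mult_assoc_dim sr)
    then show ?thesis unfolding inv2 using f by simp
  qed
  \<comment> \<open>\<open>X\<close> is the matrix of \<open>psi\<close> on its own image in the
    basis \<open>f\<close>. It is invertible because \<open>psi\<close> maps its image onto itself;
    \<open>Y\<close>, built from preimages under the square, is the inverse.\<close>
  define h0 X Y where "h0 = f' * psi" and "X = f' * (psi * f)" and "Y = f' * (psi * (z * (h' * f)))"
  have c0: "h0 \<in> carrier_mat r ?n" "X \<in> carrier_mat r r" "Y \<in> carrier_mat r r"
    unfolding h0_def X_def Y_def using f f' psic z h' sr by auto
  note dims = carrier_matD[OF f] carrier_matD[OF f'] carrier_matD[OF psic] carrier_matD[OF c0(1)] carrier_matD[OF c0(2)]
     carrier_matD[OF c0(3)] carrier_matD[OF z] carrier_matD[OF h'] carrier_matD[OF h] carrier_matD[OF y]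
  have XY: "X * Y = 1\<^sub>m r"
  proof -
    have "X * Y = f' * (psi * (f * (f' * (psi * (z * (h' * f))))))"
      unfolding X_def Y_def using dims by (simp add: mult_assoc_dim sr)
    also have "\<dots> = f' * (psi * (psi * (z * (h' * f))))" using dims by (simp add: ffa sr)
    also have "psi * (psi * (z * (h' * f))) = h * (h' * f)"
      unfolding hz using dims by (simp add: mult_assoc_dim sr)
    finally show ?thesis unfolding fhh f'f .
  qed
  have YX: "Y * X = 1\<^sub>m r" by (rule square_inverse[OF c0(2,3) XY])
  have h0f: "h0 * f = X" unfolding h0_def X_def using dims by (simp add: mult_assoc_dim)
  have psi_f: "psi = f * h0" unfolding h0_def using ff by simp
  define E where "E = f * (Y * h0)"
  have Ec: "E \<in> carrier_mat ?n ?n" unfolding E_def using c0 f by auto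
  have hom: "mod_hom H P P E" unfolding mod_hom_def
  proof (intro conjI allI impI)
    fix i assume i: "i < d"
    let ?rho = "snd P i"
    note rdim = module_dims[OF M i]
    have pr: "psi * (?rho * C) = ?rho * (psi * C)" if "dim_row C = ?n" for C
      using hom_comm[OF psih i] dims rdim that by (simp add: mult_assoc_dim[symmetric])
    define sg where "sg = f' * (?rho * f)"
    have sgc: "sg \<in> carrier_mat r r" unfolding sg_def using dims rdim by auto
    have rf: "?rho * f = f * sg"
    proof -
      have "?rho * f = psi * (?rho * y)" unfolding fy using dims rdim pr[of y] by (simp add: mult_assoc_dim)
      also have "\<dots> = f * (f' * (psi * (?rho * y)))" using dims rdim by (simp add: ffa)
      also have "psi * (?rho * y) = ?rho * f" unfolding fy using dims rdim pr[of y] by (simp add: mult_assoc_dim)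
      finally show ?thesis by (simp add: sg_def)
    qed
    have hr: "h0 * ?rho = sg * h0"
    proof -
      have "h0 * ?rho = f' * (?rho * psi)"
        unfolding h0_def using dims rdim hom_comm[OF psih i] by (simp add: mult_assoc_dim)
      also have "?rho * psi = f * (sg * h0)"
        using dims rdim sgc rf by (subst psi_f) (simp add: mult_assoc_dim[symmetric])
      also have "f' * (f * (sg * h0)) = sg * h0" using dims sgc by (simp add: f'f[THEN mult_eq_assoc])
      finally show ?thesis .
    qed
    have Xs: "X * sg = sg * X"
    proof -
      have "X * sg = h0 * (f * sg)" unfolding h0f[symmetric] using dims sgc by (simp add: mult_assoc_dim)
      also have "\<dots> = h0 * ?rho * f" unfolding rf[symmetric] using dims rdim by (simp add: mult_assoc_dim)
      also have "\<dots> = sg * X" unfolding hr h0f[symmetric] using dims sgc by (simp add: mult_assoc_dim)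
      finally show ?thesis .
    qed
    have Ys: "Y * sg = sg * Y"
    proof -
      have "Y * sg = Y * (sg * (X * Y))" unfolding XY using sgc dims by simp
      also have "\<dots> = Y * (X * (sg * Y))" using Xs dims sgc by (simp add: mult_assoc_dim[symmetric])
      also have "\<dots> = sg * Y" using YX[THEN mult_eq_assoc] dims sgc by simp
      finally show ?thesis .
    qed
    have "E * ?rho = f * (Y * (h0 * ?rho))" unfolding E_def using dims rdim by (simp add: mult_assoc_dim)
    also have "\<dots> = f * ((Y * sg) * h0)" unfolding hr using dims sgc by (simp add: mult_assoc_dim)
    also have "\<dots> = (f * sg) * (Y * h0)" unfolding Ys using dims sgc by (simp add: mult_assoc_dim)
    also have "\<dots> = ?rho * E" unfolding rf[symmetric] E_def using dims rdim by (simp add: mult_assoc_dim)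
    finally show "E * ?rho = ?rho * E" .
  qed (rule Ec)
  have EE: "E * E = E"
    unfolding E_def using dims by (simp add: mult_assoc_dim h0f[THEN mult_eq_assoc] XY[THEN mult_eq_assoc])
  from indecomposable_idem[OF P hom EE] show ?thesis
  proof
    assume E0: "E = 0\<^sub>m ?n ?n"
    have "X = h0 * (E * f)"
      unfolding E_def using dims by (simp add: mult_assoc_dim h0f h0f[THEN mult_eq_assoc] XY[THEN mult_eq_assoc])
    then have "X = 0\<^sub>m r r" unfolding E0 using dims by simp
    then have "1\<^sub>m r = 0\<^sub>m r r * Y" using XY by simp
    also have "\<dots> = 0\<^sub>m r r" using dims by simp
    finally have "1\<^sub>m r = (0\<^sub>m r r :: 'k mat)" .
    then have "f = f * 0\<^sub>m r r" using dims by (metis right_mult_one_mat')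
    then have "f = 0\<^sub>m ?n r" using dims by simp
    then have "psi = 0\<^sub>m ?n ?n" using psi_f dims by simp
    then show ?thesis unfolding psi_def by blast
  next
    assume E1: "E = 1\<^sub>m ?n"
    \<comment> \<open>The inverse of \<open>psi\<close> on the stable image, composed with the
      projection \<open>E\<close>; hence \<open>psi * W = E\<close>, which is 1 in this
      case.\<close>
    define W where "W = f * (Y * (Y * h0))"
    have Wc: "W \<in> carrier_mat ?n ?n" unfolding W_def using dims by auto
    have "psi * W = 1\<^sub>m ?n"
      unfolding E1[symmetric] E_def W_def
      using dims by (subst psi_f) (simp add: mult_assoc_dim h0f[THEN mult_eq_assoc] XY[THEN mult_eq_assoc])
    moreover have "psi = phi * phi ^\<^sub>m (k - 1)"
      using pow_mat_add[OF pc, of 1 "k - 1"] k0 pc unfolding psi_def by simp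
    ultimately have 1: "phi * (phi ^\<^sub>m (k - 1) * W) = 1\<^sub>m ?n"
      using pc Wc pow_carrier_mat[OF pc, of "k - 1"] by (simp add: mult_assoc_dim)
    have c: "phi ^\<^sub>m (k - 1) * W \<in> carrier_mat ?n ?n" using Wc pow_carrier_mat[OF pc, of "k - 1"] by auto
    show ?thesis using 1 c square_inverse[OF pc c 1] by blast
  qed
qed

lemma pow_fix:
  fixes f :: "'k mat"
  assumes "f \<in> carrier_mat m n" "phi \<in> carrier_mat n n" "f * phi = f"
  shows "f * phi ^\<^sub>m k = f"
proof (induction k)
  case (Suc k)
  have "f * phi ^\<^sub>m Suc k = f * phi ^\<^sub>m k * phi"
    using assms by (simp add: mult_assoc_dim)
  then show ?case using Suc assms by simp
qed (use assms in simp)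

text \<open>An endomorphism that fixes a nonzero map is not nilpotent, so Fitting's dichotomy makes
  it invertible. All comparisons of projective covers below rest on this.\<close>

lemma fixing_endo_invertible:
  assumes P: "indecomposable_mod H P" and phi: "mod_hom H P P phi"
    and f: "f \<in> carrier_mat m (fst P)" "f \<noteq> 0\<^sub>m m (fst P)" "f * phi = f"
  obtains psi where "psi \<in> carrier_mat (fst P) (fst P)" "psi * phi = 1\<^sub>m (fst P)" "phi * psi = 1\<^sub>m (fst P)"
proof -
  have "phi ^\<^sub>m k \<noteq> 0\<^sub>m (fst P) (fst P)" for k
    using pow_fix[OF f(1) hom_carrier[OF phi] f(3), of k] f by auto
  then show ?thesis using fitting[OF P phi] that by blast
qed

lemma projectiveD:
  "projective_mod H P \<Longrightarrow> is_module H V \<Longrightarrow> is_module H W \<Longrightarrow> mod_hom H V W g \<Longrightarrow> surj_mat g \<Longrightarrow> mod_hom H P W h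
    \<Longrightarrow> \<exists>k. mod_hom H P V k \<and> g * k = h"
  unfolding projective_mod_def by blast

text \<open>Otherwise \<open>f * n\<close> maps onto S, and projectivity gives
  \<open>f = f n y\<close>. Then \<open>n y\<close> fixes \<open>f\<close> and is invertible, so
  \<open>n\<close> is invertible and cannot be nilpotent.\<close>

lemma nilpotent_endo_kills_simple:
  assumes P: "indecomposable_mod H P" "projective_mod H P" and S: "simple_mod H S" and f: "mod_hom H P S f"
    and n: "mod_hom H P P n" "n ^\<^sub>m k = 0\<^sub>m (fst P) (fst P)"
  shows "f * n = 0\<^sub>m (fst S) (fst P)"
proof (rule ccontr)
  assume nz: "f * n \<noteq> 0\<^sub>m (fst S) (fst P)"
  have M: "is_module H P" "is_module H S" "0 < fst P" using P S by (auto simp: indecomposable_mod_def simple_mod_def)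
  note fc = hom_carrier[OF f] and nc = hom_carrier[OF n(1)]
  have fn: "mod_hom H P S (f * n)" by (rule mod_hom_comp[OF M(1,1,2) n(1) f])
  obtain y where y: "mod_hom H P P y" "f * n * y = f"
    using projectiveD[OF P(2) M(1,2) fn simple_hom_surj[OF M(1) S fn nz] f] by blast
  note yc = hom_carrier[OF y(1)]
  have ny: "mod_hom H P P (n * y)" by (rule mod_hom_comp[OF M(1,1,1) y(1) n(1)])
  have e: "f * (n * y) = f" using y(2) fc nc yc by (simp add: mult_assoc_dim)
  have "f \<noteq> 0\<^sub>m (fst S) (fst P)" using nz nc by auto
  then obtain z where z: "z \<in> carrier_mat (fst P) (fst P)" "n * y * z = 1\<^sub>m (fst P)"
    using fixing_endo_invertible[OF P(1) ny fc _ e] by metis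
  have inv: "n * (y * z) = 1\<^sub>m (fst P)" using z nc yc by (simp add: mult_assoc_dim)
  have inv': "(y * z) * n = 1\<^sub>m (fst P)" by (rule square_inverse[OF nc _ inv]) (use yc z in auto)
  have "j \<le> k \<Longrightarrow> n ^\<^sub>m (k - j) = 0\<^sub>m (fst P) (fst P)" for j
  proof (induction j)
    case (Suc j)
    then have "n ^\<^sub>m (k - j) = n ^\<^sub>m (k - Suc j) * n" by (metis Suc_diff_Suc Suc_le_lessD pow_mat.simps(2))
    then have "n ^\<^sub>m (k - Suc j) * n = 0\<^sub>m (fst P) (fst P)" using Suc by simp
    then have "n ^\<^sub>m (k - Suc j) * n * (y * z) = 0\<^sub>m (fst P) (fst P) * (y * z)" by (rule arg_cong)
    also have "\<dots> = 0\<^sub>m (fst P) (fst P)" using yc z(1) by simp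
    finally have "n ^\<^sub>m (k - Suc j) * n * (y * z) = 0\<^sub>m (fst P) (fst P)" .
    then show ?case using inv nc yc z(1) pow_carrier_mat[OF nc, of "k - Suc j"] by (simp add: mult_assoc_dim)
  qed (use n in simp)
  from this[of k] have "1\<^sub>m (fst P) = (0\<^sub>m (fst P) (fst P) :: 'k mat)" using nc by simp
  then have "(1\<^sub>m (fst P) :: 'k mat) $$ (0, 0) = 0" using M(3) by simp
  then show False using M(3) by simp
qed

lemma eigenvalue_exists:
  assumes ac: "alg_closed_field TYPE('k)" and A: "(A :: 'k mat) \<in> carrier_mat n n" and n: "0 < n"
  obtains c v where "v \<in> carrier_vec n" "v \<noteq> 0\<^sub>v n" "A *\<^sub>v v = c \<cdot>\<^sub>v v"
proof -
  have "degree (char_poly A) = n" using degree_monic_char_poly[OF A] by simp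
  then obtain c where "poly (char_poly A) c = 0" using ac n unfolding alg_closed_field_def by metis
  then have "eigenvalue A c" using eigenvalue_root_char_poly[OF A] by simp
  then show ?thesis using that A unfolding eigenvalue_def eigenvector_def by auto
qed

text \<open>Projectivity writes \<open>g\<close> as \<open>f phi\<close>. Subtracting an eigenvalue
  from the endomorphism \<open>phi\<close> leaves a singular, hence nilpotent, endomorphism, which
  \<open>f\<close> kills; so \<open>g\<close> is that eigenvalue times \<open>f\<close>. This is the
  use of algebraic closedness.\<close>

lemma indecomposable_projective_hom_simple_unique:
  assumes ac: "alg_closed_field TYPE('k)"
    and P: "indecomposable_mod H P" "projective_mod H P" and S: "simple_mod H S"
    and f: "mod_hom H P S f" "f \<noteq> 0\<^sub>m (fst S) (fst P)" and g: "mod_hom H P S g"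
  shows "\<exists>c. g = c \<cdot>\<^sub>m f"
proof -
  have M: "is_module H P" "is_module H S" "0 < fst P" using P S by (auto simp: indecomposable_mod_def simple_mod_def)
  obtain phi where phi: "mod_hom H P P phi" "f * phi = g"
    using projectiveD[OF P(2) M(1,2) f(1) simple_hom_surj[OF M(1) S f] g] by blast
  note fc = hom_carrier[OF f(1)] and pc = hom_carrier[OF phi(1)]
  obtain c v where v: "v \<in> carrier_vec (fst P)" "v \<noteq> 0\<^sub>v (fst P)" "phi *\<^sub>v v = c \<cdot>\<^sub>v v"
    by (rule eigenvalue_exists[OF ac pc M(3)])
  define n where "n = phi - c \<cdot>\<^sub>m 1\<^sub>m (fst P)"
  have n: "mod_hom H P P n" unfolding n_def
    by (intro mod_hom_minus mod_hom_smult mod_hom_id M phi)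
  note nc = hom_carrier[OF n]
  have nv: "n *\<^sub>v v = 0\<^sub>v (fst P)"
  proof -
    have "n *\<^sub>v v = phi *\<^sub>v v - (c \<cdot>\<^sub>m 1\<^sub>m (fst P)) *\<^sub>v v"
      unfolding n_def by (rule minus_mult_distrib_mat_vec[OF pc _ v(1)]) simp
    also have "(c \<cdot>\<^sub>m 1\<^sub>m (fst P)) *\<^sub>v v = c \<cdot>\<^sub>v v" using v(1) by (intro eq_vecI) auto
    finally show ?thesis using v by simp
  qed
  have "\<not> (\<exists>psi\<in>carrier_mat (fst P) (fst P). psi * n = 1\<^sub>m (fst P) \<and> n * psi = 1\<^sub>m (fst P))"
  proof
    assume "\<exists>psi\<in>carrier_mat (fst P) (fst P). psi * n = 1\<^sub>m (fst P) \<and> n * psi = 1\<^sub>m (fst P)"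
    then obtain psi where psi: "psi \<in> carrier_mat (fst P) (fst P)" "psi * n = 1\<^sub>m (fst P)" by blast
    have "v = psi *\<^sub>v (n *\<^sub>v v)" using assoc_mult_mat_vec[OF psi(1) nc v(1)] psi(2) v(1) by simp
    then show False using nv mult_zero_vec[OF psi(1)] v(2) by simp
  qed
  then obtain k where "n ^\<^sub>m k = 0\<^sub>m (fst P) (fst P)" using fitting[OF P(1) n] by blast
  then have fn: "f * n = 0\<^sub>m (fst S) (fst P)" by (rule nilpotent_endo_kills_simple[OF P S f(1) n])
  have "phi = n + c \<cdot>\<^sub>m 1\<^sub>m (fst P)" unfolding n_def using pc by (intro eq_matI) auto
  then have "g = f * n + f * (c \<cdot>\<^sub>m 1\<^sub>m (fst P))" unfolding phi(2)[symmetric] using fc nc by (simp add: mult_plus_dim)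
  also have "f * (c \<cdot>\<^sub>m 1\<^sub>m (fst P)) = c \<cdot>\<^sub>m f"
    using mult_smult_distrib[OF fc one_carrier_mat, of c] fc by simp
  finally show ?thesis unfolding fn using fc by (metis left_add_zero_mat smult_carrier_mat)
qed

lemma split_exact_dim:
  assumes "split_exact U V W f g f' g'"
  shows "fst V = fst U + fst W"
proof -
  have c: "f \<in> carrier_mat (fst V) (fst U)" "g \<in> carrier_mat (fst W) (fst V)"
    using assms hom_carrier unfolding split_exact_def by auto
  have "idem_rank (1\<^sub>m (fst V) :: 'k mat) = idem_rank (1\<^sub>m (fst U) :: 'k mat) + idem_rank (1\<^sub>m (fst W) :: 'k mat)"
    by (rule idem_rank_exact[of f "fst V" "fst U" f' g "fst W" g']) (use assms c in \<open>auto simp: split_exact_def\<close>)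
  then show ?thesis by simp
qed

text \<open>If \<open>g\<close> were nonzero on the kernel U of \<open>f\<close>, it would factor
  through U, giving an endomorphism of P with image in U that fixes \<open>g\<close>. Being
  invertible, it would force \<open>f = 0\<close>. So \<open>g\<close> vanishes on U and descends to
  a nonzero map between the two simple modules.\<close>

lemma indecomposable_projective_top_unique:
  assumes P: "indecomposable_mod H P" "projective_mod H P" and S: "simple_mod H S" "simple_mod H S'"
    and f: "mod_hom H P S f" "f \<noteq> 0\<^sub>m (fst S) (fst P)" and g: "mod_hom H P S' g" "g \<noteq> 0\<^sub>m (fst S') (fst P)"
  shows "mod_iso H S S'"
proof -
  have M: "is_module H P" "is_module H S" "is_module H S'" "0 < fst P"
    using P S by (auto simp: indecomposable_mod_def simple_mod_def)
  note fc = hom_carrier[OF f(1)] and gc = hom_carrier[OF g(1)]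
  have fs: "surj_mat f" by (rule simple_hom_surj[OF M(1) S(1) f])
  obtain f' where f': "f' \<in> carrier_mat (fst P) (fst S)" "f * f' = 1\<^sub>m (fst S)"
    by (rule right_inverse_if_surj[OF fc fs])
  let ?K = "{v \<in> carrier_vec (fst P). f *\<^sub>v v = 0\<^sub>v (fst S)}"
  have Kinv: "inv_subspace H P ?K" by (rule inv_subspace_kernel[OF M(1,2) f(1)])
  obtain U Q a b a' b' where se: "split_exact U P Q a b a' b'" and K: "?K = {a *\<^sub>v v | v. v \<in> carrier_vec (fst U)}"
    by (rule inv_subspace_split[OF M(1) Kinv])
  have U: "is_module H U" "mod_hom H U P a" using se by (auto simp: split_exact_def)
  note ac = hom_carrier[OF U(2)]
  have fa: "f * a = 0\<^sub>m (fst S) (fst U)"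
  proof (rule mat_eq_if_cols)
    fix v :: "'k vec" assume v: "v \<in> carrier_vec (fst U)"
    then have "a *\<^sub>v v \<in> ?K" unfolding K by blast
    then show "f * a *\<^sub>v v = 0\<^sub>m (fst S) (fst U) *\<^sub>v v"
      using assoc_mult_mat_vec[OF fc ac v] zero_mult_vec[OF v] by simp
  qed (use fc ac in auto)
  have ga: "mod_hom H U S' (g * a)" by (rule mod_hom_comp[OF U(1) M(1,3) U(2) g(1)])
  have ga0: "g * a = 0\<^sub>m (fst S') (fst U)"
  proof (rule ccontr)
    assume nz: "g * a \<noteq> 0\<^sub>m (fst S') (fst U)"
    obtain k where k: "mod_hom H P U k" "g * a * k = g"
      using projectiveD[OF P(2) U(1) M(3) ga simple_hom_surj[OF U(1) S(2) ga nz] g(1)] by blast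
    note kc = hom_carrier[OF k(1)]
    have ak: "mod_hom H P P (a * k)" by (rule mod_hom_comp[OF M(1) U(1) M(1) k(1) U(2)])
    have "g * (a * k) = g" using k(2) gc ac kc by (simp add: mult_assoc_dim)
    then obtain z where z: "z \<in> carrier_mat (fst P) (fst P)" "a * k * z = 1\<^sub>m (fst P)"
      using fixing_endo_invertible[OF P(1) ak gc g(2)] by metis
    have "f = f * (a * k * z)" unfolding z(2) using fc by simp
    also have "\<dots> = f * a * (k * z)" using fc ac kc z by (simp add: mult_assoc_dim)
    also have "\<dots> = 0\<^sub>m (fst S) (fst P)" unfolding fa using kc z by simp
    finally show False using f(2) by simp
  qed
  have "g * (f' * f) = g"
  proof (rule mat_eq_if_cols)
    fix v :: "'k vec" assume v: "v \<in> carrier_vec (fst P)"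
    have c: "(f' * f) *\<^sub>v v \<in> carrier_vec (fst P)" using f' fc v by auto
    have "f *\<^sub>v ((f' * f) *\<^sub>v v) = (f * (f' * f)) *\<^sub>v v"
      using f' fc v by (intro assoc_mult_mat_vec[symmetric]) auto
    also have "f * (f' * f) = f" using f' fc by (simp add: f'(2)[THEN mult_eq_assoc])
    finally have "(f' * f) *\<^sub>v v - v \<in> ?K" using c v fc mult_minus_distrib_mat_vec[OF fc c v] by auto
    then obtain u where u: "u \<in> carrier_vec (fst U)" "(f' * f) *\<^sub>v v - v = a *\<^sub>v u" unfolding K by blast
    have "g *\<^sub>v ((f' * f) *\<^sub>v v) - g *\<^sub>v v = g *\<^sub>v (a *\<^sub>v u)"
      unfolding u(2)[symmetric] by (rule mult_minus_distrib_mat_vec[OF gc c v, symmetric])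
    also have "\<dots> = 0\<^sub>v (fst S')" using assoc_mult_mat_vec[OF gc ac u(1)] zero_mult_vec[OF u(1)] ga0 by simp
    finally have z: "g *\<^sub>v ((f' * f) *\<^sub>v v) - g *\<^sub>v v = 0\<^sub>v (fst S')" .
    have cc: "g *\<^sub>v ((f' * f) *\<^sub>v v) \<in> carrier_vec (fst S')" "g *\<^sub>v v \<in> carrier_vec (fst S')" using gc c v by auto
    have "g *\<^sub>v ((f' * f) *\<^sub>v v) = g *\<^sub>v v" by (rule vec_eq_if_minus_zero[OF cc z])
    then show "(g * (f' * f)) *\<^sub>v v = g *\<^sub>v v"
      using assoc_mult_mat_vec[OF gc mult_carrier_mat[OF f'(1) fc] v] by simp
  qed (use f' fc gc in auto)
  then have h: "(g * f') * f = g" using gc f' fc by (simp add: mult_assoc_dim)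
  have hc: "g * f' \<in> carrier_mat (fst S') (fst S)" using gc f' by auto
  have "mod_hom H S S' (g * f')" by (rule hom_descend[OF M(1-3) f(1) fs g(1) hc h])
  moreover have "g * f' \<noteq> 0\<^sub>m (fst S') (fst S)" using h fc g(2) by auto
  ultimately show ?thesis by (rule simple_hom_iso[OF S])
qed

text \<open>Lifting each map through the other gives \<open>f (b a) = f\<close>, so
  \<open>b * a\<close> is invertible and \<open>a\<close> is injective.\<close>

lemma indecomposable_projective_same_top_dim_le:
  assumes P: "indecomposable_mod H P" "projective_mod H P" and P': "indecomposable_mod H P'" "projective_mod H P'"
    and S: "simple_mod H S" and f: "mod_hom H P S f" "f \<noteq> 0\<^sub>m (fst S) (fst P)"
    and g: "mod_hom H P' S g" "g \<noteq> 0\<^sub>m (fst S) (fst P')"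
  shows "fst P \<le> fst P'"
proof -
  have M: "is_module H P" "is_module H S" "is_module H P'"
    using P P' S by (auto simp: indecomposable_mod_def simple_mod_def)
  obtain a where a: "mod_hom H P P' a" "g * a = f"
    using projectiveD[OF P(2) M(3,2) g(1) simple_hom_surj[OF M(3) S g] f(1)] by blast
  obtain b where b: "mod_hom H P' P b" "f * b = g"
    using projectiveD[OF P'(2) M(1,2) f(1) simple_hom_surj[OF M(1) S f] g(1)] by blast
  note c = hom_carrier[OF f(1)] hom_carrier[OF a(1)] hom_carrier[OF b(1)]
  have "f * (b * a) = f" using a(2) b(2) c by (simp add: mult_assoc_dim[symmetric])
  then obtain z where z: "z \<in> carrier_mat (fst P) (fst P)" "z * (b * a) = 1\<^sub>m (fst P)"
    using fixing_endo_invertible[OF P(1) mod_hom_comp[OF M(1,3,1) a(1) b(1)] c(1) f(2)] by metis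
  show ?thesis
    by (rule left_inverse_dim_le[OF c(2), of "z * b"]) (use z c in \<open>auto simp: mult_assoc_dim\<close>)
qed

lemma projective_summand:
  assumes P: "projective_mod H P" and U: "is_module H U" "mod_hom H U P a" "mod_hom H P U a'" "a' * a = 1\<^sub>m (fst U)"
  shows "projective_mod H U"
  unfolding projective_mod_def
proof (intro conjI allI impI)
  fix V W g h
  assume V: "is_module H V" "is_module H W" "mod_hom H V W g" "surj_mat g" and h: "mod_hom H U W h"
  have M: "is_module H P" using P by (simp add: projective_mod_def)
  note c = hom_carrier[OF U(2)] hom_carrier[OF U(3)] hom_carrier[OF h] hom_carrier[OF V(3)]
  obtain k where k: "mod_hom H P V k" "g * k = h * a'"
    using projectiveD[OF P V mod_hom_comp[OF M U(1) V(2) U(3) h]] by blast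
  have "g * (k * a) = g * k * a" using c hom_carrier[OF k(1)] by (simp add: mult_assoc_dim)
  also have "\<dots> = h" unfolding k(2) using c U(4) by (simp add: mult_assoc_dim)
  finally show "\<exists>k. mod_hom H U V k \<and> g * k = h"
    using mod_hom_comp[OF U(1) M V(1) U(2) k(1)] by blast
qed (rule U(1))

text \<open>A nonzero quotient of least dimension is simple: a proper nonzero submodule would yield
  a smaller nonzero quotient.\<close>

lemma ex_simple_quotient:
  assumes M: "is_module H M" and pos: "0 < fst M"
  obtains S f where "simple_mod H S" "mod_hom H M S f" "f \<noteq> 0\<^sub>m (fst S) (fst M)"
proof -
  define R where "R n \<longleftrightarrow> (\<exists>Q g. is_module H Q \<and> mod_hom H M Q g \<and> surj_mat g \<and> 0 < fst Q \<and> fst Q = n)" for n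
  have "surj_mat (1\<^sub>m (fst M) :: 'k mat)" by (rule surj_if_right_inverse[of _ "fst M" "fst M" "1\<^sub>m (fst M)"]) auto
  then have "R (fst M)" unfolding R_def using M pos mod_hom_id[OF M] by blast
  then obtain n where n: "R n" and least: "\<And>m. m < n \<Longrightarrow> \<not> R m" using exists_least_iff[of R] by blast
  from n obtain Q g where Q: "is_module H Q" "mod_hom H M Q g" "surj_mat g" "0 < fst Q" "fst Q = n"
    unfolding R_def by blast
  note gc = hom_carrier[OF Q(2)]
  obtain g' where g': "g' \<in> carrier_mat (fst M) (fst Q)" "g * g' = 1\<^sub>m (fst Q)"
    by (rule right_inverse_if_surj[OF gc Q(3)])
  have "simple_mod H Q" unfolding simple_mod_def
  proof (intro conjI allI impI)
    fix W assume W: "inv_subspace H Q W"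
    obtain U T a b a' b' where se: "split_exact U Q T a b a' b'" and WU: "W = {a *\<^sub>v v | v. v \<in> carrier_vec (fst U)}"
      by (rule inv_subspace_split[OF Q(1) W])
    have ac: "a \<in> carrier_mat (fst Q) (fst U)" and bc: "b \<in> carrier_mat (fst T) (fst Q)"
      using se hom_carrier by (auto simp: split_exact_def)
    have dim: "fst Q = fst U + fst T" by (rule split_exact_dim[OF se])
    show "W = {0\<^sub>v (fst Q)} \<or> W = carrier_vec (fst Q)"
    proof (cases "fst T = 0")
      case True
      have a'c: "a' \<in> carrier_mat (fst U) (fst Q)" and b'c: "b' \<in> carrier_mat (fst Q) (fst T)" 
        and s: "a * a' + b' * b = 1\<^sub>m (fst Q)" using se by (auto simp: split_exact_def)
      have "b' * b = 0\<^sub>m (fst Q) (fst Q)" using b'c bc True by (intro eq_matI) (auto simp: scalar_prod_def)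
      then have aa: "a * a' = 1\<^sub>m (fst Q)" using s ac a'c by auto
      have "x \<in> W" if x: "x \<in> carrier_vec (fst Q)" for x
      proof -
        have "x = a *\<^sub>v (a' *\<^sub>v x)" using assoc_mult_mat_vec[OF ac a'c x] aa x by simp
        then show ?thesis unfolding WU using a'c x by auto
      qed
      then show ?thesis using W by (auto simp: inv_subspace_def)
    next
      case False
      have T: "is_module H T" "mod_hom H Q T b" "b' \<in> carrier_mat (fst Q) (fst T)" "b * b' = 1\<^sub>m (fst T)"
        using se by (auto simp: split_exact_def)
      have "surj_mat (b * g)"
        by (rule surj_if_right_inverse[of _ "fst T" "fst M" "g' * b'"])
          (use bc gc g' T in \<open>auto simp: mult_assoc_dim g'(2)[THEN mult_eq_assoc]\<close>)
      then have "R (fst T)" unfolding R_def using T False mod_hom_comp[OF M Q(1) T(1) Q(2) T(2)] by blast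
      then have "\<not> fst T < n" using least by blast
      then have "fst U = 0" using dim Q(5) by simp
      have "x = 0\<^sub>v (fst Q)" if xW: "x \<in> W" for x
      proof -
        obtain v where v: "v \<in> carrier_vec (fst U)" "x = a *\<^sub>v v" using xW unfolding WU by blast
        show ?thesis unfolding v(2) using ac v(1) \<open>fst U = 0\<close> by (intro eq_vecI) (auto simp: scalar_prod_def)
      qed
      then show ?thesis using W by (auto simp: inv_subspace_def)
    qed
  qed (use Q in auto)
  moreover have "g \<noteq> 0\<^sub>m (fst Q) (fst M)"
  proof
    assume "g = 0\<^sub>m (fst Q) (fst M)"
    then have "1\<^sub>m (fst Q) = (0\<^sub>m (fst Q) (fst Q) :: 'k mat)" using g' by simp
    then have "(1\<^sub>m (fst Q) :: 'k mat) $$ (0, 0) = 0" using Q(4) by simp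
    then show False using Q(4) by simp
  qed
  ultimately show ?thesis using Q(2) that by blast
qed

text \<open>Among the projectives with a nonzero map to S one of least dimension is taken. For an
  idempotent \<open>E\<close> the map is nonzero on the image of \<open>E\<close> or of
  \<open>1 - E\<close>, and by minimality that summand is everything.\<close>

lemma ex_indecomposable_projective:
  assumes P0: "projective_mod H P0" and S: "simple_mod H S" and f0: "mod_hom H P0 S f0" "f0 \<noteq> 0\<^sub>m (fst S) (fst P0)"
  obtains P f where "indecomposable_mod H P" "projective_mod H P" "mod_hom H P S f" "f \<noteq> 0\<^sub>m (fst S) (fst P)"
proof -
  define R where "R n \<longleftrightarrow> (\<exists>P f. projective_mod H P \<and> mod_hom H P S f \<and> f \<noteq> 0\<^sub>m (fst S) (fst P) \<and> fst P = n)" for n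
  have "R (fst P0)" unfolding R_def using P0 f0 by blast
  then obtain n where n: "R n" and least: "\<And>m. m < n \<Longrightarrow> \<not> R m" using exists_least_iff[of R] by blast
  from n obtain P f where P: "projective_mod H P" and f: "mod_hom H P S f" "f \<noteq> 0\<^sub>m (fst S) (fst P)" and Pn: "fst P = n"
    unfolding R_def by blast
  have M: "is_module H P" "is_module H S" using P S by (auto simp: projective_mod_def simple_mod_def)
  note fc = hom_carrier[OF f(1)]
  have one: "E = 1\<^sub>m (fst P)" if E: "mod_hom H P P E" "E * E = E" and nz: "f * E \<noteq> 0\<^sub>m (fst S) (fst P)" for E
  proof -
    obtain U a a' where U: "is_module H U" "mod_hom H U P a" "mod_hom H P U a'" "a * a' = E" "a' * a = 1\<^sub>m (fst U)"
      by (rule summand_module[OF M(1) E])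
    note ac = hom_carrier[OF U(2)] and a'c = hom_carrier[OF U(3)]
    have "projective_mod H U" by (rule projective_summand[OF P U(1-3,5)])
    moreover have "mod_hom H U S (f * a)" by (rule mod_hom_comp[OF U(1) M U(2) f(1)])
    moreover have "f * a \<noteq> 0\<^sub>m (fst S) (fst U)"
    proof
      assume "f * a = 0\<^sub>m (fst S) (fst U)"
      then have "f * a * a' = 0\<^sub>m (fst S) (fst P)" using a'c by simp
      then show False using nz U(4) fc ac a'c by (simp add: mult_assoc_dim)
    qed
    ultimately have "R (fst U)" unfolding R_def by blast
    then have "fst P \<le> fst U" using least Pn by (metis not_le)
    moreover have "fst U \<le> fst P" by (rule left_inverse_dim_le[OF ac a'c U(5)])
    ultimately have "fst U = fst P" by simp
    then have "a * a' = 1\<^sub>m (fst P)" using ac a'c U(5) by (metis square_inverse)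
    then show ?thesis using U(4) by simp
  qed
  have pos: "0 < fst P"
  proof (rule ccontr)
    assume "\<not> 0 < fst P"
    then have "f = 0\<^sub>m (fst S) (fst P)" using fc by (intro eq_matI) auto
    then show False using f(2) by simp
  qed
  have "indecomposable_mod H P"
  proof (rule indecomposableI[OF M(1) pos])
    fix E assume E: "mod_hom H P P E" "E * E = E"
    note Ec = hom_carrier[OF E(1)]
    show "E = 0\<^sub>m (fst P) (fst P) \<or> E = 1\<^sub>m (fst P)"
    proof (cases "f * E = 0\<^sub>m (fst S) (fst P)")
      case False
      then show ?thesis using one[OF E] by simp
    next
      case True
      let ?F = "1\<^sub>m (fst P) - E"
      have F: "mod_hom H P P ?F" by (rule mod_hom_minus[OF M(1,1) mod_hom_id[OF M(1)] E(1)])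
      have FF: "?F * ?F = ?F" using Ec E(2)
        by (simp add: minus_mult_dim mult_minus_dim) (rule eq_matI; simp)
      have "f * ?F = f" using True fc Ec by (simp add: mult_minus_dim) (rule eq_matI; simp)
      then have "?F = 1\<^sub>m (fst P)" using one[OF F FF] f(2) by simp
      then have "(1\<^sub>m (fst P) - E) $$ (i, j) = 1\<^sub>m (fst P) $$ (i, j)" for i j by simp
      then have "E $$ (i, j) = 0" if "i < fst P" "j < fst P" for i j using that Ec by (metis carrier_matD index_minus_mat(1) diff_eq_eq add_cancel_left_right)
      then have "E = 0\<^sub>m (fst P) (fst P)" using Ec by (intro eq_matI) auto
      then show ?thesis ..
    qed
  qed
  then show ?thesis using P f that by blast
qed

end

subsection \<open>The regular module and the Frobenius form\<close>

lemma injective_square_inverse: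
  fixes A :: "'a::field mat"
  assumes A: "A \<in> carrier_mat n n" and inj: "\<And>v. v \<in> carrier_vec n \<Longrightarrow> A *\<^sub>v v = 0\<^sub>v n \<Longrightarrow> v = 0\<^sub>v n"
  obtains B where "B \<in> carrier_mat n n" "A * B = 1\<^sub>m n" "B * A = 1\<^sub>m n"
proof -
  have "det A \<noteq> 0" using det_0_iff_vec_prod_zero_field[OF A] inj by blast
  from det_non_zero_imp_unit[OF A this, of "()"] show ?thesis
    using that unfolding Units_def by (auto simp: ring_mat_simps)
qed

lemma idem_rank_eq_one:
  fixes E :: "'a::field mat"
  assumes E: "E \<in> carrier_mat n n" and w: "w \<in> carrier_vec n" "w \<noteq> 0\<^sub>v n" "E *\<^sub>v w = w"
    and sp: "\<And>x. x \<in> carrier_vec n \<Longrightarrow> \<exists>c. E *\<^sub>v x = c \<cdot>\<^sub>v w"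
  shows "idem_rank E = 1"
proof -
  obtain j where j: "j < n" "w $ j \<noteq> 0"
  proof -
    have "\<exists>j<n. w $ j \<noteq> 0"
    proof (rule ccontr)
      assume "\<not> ?thesis"
      then have "w = 0\<^sub>v n" using w(1) by (intro eq_vecI) auto
      with w(2) show False ..
    qed
    then show thesis using that by blast
  qed
  \<comment> \<open>All columns of \<open>E\<close> are multiples of \<open>w\<close>, so
    \<open>E\<close> is \<open>w\<close> times a row; the row is obtained by comparing entries at an
    index where \<open>w\<close> is nonzero.\<close>
  define phi where "phi = mat 1 n (\<lambda>(_, k). E $$ (j, k) / w $ j)"
  have phi: "phi \<in> carrier_mat 1 n" by (simp add: phi_def)
  have "colm w * phi = E"
  proof (rule eq_matI)
    fix i k assume "i < dim_row E" "k < dim_col E"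
    then have ik: "i < n" "k < n" using E by auto
    obtain c where c: "E *\<^sub>v unit_vec n k = c \<cdot>\<^sub>v w" using sp[of "unit_vec n k"] by auto
    have "E *\<^sub>v unit_vec n k = col E k" using E ik by (intro eq_vecI) auto
    then have e: "E $$ (i', k) = c * w $ i'" if "i' < n" for i'
      using arg_cong[OF c, of "\<lambda>v. v $ i'"] E w ik that by simp
    have "(colm w * phi) $$ (i, k) = w $ i * phi $$ (0, k)"
      by (subst mult_index_carrier[OF colm_carrier[OF w(1)] phi ik]) (use w ik in simp)
    also have "\<dots> = E $$ (i, k)" using ik j by (simp add: phi_def e)
    finally show "(colm w * phi) $$ (i, k) = E $$ (i, k)" .
  qed (use E w phi in auto)
  moreover have "phi * colm w = 1\<^sub>m 1"
  proof (rule eq_matI)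
    fix i k assume "i < dim_row (1\<^sub>m 1 :: 'a mat)" "k < dim_col (1\<^sub>m 1 :: 'a mat)"
    then have ik: "i = 0" "k = 0" by auto
    have "(phi * colm w) $$ (0, 0) = (\<Sum>k<n. E $$ (j, k) / w $ j * w $ k)"
      by (subst mult_index_carrier[OF phi colm_carrier[OF w(1)]]) (use w in \<open>auto simp: phi_def\<close>)
    also have "\<dots> = (\<Sum>k<n. E $$ (j, k) * w $ k) / w $ j" by (simp add: sum_divide_distrib)
    also have "(\<Sum>k<n. E $$ (j, k) * w $ k) = w $ j"
      using arg_cong[OF w(3), of "\<lambda>v. v $ j"] mult_vec_index_carrier[OF E w(1) j(1)] by simp
    finally show "(phi * colm w) $$ (i, k) = 1\<^sub>m 1 $$ (i, k)" using ik j by simp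
  qed (use w phi in auto)
  ultimately show ?thesis using idem_rank_eq[OF colm_carrier[OF w(1)] phi] by metis
qed

lemma smult_mult_mat_vec:
  "A \<in> carrier_mat n m \<Longrightarrow> v \<in> carrier_vec m \<Longrightarrow> (c \<cdot>\<^sub>m A) *\<^sub>v v = c \<cdot>\<^sub>v (A *\<^sub>v v :: 'a::field vec)"
  by (intro eq_vecI) (auto simp: scalar_prod_def sum_distrib_left mult_ac)

context hopf_alg
begin

abbreviation reg :: "'k rep" where "reg \<equiv> regular_mod H"

lemma fst_reg [simp]: "fst reg = d"
  by (simp add: regular_mod_def)

lemma snd_reg: "snd reg i = mat d d (\<lambda>(k, j). hmu H i j k)"
  by (simp add: regular_mod_def)

lemma is_module_reg: "is_module H reg"
  unfolding is_module_iff
proof (intro conjI allI impI)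
  fix i assume i: "i < d"
  show "snd reg i \<in> carrier_mat (fst reg) (fst reg)" by (simp add: snd_reg)
  fix j assume j: "j < d"
  show "snd reg i * snd reg j = act reg (hmu H i j)"
  proof (rule eq_matI)
    fix k c assume "k < dim_row (act reg (hmu H i j))" "c < dim_col (act reg (hmu H i j))"
    then have kc: "k < d" "c < d" by auto
    have "(snd reg i * snd reg j) $$ (k, c) = (\<Sum>l<d. hmu H i l k * hmu H j c l)"
      by (subst mult_index_carrier[of _ d d _ d]) (use kc in \<open>auto simp: snd_reg\<close>)
    also have "\<dots> = (\<Sum>l<d. hmu H i j l * hmu H l c k)"
      using ax_assoc[OF i j kc(2,1)] by (simp add: mult.commute)
    also have "\<dots> = act reg (hmu H i j) $$ (k, c)" using kc by (simp add: act_def snd_reg)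
    finally show "(snd reg i * snd reg j) $$ (k, c) = act reg (hmu H i j) $$ (k, c)" .
  qed (auto simp: snd_reg)
next
  show "act reg (hunit H) = 1\<^sub>m (fst reg)"
    by (rule eq_matI) (auto simp: act_def snd_reg ax_unitl)
qed

definition uvec :: "'k vec" where "uvec = vec d (hunit H)"

lemma uvec_carrier [simp]: "uvec \<in> carrier_vec d"
  by (simp add: uvec_def)

text \<open>The matrix of \<open>A \<rightarrow> M\<close>, \<open>a \<mapsto> a v\<close>.\<close>
definition orb :: "'k rep \<Rightarrow> 'k vec \<Rightarrow> 'k mat" where
  "orb M v = mat (fst M) d (\<lambda>(r, i). (snd M i *\<^sub>v v) $ r)"

lemma orb_carrier [simp]: "orb M v \<in> carrier_mat (fst M) d"
  by (simp add: orb_def)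

lemma dim_orb [simp]: "dim_row (orb M v) = fst M" "dim_col (orb M v) = d"
  by (simp_all add: orb_def)

lemma col_orb: "is_module H M \<Longrightarrow> i < d \<Longrightarrow> col (orb M v) i = snd M i *\<^sub>v v"
  by (rule eq_vecI) (auto simp: orb_def module_dims)

lemma orb_mult_vec:
  assumes M: "is_module H M" and v: "v \<in> carrier_vec (fst M)"
  shows "orb M v *\<^sub>v vec d a = act M a *\<^sub>v v"
proof (rule eq_vecI)
  fix r assume "r < dim_vec (act M a *\<^sub>v v)"
  then have r: "r < fst M" by simp
  have "(orb M v *\<^sub>v vec d a) $ r = (\<Sum>i<d. (\<Sum>c<fst M. snd M i $$ (r, c) * v $ c) * a i)"
    unfolding mult_vec_index_carrier[OF orb_carrier vec_carrier r] using r
    by (intro sum.cong refl) (simp add: orb_def mult_vec_index_carrier[OF module_carrier[OF M] v r] del: index_mult_mat_vec)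
  also have "\<dots> = (\<Sum>c<fst M. \<Sum>i<d. a i * snd M i $$ (r, c) * v $ c)"
    unfolding sum_distrib_right by (subst sum.swap) (simp add: mult_ac)
  also have "\<dots> = (act M a *\<^sub>v v) $ r"
    unfolding mult_vec_index_carrier[OF act_carrier v r] using r by (simp add: act_def sum_distrib_right)
  finally show "(orb M v *\<^sub>v vec d a) $ r = (act M a *\<^sub>v v) $ r" .
qed (simp add: orb_def)

lemma orb_hom:
  assumes M: "is_module H M" and v: "v \<in> carrier_vec (fst M)"
  shows "mod_hom H reg M (orb M v)"
  unfolding mod_hom_def
proof (intro conjI allI impI)
  fix i assume i: "i < d"
  have rc: "snd reg i \<in> carrier_mat d d" using module_carrier[OF is_module_reg i] by simp
  note mc = module_carrier[OF M]
  show "orb M v * snd reg i = snd M i * orb M v"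
  proof (rule mat_col_eqI)
    fix j assume "j < dim_col (snd M i * orb M v)"
    then have j: "j < d" by (simp add: orb_def)
    have "col (orb M v * snd reg i) j = orb M v *\<^sub>v col (snd reg i) j"
      using rc j by (intro mult_col) simp
    also have "col (snd reg i) j = vec d (hmu H i j)" using j by (intro eq_vecI) (auto simp: snd_reg)
    also have "orb M v *\<^sub>v \<dots> = (snd M i * snd M j) *\<^sub>v v"
      unfolding orb_mult_vec[OF M v] module_mult[OF M i j] ..
    also have "\<dots> = snd M i *\<^sub>v col (orb M v) j"
      unfolding col_orb[OF M j] by (rule assoc_mult_mat_vec[OF mc[OF i] mc[OF j] v])
    also have "\<dots> = col (snd M i * orb M v) j"
      using j by (intro mult_col[symmetric]) (simp add: orb_def)
    finally show "col (orb M v * snd reg i) j = col (snd M i * orb M v) j" .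
  qed (use rc mc[OF i] in \<open>auto simp: orb_def\<close>)
qed simp

lemma orb_unit:
  assumes M: "is_module H M" and v: "v \<in> carrier_vec (fst M)"
  shows "orb M v *\<^sub>v uvec = v"
  unfolding uvec_def orb_mult_vec[OF M v] module_unit[OF M] using v by simp

lemma hom_from_reg:
  assumes M: "is_module H M" and f: "mod_hom H reg M f"
  shows "f = orb M (f *\<^sub>v uvec)"
proof (rule mat_col_eqI)
  note fc = hom_carrier[OF f, simplified]
  fix j assume "j < dim_col (orb M (f *\<^sub>v uvec))"
  then have j: "j < d" by (simp add: orb_def)
  have rc: "snd reg j \<in> carrier_mat d d" using module_carrier[OF is_module_reg j] by simp
  have "snd reg j *\<^sub>v uvec = unit_vec d j"
  proof (rule eq_vecI)
    fix k assume "k < dim_vec (unit_vec d j :: 'k vec)"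
    then have k: "k < d" by simp
    have "(snd reg j *\<^sub>v uvec) $ k = (\<Sum>l<d. hunit H l * hmu H j l k)"
      unfolding mult_vec_index_carrier[OF rc uvec_carrier k] using k by (simp add: snd_reg uvec_def mult.commute)
    then show "(snd reg j *\<^sub>v uvec) $ k = unit_vec d j $ k" using ax_unitr[OF j k] j k by simp
  qed (simp add: snd_reg)
  then have "col f j = f *\<^sub>v (snd reg j *\<^sub>v uvec)" using fc j by (auto intro!: eq_vecI)
  also have "\<dots> = (f * snd reg j) *\<^sub>v uvec" by (rule assoc_mult_mat_vec[OF fc rc uvec_carrier, symmetric])
  also have "\<dots> = snd M j *\<^sub>v (f *\<^sub>v uvec)"
    unfolding hom_comm[OF f j] by (rule assoc_mult_mat_vec[OF module_carrier[OF M j] fc uvec_carrier])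
  finally show "col f j = col (orb M (f *\<^sub>v uvec)) j" using col_orb[OF M j] by simp
qed (use hom_carrier[OF f] in \<open>auto simp: orb_def\<close>)

lemma projective_reg: "projective_mod H reg"
  unfolding projective_mod_def
proof (intro conjI allI impI)
  fix V W g h
  assume V: "is_module H V" "is_module H W" "mod_hom H V W g" "surj_mat g" and h: "mod_hom H reg W h"
  note gc = hom_carrier[OF V(3)] and hc = hom_carrier[OF h, simplified]
  have "h *\<^sub>v uvec \<in> carrier_vec (fst W)" using hc by simp
  then obtain v where v: "v \<in> carrier_vec (fst V)" "g *\<^sub>v v = h *\<^sub>v uvec"
    using V(4) gc unfolding surj_mat_def by (metis carrier_matD)
  note ov = orb_hom[OF V(1) v(1)]
  have hom: "mod_hom H reg W (g * orb V v)" by (rule mod_hom_comp[OF is_module_reg V(1,2) ov V(3)])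
  have "g * orb V v *\<^sub>v uvec = g *\<^sub>v (orb V v *\<^sub>v uvec)" by (rule assoc_mult_mat_vec[OF gc orb_carrier uvec_carrier])
  then have "g * orb V v *\<^sub>v uvec = h *\<^sub>v uvec" using orb_unit[OF V(1) v(1)] v(2) by simp
  then have "g * orb V v = h" using hom_from_reg[OF V(2) hom] hom_from_reg[OF V(2) h] by simp
  then show "\<exists>k. mod_hom H reg V k \<and> g * k = h" using ov by blast
qed (rule is_module_reg)

lemma inverse_hom:
  assumes M: "is_module H M" "is_module H N" and f: "mod_hom H M N f" and g: "g \<in> carrier_mat (fst M) (fst N)"
    and inv: "f * g = 1\<^sub>m (fst N)" "g * f = 1\<^sub>m (fst M)"
  shows "mod_hom H N M g"
  unfolding mod_hom_def
proof (intro conjI allI impI)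
  fix i assume i: "i < d"
  note fc = hom_carrier[OF f] and md = module_dims[OF M(1) i] module_dims[OF M(2) i]
  have "g * snd N i = g * (snd N i * f) * g" using fc g md inv by (simp add: mult_assoc_dim)
  also have "\<dots> = g * f * (snd M i * g)" unfolding hom_comm[OF f i, symmetric] using fc g md by (simp add: mult_assoc_dim)
  also have "\<dots> = snd M i * g" unfolding inv(2) using g md by simp
  finally show "g * snd N i = snd M i * g" .
qed (rule g)

text \<open>\<open>integral_faithful\<close> says that the Gram matrix of
  \<open>\<lambda>(x y)\<close> times the matrix of the antipode is injective. Both factors are
  square, so both are invertible: nondegeneracy of the form and bijectivity of the antipode come out
  together. \<open>t\<close> holds the coefficients of the inverse antipode.\<close>

lemma frobenius_form:
  obtains la B' t where "mat d d (\<lambda>(i, j). mul i j la) * B' = 1\<^sub>m d" "B' * mat d d (\<lambda>(i, j). mul i j la) = 1\<^sub>m d"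
    "B' \<in> carrier_mat d d"
    "\<And>m F. m < d \<Longrightarrow> (\<Sum>k<d. t m k * ant k F) = F m" "\<And>m F. m < d \<Longrightarrow> ant m (\<lambda>k. \<Sum>l<d. t k l * F l) = F m"
proof -
  obtain la b where la: "\<And>b G. b < d \<Longrightarrow> cop b (\<lambda>x y. G x * la y) = un G * la b" and b: "b < d" "la b \<noteq> 0"
    using ex_nonzero_integral by metis
  define B where "B = mat d d (\<lambda>(i, j). mul i j la)"
  define S where "S = mat d d (\<lambda>(l, k). hanti H k l)"
  have c: "B \<in> carrier_mat d d" "S \<in> carrier_mat d d" by (simp_all add: B_def S_def)
  have BS: "(B * S) $$ (i, a) = ant a (\<lambda>s. mul i s la)" if "i < d" "a < d" for i a
    unfolding mult_index_carrier[OF c that] using that by (simp add: B_def S_def ant_def mult.commute)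
  have "v = 0\<^sub>v d" if v: "v \<in> carrier_vec d" "B * S *\<^sub>v v = 0\<^sub>v d" for v
  proof (rule eq_vecI)
    fix j assume "j < dim_vec (0\<^sub>v d :: 'k vec)"
    then have j: "j < d" by simp
    have "(\<Sum>a<d. v $ a * ant a (\<lambda>s. mul i s la)) = 0" if i: "i < d" for i
    proof -
      have "(B * S *\<^sub>v v) $ i = (\<Sum>a<d. (B * S) $$ (i, a) * v $ a)"
        using c v(1) i by (intro mult_vec_index_carrier) auto
      then show ?thesis using v(2) i by (simp add: BS mult.commute del: index_mult_mat)
    qed
    then show "v $ j = 0\<^sub>v d $ j" using integral_faithful[OF la b _ j, of "\<lambda>a. v $ a"] j by simp
  qed (use that in auto)
  then obtain T where T: "T \<in> carrier_mat d d" "B * S * T = 1\<^sub>m d" "T * (B * S) = 1\<^sub>m d"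
    by (rule injective_square_inverse[OF mult_carrier_mat[OF c]]) auto
  have B': "S * T \<in> carrier_mat d d" "B * (S * T) = 1\<^sub>m d" using c T by (auto simp: mult_assoc_dim)
  have S': "T * B \<in> carrier_mat d d" "(T * B) * S = 1\<^sub>m d" using c T by (auto simp: mult_assoc_dim)
  have SS': "S * (T * B) = 1\<^sub>m d" by (rule square_inverse[OF S'(1) c(2) S'(2)])
  define t where "t k l = (T * B) $$ (l, k)" for k l
  show ?thesis
  proof (rule that[of la "S * T" t, folded B_def])
    show "B * (S * T) = 1\<^sub>m d" by (rule B'(2))
    show "S * T * B = 1\<^sub>m d" by (rule square_inverse[OF c(1) B'])
    show "S * T \<in> carrier_mat d d" by (rule B'(1))
    fix m F assume m: "m < d"
    have e1: "(\<Sum>k<d. hanti H k l * t m k) = dlt l m" if "l < d" for l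
      using arg_cong[OF SS', of "\<lambda>X. X $$ (l, m)"] mult_index_carrier[OF c(2) S'(1) that m] that m
      by (simp add: t_def S_def)
    have "(\<Sum>k<d. t m k * ant k F) = (\<Sum>l<d. (\<Sum>k<d. hanti H k l * t m k) * F l)"
      unfolding ant_def sum_distrib_left sum_distrib_right by (subst sum.swap) (simp add: mult_ac)
    also have "\<dots> = (\<Sum>l<d. dlt m l * F l)" using e1 by (auto intro!: sum.cong)
    finally show "(\<Sum>k<d. t m k * ant k F) = F m" using m by (simp only: sum_delta)
    have e2: "(\<Sum>k<d. t k l * hanti H m k) = dlt l m" if "l < d" for l
      using arg_cong[OF S'(2), of "\<lambda>X. X $$ (l, m)"] mult_index_carrier[OF S'(1) c(2) that m] that m
      by (simp add: t_def S_def)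
    have "ant m (\<lambda>k. \<Sum>l<d. t k l * F l) = (\<Sum>l<d. (\<Sum>k<d. t k l * hanti H m k) * F l)"
      unfolding ant_def sum_distrib_left sum_distrib_right by (subst sum.swap) (simp add: mult_ac)
    also have "\<dots> = (\<Sum>l<d. dlt m l * F l)" using e2 by (auto intro!: sum.cong)
    finally show "ant m (\<lambda>k. \<Sum>l<d. t k l * F l) = F m" using m by (simp only: sum_delta)
  qed
qed

text \<open>Left and right multiplication by \<open>e\<close> are adjoint with respect to the nondegenerate associative form \<open>(x, y) \<mapsto> \<lambda>(x y)\<close>.\<close>
lemma idem_rank_left_right:
  assumes idem: "orb reg (vec d e) * orb reg (vec d e) = orb reg (vec d e)"
  shows "idem_rank (act reg e) = idem_rank (orb reg (vec d e))"
proof -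
  obtain la B' where B': "mat d d (\<lambda>(i, j). mul i j la) * B' = 1\<^sub>m d" "B' * mat d d (\<lambda>(i, j). mul i j la) = 1\<^sub>m d"
    "B' \<in> carrier_mat d d" by (rule frobenius_form)
  define B where "B = mat d d (\<lambda>(i, j). mul i j la)"
  let ?R = "orb reg (vec d e)" and ?L = "act reg e"
  have c: "B \<in> carrier_mat d d" "?R \<in> carrier_mat d d" "?L \<in> carrier_mat d d" "transpose_mat ?R \<in> carrier_mat d d"
    using orb_carrier[of reg] act_carrier[of reg] by (auto simp: B_def)
  have R: "?R $$ (k, i) = (\<Sum>j<d. e j * hmu H i j k)" if "k < d" "i < d" for k i
  proof -
    have rc: "snd reg i \<in> carrier_mat d d" using module_carrier[OF is_module_reg that(2)] by simp
    have "(snd reg i *\<^sub>v vec d e) $ k = (\<Sum>j<d. e j * hmu H i j k)"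
      unfolding mult_vec_index_carrier[OF rc vec_carrier that(1)] using that by (simp add: snd_reg mult.commute)
    then show ?thesis using that by (simp add: orb_def del: index_mult_mat_vec)
  qed
  have L: "?L $$ (k, j) = (\<Sum>i<d. e i * hmu H i j k)" if "k < d" "j < d" for k j
    using that by (simp add: act_def snd_reg)
  have adj: "transpose_mat ?R * B = B * ?L"
  proof (rule eq_matI)
    fix i j assume "i < dim_row (B * ?L)" "j < dim_col (B * ?L)"
    then have ij: "i < d" "j < d" using c by auto
    have "(transpose_mat ?R * B) $$ (i, j) = (\<Sum>k<d. (\<Sum>l<d. e l * hmu H i l k) * mul k j la)"
      unfolding mult_index_carrier[OF c(4,1) ij] using ij c(2) by (simp add: R B_def)
    also have "\<dots> = (\<Sum>l<d. e l * mul i l (\<lambda>k. mul k j la))"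
      unfolding sum_distrib_right mul_def[of i] sum_distrib_left by (subst sum.swap) (simp add: mult_ac)
    also have "\<dots> = (\<Sum>l<d. e l * mul l j (\<lambda>k. mul i k la))" using ij by (simp add: mul_assoc)
    also have "\<dots> = (\<Sum>k<d. mul i k la * (\<Sum>l<d. e l * hmu H l j k))"
      unfolding mul_def[of _ j] sum_distrib_left by (subst sum.swap) (simp add: mult_ac)
    also have "\<dots> = (B * ?L) $$ (i, j)"
      unfolding mult_index_carrier[OF c(1,3) ij] using ij by (simp add: L B_def)
    finally show "(transpose_mat ?R * B) $$ (i, j) = (B * ?L) $$ (i, j)" .
  qed (use c in auto)
  have "?L = B' * transpose_mat ?R * B"
    using c B' adj B'(2)[folded B_def, THEN mult_eq_assoc, of ?L] by (simp add: mult_assoc_dim)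
  moreover have "transpose_mat ?R * transpose_mat ?R = transpose_mat ?R"
    using transpose_mult[OF c(2,2)] idem by simp
  ultimately have "idem_rank ?L = idem_rank (transpose_mat ?R)"
    using idem_rank_similar[OF c(4) _ B'(3) c(1) B'(1)[folded B_def]] by simp
  then show ?thesis using idem_rank_transpose[OF c(2) idem] by simp
qed

text \<open>The projective cover P of S splits off A. The projection \<open>E\<close> of A onto it
  is right multiplication by \<open>e = E(1)\<close>, so P is \<open>A e\<close> and
  \<open>e\<close> is idempotent. Evaluation at \<open>e\<close> identifies Hom(P, M) with
  \<open>e M\<close>, which has dimension 1 for S and 0 for the other simple modules. On A itself
  the rank is dim \<open>e A\<close>, which equals dim \<open>A e\<close> by the Frobenius
  form.\<close>

lemma simple_idempotent:
  assumes ac: "alg_closed_field TYPE('k)" and S: "simple_mod H S"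
  obtains e P where "\<And>M. is_module H M \<Longrightarrow> act M e * act M e = act M e"
    "idem_rank (act S e) = 1"
    "\<And>S'. simple_mod H S' \<Longrightarrow> \<not> mod_iso H S S' \<Longrightarrow> act S' e = 0\<^sub>m (fst S') (fst S')"
    "indecomposable_mod H P" "projective_mod H P" "idem_rank (act reg e) = fst P"
    "\<exists>f. mod_hom H P S f \<and> f \<noteq> 0\<^sub>m (fst S) (fst P)"
proof -
  have Sm: "is_module H S" "0 < fst S" using S by (auto simp: simple_mod_def)
  define v where "v = (unit_vec (fst S) 0 :: 'k vec)"
  have v: "v \<in> carrier_vec (fst S)" "v \<noteq> 0\<^sub>v (fst S)" using Sm by (auto simp: v_def)
  let ?q = "orb S v"
  have q: "mod_hom H reg S ?q" "?q \<noteq> 0\<^sub>m (fst S) (fst reg)"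
    using orb_hom[OF Sm(1) v(1)] orb_unit[OF Sm(1) v(1)] v(2) zero_mult_vec[OF uvec_carrier] by auto
  obtain P f where P: "indecomposable_mod H P" "projective_mod H P" and f: "mod_hom H P S f" "f \<noteq> 0\<^sub>m (fst S) (fst P)"
    by (rule ex_indecomposable_projective[OF projective_reg S q])
  have Pm: "is_module H P" using P by (simp add: indecomposable_mod_def)
  obtain io where io: "mod_hom H P reg io" "?q * io = f"
    using projectiveD[OF P(2) is_module_reg Sm(1) q(1) simple_hom_surj[OF is_module_reg S q] f(1)] by blast
  obtain p0 where p0: "mod_hom H reg P p0" "f * p0 = ?q"
    using projectiveD[OF projective_reg Pm Sm(1) f(1) simple_hom_surj[OF Pm S f] q(1)] by blast
  note fc = hom_carrier[OF f(1)] and ioc = hom_carrier[OF io(1), simplified] and p0c = hom_carrier[OF p0(1), simplified]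
  have pio: "mod_hom H P P (p0 * io)" by (rule mod_hom_comp[OF Pm is_module_reg Pm io(1) p0(1)])
  have "f * (p0 * io) = f" using fc p0c ioc io(2) p0(2) by (simp add: mult_assoc_dim[symmetric])
  then obtain z where z: "z \<in> carrier_mat (fst P) (fst P)" "z * (p0 * io) = 1\<^sub>m (fst P)" "p0 * io * z = 1\<^sub>m (fst P)"
    using fixing_endo_invertible[OF P(1) pio fc f(2)] by metis
  \<comment> \<open>The lifts \<open>io\<close> and \<open>p0\<close> only satisfy
    \<open>f p0 io = f\<close>. Hence \<open>p0 * io\<close> is invertible, and correcting
    \<open>p0\<close> by its inverse gives a genuine retraction.\<close>
  define p where "p = z * p0"
  have p: "mod_hom H reg P p" unfolding p_def
    by (rule mod_hom_comp[OF is_module_reg Pm Pm p0(1) inverse_hom[OF Pm Pm pio z(1,3,2)]])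
  note pc = hom_carrier[OF p, simplified]
  have pi: "p * io = 1\<^sub>m (fst P)" unfolding p_def using z p0c ioc by (simp add: mult_assoc_dim)
  define E where "E = io * p"
  have E: "mod_hom H reg reg E" unfolding E_def by (rule mod_hom_comp[OF is_module_reg Pm is_module_reg p io(1)])
  note Ec = hom_carrier[OF E, simplified]
  have EE: "E * E = E" unfolding E_def using pc ioc by (simp add: mult_assoc_dim pi[THEN mult_eq_assoc])
  have Eio: "E * io = io" unfolding E_def using pc ioc by (simp add: mult_assoc_dim pi)
  define e where "e k = (E *\<^sub>v uvec) $ k" for k
  have evec: "vec d e = E *\<^sub>v uvec" unfolding e_def using Ec by (intro eq_vecI) auto
  have ec: "vec d e \<in> carrier_vec (fst reg)" by simp
  have Eorb: "E = orb reg (vec d e)" unfolding evec by (rule hom_from_reg[OF is_module_reg E])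
  have Ee: "E *\<^sub>v vec d e = vec d e"
    unfolding evec using assoc_mult_mat_vec[OF Ec Ec uvec_carrier] EE by simp
  have amul_ee: "amul e e k = e k" if k: "k < d" for k
  proof -
    have "act reg e *\<^sub>v vec d e = vec d e"
      using orb_mult_vec[OF is_module_reg ec, of e] Ee Eorb by simp
    moreover have "(act reg e *\<^sub>v vec d e) $ k = amul e e k"
    proof -
      have "(act reg e *\<^sub>v vec d e) $ k = (\<Sum>j<d. (\<Sum>i<d. e i * hmu H i j k) * e j)"
        using k act_carrier[of reg e] by (subst mult_vec_index_carrier[where m = d and n = d]) (auto simp: act_def snd_reg)
      also have "\<dots> = amul e e k"
        unfolding amul_def sum_distrib_right by (subst sum.swap) (simp add: mult_ac)
      finally show ?thesis .
    qed
    ultimately show ?thesis using k by simp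
  qed
  have idem: "act M e * act M e = act M e" if "is_module H M" for M
    unfolding act_mult[OF that] unfolding act_def by (rule lincomb_cong) (simp_all add: amul_ee)
  \<comment> \<open>The map \<open>a \<mapsto> a (e y)\<close> sends \<open>e\<close> to
    \<open>e y\<close>. Restricted to \<open>P = A e\<close> it is the element of Hom(P, M) attached
    to \<open>e y\<close>, and nonzero as soon as \<open>e y\<close> is.\<close>
  have homE: "orb M (act M e *\<^sub>v y) *\<^sub>v vec d e = act M e *\<^sub>v y" if M: "is_module H M" and y: "y \<in> carrier_vec (fst M)" for M y
  proof -
    have "act M e *\<^sub>v y \<in> carrier_vec (fst M)" by (rule mult_mat_vec_carrier[OF act_carrier y])
    then have "orb M (act M e *\<^sub>v y) *\<^sub>v vec d e = act M e *\<^sub>v (act M e *\<^sub>v y)" by (rule orb_mult_vec[OF M])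
    also have "\<dots> = act M e *\<^sub>v y" using assoc_mult_mat_vec[OF act_carrier act_carrier y, of e e] idem[OF M] by simp
    finally show ?thesis .
  qed
  have io_pu: "io *\<^sub>v (p *\<^sub>v uvec) = vec d e"
    unfolding evec E_def using assoc_mult_mat_vec[OF ioc pc uvec_carrier] by simp
  have ohom: "mod_hom H P M (orb M y * io)" if "is_module H M" "y \<in> carrier_vec (fst M)" for M y
    by (rule mod_hom_comp[OF Pm is_module_reg that(1) io(1) orb_hom[OF that]])
  have oval: "(orb M (act M e *\<^sub>v y) * io) *\<^sub>v (p *\<^sub>v uvec) = act M e *\<^sub>v y"
    if M: "is_module H M" and y: "y \<in> carrier_vec (fst M)" for M y
    using assoc_mult_mat_vec[OF orb_carrier ioc, of "p *\<^sub>v uvec" M "act M e *\<^sub>v y"] pc io_pu homE[OF M y] by simp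
  have puc: "p *\<^sub>v uvec \<in> carrier_vec (fst P)" using pc by auto
  have onz: "orb M (act M e *\<^sub>v y) * io \<noteq> 0\<^sub>m (fst M) (fst P)"
    if M: "is_module H M" and y: "y \<in> carrier_vec (fst M)" and nz: "act M e *\<^sub>v y \<noteq> 0\<^sub>v (fst M)" for M y
    using oval[OF M y] zero_mult_vec[OF puc] nz by auto
  show ?thesis
  proof (rule that[OF idem])
    define w where "w = act S e *\<^sub>v v"
    have wc: "w \<in> carrier_vec (fst S)" unfolding w_def by (rule mult_mat_vec_carrier[OF act_carrier v(1)])
    \<comment> \<open>If \<open>e v = 0\<close>, the map \<open>a \<mapsto> a v\<close> kills
      \<open>A e\<close>; but its restriction to P is \<open>f\<close>.\<close>
    have wnz: "w \<noteq> 0\<^sub>v (fst S)"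
    proof
      assume w0: "w = 0\<^sub>v (fst S)"
      have h: "mod_hom H reg S (?q * E)" by (rule mod_hom_comp[OF is_module_reg is_module_reg Sm(1) E q(1)])
      have "?q * E *\<^sub>v uvec = ?q *\<^sub>v (E *\<^sub>v uvec)" by (rule assoc_mult_mat_vec[OF orb_carrier Ec uvec_carrier])
      also have "\<dots> = w" unfolding evec[symmetric] w_def by (rule orb_mult_vec[OF Sm(1) v(1)])
      finally have "?q * E = orb S (0\<^sub>v (fst S))" using hom_from_reg[OF Sm(1) h] w0 by simp
      also have "\<dots> = 0\<^sub>m (fst S) d"
        using mult_zero_vec[OF module_carrier[OF Sm(1)]] by (intro eq_matI) (auto simp: orb_def)
      finally have "?q * E * io = 0\<^sub>m (fst S) (fst P)" using ioc by simp
      moreover have "?q * E * io = f" using orb_carrier[of S v] Ec ioc by (simp add: mult_assoc_dim Eio io(2))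
      ultimately show False using f(2) by simp
    qed
    have ew: "act S e *\<^sub>v w = w"
      unfolding w_def using assoc_mult_mat_vec[OF act_carrier act_carrier v(1), of e e] idem[OF Sm(1)] by simp
    have ohw: "mod_hom H P S (orb S w * io)" by (rule ohom[OF Sm(1) wc])
    have ow: "orb S w * io \<noteq> 0\<^sub>m (fst S) (fst P)" using onz[OF Sm(1) wc] ew wnz by simp
    show "idem_rank (act S e) = 1"
    proof (rule idem_rank_eq_one[OF act_carrier wc wnz ew])
      fix x :: "'k vec" assume x: "x \<in> carrier_vec (fst S)"
      let ?y = "act S e *\<^sub>v x"
      have yc: "?y \<in> carrier_vec (fst S)" by (rule mult_mat_vec_carrier[OF act_carrier x])
      obtain c where c: "orb S ?y * io = c \<cdot>\<^sub>m (orb S w * io)"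
        using indecomposable_projective_hom_simple_unique[OF ac P S ohw ow ohom[OF Sm(1) yc]] by blast
      have "?y = (c \<cdot>\<^sub>m (orb S w * io)) *\<^sub>v (p *\<^sub>v uvec)" using oval[OF Sm(1) x] c by simp
      also have "\<dots> = c \<cdot>\<^sub>v ((orb S w * io) *\<^sub>v (p *\<^sub>v uvec))"
        by (rule smult_mult_mat_vec[OF hom_carrier[OF ohw] puc])
      also have "\<dots> = c \<cdot>\<^sub>v w" using oval[OF Sm(1) wc] ew by simp
      finally show "\<exists>c. act S e *\<^sub>v x = c \<cdot>\<^sub>v w" by blast
    qed
    show "act S' e = 0\<^sub>m (fst S') (fst S')" if S': "simple_mod H S'" and ni: "\<not> mod_iso H S S'" for S'
    proof (rule ccontr)
      assume nz: "act S' e \<noteq> 0\<^sub>m (fst S') (fst S')"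
      have S'm: "is_module H S'" using S' by (simp add: simple_mod_def)
      obtain x where x: "x \<in> carrier_vec (fst S')" "act S' e *\<^sub>v x \<noteq> 0\<^sub>v (fst S')"
        by (rule ex_nonzero_mult_vec[OF act_carrier nz])
      have "act S' e *\<^sub>v x \<in> carrier_vec (fst S')" by (rule mult_mat_vec_carrier[OF act_carrier x(1)])
      then have "mod_iso H S S'"
        using indecomposable_projective_top_unique[OF P S S' f ohom[OF S'm] onz[OF S'm x]] by blast
      with ni show False ..
    qed
    show "indecomposable_mod H P" "projective_mod H P" by fact+
    show "idem_rank (act reg e) = fst P"
      using idem_rank_left_right[of e] EE idem_rank_eq[OF ioc pc pi] unfolding Eorb[symmetric] E_def[symmetric] by simp
    show "\<exists>f. mod_hom H P S f \<and> f \<noteq> 0\<^sub>m (fst S) (fst P)" using f by blast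
  qed
qed

end

subsection \<open>Tensor products\<close>

lemma sum_div_mod:
  fixes F :: "nat \<Rightarrow> nat \<Rightarrow> 'a::comm_monoid_add"
  assumes "0 < m"
  shows "(\<Sum>k<n * m. F (k div m) (k mod m)) = (\<Sum>a<n. \<Sum>b<m. F a b)"
proof (induction n)
  case (Suc n)
  have "(\<Sum>k<Suc n * m. F (k div m) (k mod m)) = (\<Sum>k<n * m + m. F (k div m) (k mod m))"
    by (simp add: add.commute)
  also have "\<dots> = (\<Sum>a<n. \<Sum>b<m. F a b) + (\<Sum>b<m. F ((n * m + b) div m) ((n * m + b) mod m))"
    unfolding sum_lessThan_add Suc.IH ..
  also have "(\<Sum>b<m. F ((n * m + b) div m) ((n * m + b) mod m)) = (\<Sum>b<m. F n b)"
    using assms by (intro sum.cong) auto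
  finally show ?case by simp
qed simp

lemma div_mod_less: "k < n * m \<Longrightarrow> k div m < n \<and> k mod m < (m::nat)"
  by (metis less_mult_imp_div_less mod_less_divisor mult_0_right not_gr_zero not_less_zero)

definition kron :: "'a::semiring_0 mat \<Rightarrow> 'a mat \<Rightarrow> 'a mat" where
  "kron A B = mat (dim_row A * dim_row B) (dim_col A * dim_col B)
     (\<lambda>(r, c). A $$ (r div dim_row B, c div dim_col B) * B $$ (r mod dim_row B, c mod dim_col B))"

lemma kron_carrier [simp]: "A \<in> carrier_mat n m \<Longrightarrow> B \<in> carrier_mat n' m' \<Longrightarrow> kron A B \<in> carrier_mat (n * n') (m * m')"
  by (auto simp: kron_def)

lemma dim_kron [simp]: "dim_row (kron A B) = dim_row A * dim_row B" "dim_col (kron A B) = dim_col A * dim_col B"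
  by (simp_all add: kron_def)

lemma kron_mult:
  fixes A :: "'a::comm_semiring_0 mat"
  assumes c: "A \<in> carrier_mat n m" "C \<in> carrier_mat m l" "B \<in> carrier_mat n' m'" "D \<in> carrier_mat m' l'"
  shows "kron A B * kron C D = kron (A * C) (B * D)"
proof (rule eq_matI)
  fix r s assume "r < dim_row (kron (A * C) (B * D))" "s < dim_col (kron (A * C) (B * D))"
  then have rs: "r < n * n'" "s < l * l'" using c by auto
  note r = div_mod_less[OF rs(1)] and s = div_mod_less[OF rs(2)]
  have k: "kron A B \<in> carrier_mat (n * n') (m * m')" "kron C D \<in> carrier_mat (m * m') (l * l')"
    using c by auto
  have "(kron A B * kron C D) $$ (r, s) = (\<Sum>k<m * m'. A $$ (r div n', k div m') * B $$ (r mod n', k mod m') *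
      (C $$ (k div m', s div l') * D $$ (k mod m', s mod l')))"
    unfolding mult_index_carrier[OF k rs] using c rs by (auto simp: kron_def intro!: sum.cong)
  also have "\<dots> = (\<Sum>a<m. \<Sum>b<m'. A $$ (r div n', a) * B $$ (r mod n', b) * (C $$ (a, s div l') * D $$ (b, s mod l')))"
  proof (cases "m' = 0")
    case False
    then show ?thesis
      using sum_div_mod[of m' "\<lambda>a b. A $$ (r div n', a) * B $$ (r mod n', b) * (C $$ (a, s div l') * D $$ (b, s mod l'))" m] by simp
  qed simp
  also have "\<dots> = (\<Sum>a<m. A $$ (r div n', a) * C $$ (a, s div l')) * (\<Sum>b<m'. B $$ (r mod n', b) * D $$ (b, s mod l'))"
    unfolding sum_product by (simp add: mult_ac)
  also have "\<dots> = kron (A * C) (B * D) $$ (r, s)"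
    using c rs r s by (simp add: kron_def mult_index_carrier[OF c(1,2)] mult_index_carrier[OF c(3,4)] del: index_mult_mat(1))
  finally show "(kron A B * kron C D) $$ (r, s) = kron (A * C) (B * D) $$ (r, s)" .
qed (use c in auto)

lemma kron_one_one: "kron (1\<^sub>m n) (1\<^sub>m m) = (1\<^sub>m (n * m) :: 'a::comm_semiring_1 mat)"
proof (rule eq_matI)
  fix r s assume "r < dim_row (1\<^sub>m (n * m) :: 'a mat)" "s < dim_col (1\<^sub>m (n * m) :: 'a mat)"
  then have rs: "r < n * m" "s < n * m" by auto
  have "r = s \<longleftrightarrow> r div m = s div m \<and> r mod m = s mod m" by (metis div_mult_mod_eq)
  then show "kron (1\<^sub>m n) (1\<^sub>m m) $$ (r, s) = (1\<^sub>m (n * m) :: 'a mat) $$ (r, s)"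
    using rs div_mod_less[OF rs(1)] div_mod_less[OF rs(2)] by (auto simp: kron_def)
qed auto

lemma kron_zero_right: "kron A (0\<^sub>m m l) = (0\<^sub>m (dim_row A * m) (dim_col A * l) :: 'a::comm_semiring_1 mat)"
proof (rule eq_matI)
  fix r s assume "r < dim_row (0\<^sub>m (dim_row A * m) (dim_col A * l) :: 'a mat)" "s < dim_col (0\<^sub>m (dim_row A * m) (dim_col A * l) :: 'a mat)"
  then have rs: "r < dim_row A * m" "s < dim_col A * l" by auto
  then show "kron A (0\<^sub>m m l) $$ (r, s) = (0\<^sub>m (dim_row A * m) (dim_col A * l) :: 'a mat) $$ (r, s)"
    using div_mod_less[OF rs(1)] div_mod_less[OF rs(2)] by (simp add: kron_def)
qed auto

lemma kron_add_right:
  fixes A :: "'a::comm_semiring_1 mat"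
  assumes "B \<in> carrier_mat m l" "C \<in> carrier_mat m l"
  shows "kron A (B + C) = kron A B + kron A C"
proof (rule eq_matI)
  fix r s assume "r < dim_row (kron A B + kron A C)" "s < dim_col (kron A B + kron A C)"
  then have rs: "r < dim_row A * m" "s < dim_col A * l" using assms by auto
  then show "kron A (B + C) $$ (r, s) = (kron A B + kron A C) $$ (r, s)"
    using assms div_mod_less[OF rs(1)] div_mod_less[OF rs(2)] by (simp add: kron_def distrib_left)
qed (use assms in auto)

lemma kron_lincomb:
  assumes B: "\<And>k. k < d \<Longrightarrow> B k \<in> carrier_mat m l" and A: "A \<in> carrier_mat n n'"
  shows "kron A (lincomb d m l c B) = lincomb d (n * m) (n' * l) c (\<lambda>k. kron A (B k))"
proof (rule eq_matI)
  fix r s assume "r < dim_row (lincomb d (n * m) (n' * l) c (\<lambda>k. kron A (B k)))" "s < dim_col (lincomb d (n * m) (n' * l) c (\<lambda>k. kron A (B k)))"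
  then have rs: "r < n * m" "s < n' * l" by auto
  have "lincomb d (n * m) (n' * l) c (\<lambda>k. kron A (B k)) $$ (r, s) = (\<Sum>k<d. c k * (A $$ (r div m, s div l) * B k $$ (r mod m, s mod l)))"
    using rs carrier_matD[OF A] by (auto simp: kron_def carrier_matD[OF B] intro!: sum.cong)
  then show "kron A (lincomb d m l c B) $$ (r, s) = lincomb d (n * m) (n' * l) c (\<lambda>k. kron A (B k)) $$ (r, s)"
    using rs div_mod_less[OF rs(1)] div_mod_less[OF rs(2)] A by (simp add: kron_def sum_distrib_left mult_ac)
qed (use A in auto)

context hopf_alg
begin

lemma fst_tensor [simp]: "fst (tensor_mod H V W) = fst V * fst W"
  by (simp add: tensor_mod_def Let_def)

lemma tensor_index:
  assumes "r < fst V * fst W" "c < fst V * fst W"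
  shows "snd (tensor_mod H V W) k $$ (r, c)
    = cop k (\<lambda>i j. snd V i $$ (r div fst W, c div fst W) * snd W j $$ (r mod fst W, c mod fst W))"
  using assms by (simp add: tensor_mod_def Let_def cop_def mult.assoc)

lemma tensor_carrier: "snd (tensor_mod H V W) k \<in> carrier_mat (fst V * fst W) (fst V * fst W)"
  by (simp add: tensor_mod_def Let_def)

lemma tensor_lincomb:
  assumes V: "is_module H V" and W: "is_module H W"
  shows "snd (tensor_mod H V W) k = lincomb d (fst V * fst W) (fst V * fst W) (\<lambda>_. 1)
    (\<lambda>i. lincomb d (fst V * fst W) (fst V * fst W) (hdelta H k i) (\<lambda>j. kron (snd V i) (snd W j)))" (is "_ = ?R")
proof (rule eq_matI)
  fix r c assume "r < dim_row ?R" "c < dim_col ?R"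
  then have rc: "r < fst V * fst W" "c < fst V * fst W" by auto
  then show "snd (tensor_mod H V W) k $$ (r, c) = ?R $$ (r, c)"
    unfolding tensor_index[OF rc] cop_def by (simp add: kron_def module_dims V W)
qed (simp_all add: tensor_mod_def Let_def)

lemma module_entry_mult:
  assumes V: "is_module H V" and "i < d" "j < d" "r < fst V" "c < fst V"
  shows "(\<Sum>z<fst V. snd V i $$ (r, z) * snd V j $$ (z, c)) = mul i j (\<lambda>k. snd V k $$ (r, c))"
proof -
  have "(\<Sum>z<fst V. snd V i $$ (r, z) * snd V j $$ (z, c)) = (snd V i * snd V j) $$ (r, c)"
    by (rule mult_index_carrier[symmetric]) (use assms module_carrier in auto)
  then show ?thesis unfolding module_mult[OF assms(1-3)] using assms(4,5) by (simp add: act_def mul_def)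
qed

lemma module_entry_unit:
  assumes V: "is_module H V" and "r < fst V" "c < fst V"
  shows "un (\<lambda>k. snd V k $$ (r, c)) = dlt r c"
  using arg_cong[OF module_unit[OF V], of "\<lambda>X. X $$ (r, c)"] assms by (simp add: act_def un_def)

lemma sum_cop_product:
  "(\<Sum>a\<in>A. \<Sum>b\<in>B. cop k (\<lambda>i j. f i a * g j b) * cop l (\<lambda>p q. f' p a * g' q b))
    = cop k (\<lambda>i j. cop l (\<lambda>p q. (\<Sum>a\<in>A. f i a * f' p a) * (\<Sum>b\<in>B. g j b * g' q b)))"
proof -
  have "cop k (\<lambda>i j. f i a * g j b) * cop l (\<lambda>p q. f' p a * g' q b)
    = cop k (\<lambda>i j. cop l (\<lambda>p q. (f i a * f' p a) * (g j b * g' q b)))" for a b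
  proof -
    have "cop k (\<lambda>i j. f i a * g j b) * cop l (\<lambda>p q. f' p a * g' q b)
      = cop k (\<lambda>i j. cop l (\<lambda>p q. (f i a * g j b) * (f' p a * g' q b)))"
      by (simp only: cop_scale(1)) (simp only: cop_scale(2))
    then show ?thesis by (simp only: mult_ac)
  qed
  then show ?thesis by (simp only: cop_sum[symmetric] sum_product[symmetric])
qed

lemma is_module_tensor:
  assumes V: "is_module H V" and W: "is_module H W"
  shows "is_module H (tensor_mod H V W)"
  unfolding is_module_iff
proof (intro conjI allI impI)
  let ?T = "tensor_mod H V W" and ?n = "fst V" and ?m = "fst W"
  fix a b assume ab: "a < d" "b < d"
  show "snd ?T a * snd ?T b = act ?T (hmu H a b)"
  proof (rule eq_matI)
    fix r c assume "r < dim_row (act ?T (hmu H a b))" "c < dim_col (act ?T (hmu H a b))"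
    then have rc: "r < ?n * ?m" "c < ?n * ?m" by auto
    note r = div_mod_less[OF rc(1)] and c = div_mod_less[OF rc(2)]
    have m0: "0 < ?m" using c by auto
    have "(snd ?T a * snd ?T b) $$ (r, c) = (\<Sum>z<?n * ?m. snd ?T a $$ (r, z) * snd ?T b $$ (z, c))"
      by (rule mult_index_carrier[OF tensor_carrier tensor_carrier rc])
    also have "\<dots> = (\<Sum>z<?n * ?m. cop a (\<lambda>i j. snd V i $$ (r div ?m, z div ?m) * snd W j $$ (r mod ?m, z mod ?m)) *
        cop b (\<lambda>i j. snd V i $$ (z div ?m, c div ?m) * snd W j $$ (z mod ?m, c mod ?m)))"
      by (intro sum.cong refl) (simp only: tensor_index rc lessThan_iff)
    also have "\<dots> = (\<Sum>z1<?n. \<Sum>z2<?m. cop a (\<lambda>i j. snd V i $$ (r div ?m, z1) * snd W j $$ (r mod ?m, z2)) *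
        cop b (\<lambda>i j. snd V i $$ (z1, c div ?m) * snd W j $$ (z2, c mod ?m)))"
      by (rule sum_div_mod[OF m0])
    also have "\<dots> = cop a (\<lambda>i j. cop b (\<lambda>p q. mul i p (\<lambda>k. snd V k $$ (r div ?m, c div ?m)) * mul j q (\<lambda>k. snd W k $$ (r mod ?m, c mod ?m))))"
      unfolding sum_cop_product using r c by (simp add: module_entry_mult V W)
    also have "\<dots> = cop a (\<lambda>i j. cop b (\<lambda>p q. mul i p (\<lambda>k. mul j q (\<lambda>k'. snd V k $$ (r div ?m, c div ?m) * snd W k' $$ (r mod ?m, c mod ?m)))))"
      by (simp only: mul_scale)
    also have "\<dots> = mul a b (\<lambda>k. cop k (\<lambda>i j. snd V i $$ (r div ?m, c div ?m) * snd W j $$ (r mod ?m, c mod ?m)))"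
      by (rule mul_cop[OF ab, symmetric])
    also have "\<dots> = act ?T (hmu H a b) $$ (r, c)"
      using rc by (simp add: act_def mul_def tensor_index)
    finally show "(snd ?T a * snd ?T b) $$ (r, c) = act ?T (hmu H a b) $$ (r, c)" .
  qed (simp_all add: tensor_mod_def Let_def)
next
  let ?T = "tensor_mod H V W" and ?n = "fst V" and ?m = "fst W"
  show "act ?T (hunit H) = 1\<^sub>m (fst ?T)"
  proof (rule eq_matI)
    fix r c assume "r < dim_row (1\<^sub>m (fst ?T) :: 'k mat)" "c < dim_col (1\<^sub>m (fst ?T) :: 'k mat)"
    then have rc: "r < ?n * ?m" "c < ?n * ?m" by auto
    note r = div_mod_less[OF rc(1)] and c = div_mod_less[OF rc(2)]
    have "act ?T (hunit H) $$ (r, c) = un (\<lambda>k. cop k (\<lambda>i j. snd V i $$ (r div ?m, c div ?m) * snd W j $$ (r mod ?m, c mod ?m)))"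
      using rc by (simp add: act_def un_def tensor_index)
    also have "\<dots> = dlt (r div ?m) (c div ?m) * dlt (r mod ?m) (c mod ?m)"
      unfolding un_cop using r c by (simp add: un_scale module_entry_unit V W)
    also have "\<dots> = 1\<^sub>m (fst ?T) $$ (r, c)"
      using rc by (auto simp: div_mult_mod_eq) (metis div_mult_mod_eq)+
    finally show "act ?T (hunit H) $$ (r, c) = 1\<^sub>m (fst ?T) $$ (r, c)" .
  qed simp_all
qed (use tensor_carrier in auto)

lemma tensor_hom:
  assumes X: "is_module H X" and M: "is_module H V" "is_module H W" and f: "mod_hom H V W f"
  shows "mod_hom H (tensor_mod H X V) (tensor_mod H X W) (kron (1\<^sub>m (fst X)) f)"
  unfolding mod_hom_def
proof (intro conjI allI impI)
  let ?K = "kron (1\<^sub>m (fst X)) f"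
  note fc = hom_carrier[OF f]
  have K: "?K \<in> carrier_mat (fst X * fst W) (fst X * fst V)" using kron_carrier[OF one_carrier_mat fc] by simp
  then show "?K \<in> carrier_mat (fst (tensor_mod H X W)) (fst (tensor_mod H X V))" by simp
  fix k assume k: "k < d"
  have c1: "kron (snd X i) (snd V j) \<in> carrier_mat (fst X * fst V) (fst X * fst V)" if "i < d" "j < d" for i j
    using kron_carrier[OF module_carrier[OF X that(1)] module_carrier[OF M(1) that(2)]] .
  have c2: "kron (snd X i) (snd W j) \<in> carrier_mat (fst X * fst W) (fst X * fst W)" if "i < d" "j < d" for i j
    using kron_carrier[OF module_carrier[OF X that(1)] module_carrier[OF M(2) that(2)]] .
  have e: "?K * kron (snd X i) (snd V j) = kron (snd X i) (snd W j) * ?K" if "i < d" "j < d" for i j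
    using module_carrier[OF X that(1)] hom_comm[OF f that(2)]
    by (simp add: kron_mult[OF one_carrier_mat module_carrier[OF X that(1)] fc module_carrier[OF M(1) that(2)]]
      kron_mult[OF module_carrier[OF X that(1)] one_carrier_mat module_carrier[OF M(2) that(2)] fc])
  show "?K * snd (tensor_mod H X V) k = snd (tensor_mod H X W) k * ?K"
    unfolding tensor_lincomb[OF X M(1)] tensor_lincomb[OF X M(2)]
    by (simp add: mult_lincomb[OF K] lincomb_mult[OF K] c1 c2 e cong: lincomb_cong)
qed

lemma tensor_split_exact:
  assumes X: "is_module H X" and se: "split_exact U V W f g f' g'"
  shows "split_exact (tensor_mod H X U) (tensor_mod H X V) (tensor_mod H X W)
    (kron (1\<^sub>m (fst X)) f) (kron (1\<^sub>m (fst X)) g) (kron (1\<^sub>m (fst X)) f') (kron (1\<^sub>m (fst X)) g')"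
proof -
  have M: "is_module H U" "is_module H V" "is_module H W" "mod_hom H U V f" "mod_hom H V W g"
    and c': "f' \<in> carrier_mat (fst U) (fst V)" "g' \<in> carrier_mat (fst V) (fst W)"
    and e: "f' * f = 1\<^sub>m (fst U)" "g * g' = 1\<^sub>m (fst W)" "g * f = 0\<^sub>m (fst W) (fst U)" "f * f' + g' * g = 1\<^sub>m (fst V)"
    using se by (auto simp: split_exact_def)
  note fc = hom_carrier[OF M(4)] and gc = hom_carrier[OF M(5)]
  let ?I = "1\<^sub>m (fst X) :: 'k mat"
  note km = kron_mult[OF one_carrier_mat one_carrier_mat]
  show ?thesis unfolding split_exact_def
  proof (intro conjI)
    show "is_module H (tensor_mod H X U)" "is_module H (tensor_mod H X V)" "is_module H (tensor_mod H X W)"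
      using X M is_module_tensor by auto
    show "mod_hom H (tensor_mod H X U) (tensor_mod H X V) (kron ?I f)" "mod_hom H (tensor_mod H X V) (tensor_mod H X W) (kron ?I g)"
      using X M tensor_hom by auto
    show "kron ?I f' \<in> carrier_mat (fst (tensor_mod H X U)) (fst (tensor_mod H X V))"
      "kron ?I g' \<in> carrier_mat (fst (tensor_mod H X V)) (fst (tensor_mod H X W))"
      using kron_carrier[OF one_carrier_mat c'(1)] kron_carrier[OF one_carrier_mat c'(2)] by auto
    show "kron ?I f' * kron ?I f = 1\<^sub>m (fst (tensor_mod H X U))"
      using km[OF c'(1) fc] e(1) by (simp add: kron_one_one)
    show "kron ?I g * kron ?I g' = 1\<^sub>m (fst (tensor_mod H X W))"
      using km[OF gc c'(2)] e(2) by (simp add: kron_one_one)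
    show "kron ?I g * kron ?I f = 0\<^sub>m (fst (tensor_mod H X W)) (fst (tensor_mod H X U))"
      using km[OF gc fc] e(3) by (simp add: kron_zero_right)
    have "kron ?I f * kron ?I f' + kron ?I g' * kron ?I g = kron ?I (f * f' + g' * g)"
      using km[OF fc c'(1)] km[OF c'(2) gc] kron_add_right[OF mult_carrier_mat[OF fc c'(1)] mult_carrier_mat[OF c'(2) gc], of ?I] by simp
    then show "kron ?I f * kron ?I f' + kron ?I g' * kron ?I g = 1\<^sub>m (fst (tensor_mod H X V))"
      using e(4) by (simp add: kron_one_one)
  qed
qed

lemma mod_iso_tensor:
  assumes X: "is_module H X" and M: "is_module H V" "is_module H W" and iso: "mod_iso H V W"
  shows "mod_iso H (tensor_mod H X V) (tensor_mod H X W)"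
proof -
  obtain f g where f: "mod_hom H V W f" and g: "g \<in> carrier_mat (fst V) (fst W)" and inv: "f * g = 1\<^sub>m (fst W)" "g * f = 1\<^sub>m (fst V)"
    using iso unfolding mod_iso_def by blast
  note km = kron_mult[OF one_carrier_mat one_carrier_mat]
  let ?I = "1\<^sub>m (fst X) :: 'k mat"
  have "kron ?I f * kron ?I g = 1\<^sub>m (fst X * fst W)" "kron ?I g * kron ?I f = 1\<^sub>m (fst X * fst V)"
    using km[OF hom_carrier[OF f] g] km[OF g hom_carrier[OF f]] inv by (simp_all add: kron_one_one)
  then show ?thesis unfolding mod_iso_def
    using tensor_hom[OF X M f] kron_carrier[OF one_carrier_mat g, of "fst X"] by auto
qed

section \<open>The trivial module and tensoring with the regular module\<close>

lemma fst_trivial [simp]: "fst (trivial_mod H) = 1"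
  by (simp add: trivial_mod_def)

lemma is_module_trivial: "is_module H (trivial_mod H)"
  unfolding is_module_iff trivial_mod_def act_def
  by (auto intro!: eq_matI simp: scalar_prod_def mul_eps[symmetric] mul_def un_eps[unfolded un_def])

text \<open>With a one-dimensional right factor the index splitting is trivial, so the counit axiom
  makes the two actions equal as matrices, not merely isomorphic.\<close>

lemma act_tensor_trivial:
  assumes V: "is_module H V"
  shows "act (tensor_mod H V (trivial_mod H)) a = act V a"
proof -
  have "snd (tensor_mod H V (trivial_mod H)) k = snd V k" if k: "k < d" for k
  proof (rule eq_matI)
    fix r c assume "r < dim_row (snd V k)" "c < dim_col (snd V k)"
    then have rc: "r < fst V" "c < fst V" using k by (auto simp: module_dims V)
    then have "snd (tensor_mod H V (trivial_mod H)) k $$ (r, c) = cop k (\<lambda>i j. snd V i $$ (r, c) * eps j)"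
      by (subst tensor_index) (simp_all add: trivial_mod_def)
    then show "snd (tensor_mod H V (trivial_mod H)) k $$ (r, c) = snd V k $$ (r, c)"
      using cop_eps_right[OF k, of "\<lambda>i. snd V i $$ (r, c)"] by (simp add: mult.commute)
  qed (use k in \<open>simp_all add: module_dims V tensor_mod_def trivial_mod_def Let_def\<close>)
  then show ?thesis unfolding act_def fst_tensor fst_trivial mult_1_right by (intro lincomb_cong) simp_all
qed

text \<open>\<open>S\<inverse>(a\<^sub>2) a\<^sub>1 = \<epsilon>(a) 1\<close>, where \<open>t\<close> is the matrix of \<open>S\<inverse>\<close>.\<close>
lemma antipode_inverse_conv:
  assumes t: "\<And>m F. m < d \<Longrightarrow> (\<Sum>k<d. t m k * ant k F) = F m" "\<And>m F. m < d \<Longrightarrow> ant m (\<lambda>k. \<Sum>l<d. t k l * F l) = F m"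
    and a: "a < d"
  shows "cop a (\<lambda>x y. \<Sum>k<d. t y k * mul k x F) = eps a * un F"
proof -
  define G where "G k = (\<Sum>l<d. t k l * F l)" for k
  have F: "F z = ant z G" if "z < d" for z unfolding G_def using t(2)[OF that] by simp
  have "cop a (\<lambda>x y. \<Sum>k<d. t y k * mul k x F) = cop a (\<lambda>x y. \<Sum>k<d. t y k * mul k x (\<lambda>z. ant z G))"
    by (simp add: F)
  also have "\<dots> = cop a (\<lambda>x y. \<Sum>k<d. t y k * ant k (\<lambda>u. ant x (\<lambda>s. mul s u G)))"
    by (simp add: ant_mul)
  also have "\<dots> = cop a (\<lambda>x y. ant x (\<lambda>s. mul s y G))"
    by (simp add: t(1))
  also have "\<dots> = eps a * un G" by (rule antipode_left[OF a])
  also have "un G = un (\<lambda>z. ant z G)" by (simp add: un_ant)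
  also have "\<dots> = un F" by (simp add: F)
  finally show ?thesis .
qed

text \<open>\<open>v \<otimes> a \<mapsto> a\<^sub>1 v \<otimes> a\<^sub>2\<close> identifies \<open>V \<otimes> A\<close> with a direct sum of \<open>dim V\<close> copies of \<open>A\<close>;
  its inverse needs the inverse of the antipode.\<close>
lemma idem_rank_tensor_reg:
  assumes V: "is_module H V" and idem: "act reg e * act reg e = act reg e"
  shows "idem_rank (act (tensor_mod H V reg) e) = fst V * idem_rank (act reg e)"
proof (cases "d = 0")
  case True
  have "act (tensor_mod H V reg) e = 0\<^sub>m 0 0" "act reg e = 0\<^sub>m 0 0"
    using True by (auto intro!: eq_matI)
  then show ?thesis by simp
next
  case False
  then have d0: "0 < d" by simp
  obtain la B' t where t: "\<And>m F. m < d \<Longrightarrow> (\<Sum>k<d. t m k * ant k F) = F m"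
    "\<And>m F. m < d \<Longrightarrow> ant m (\<lambda>k. \<Sum>l<d. t k l * F l) = F m" by (rule frobenius_form) blast
  let ?n = "fst V" and ?I = "1\<^sub>m (fst V) :: 'k mat" and ?T = "tensor_mod H V reg"
  define Phi where "Phi = mat (?n * d) (?n * d) (\<lambda>(r, c). cop (c mod d) (\<lambda>p q. snd V p $$ (r div d, c div d) * dlt q (r mod d)))"
  \<comment> \<open>\<open>Psi\<close> sends \<open>v \<otimes> a\<close> to
    \<open>S\<inverse>(a_1) v \<otimes> a_2\<close>. In \<open>Psi * Phi\<close> the factor
    \<open>S\<inverse>(a_2) a_1\<close> contracts by \<open>antipode_inverse_conv\<close>.\<close>
  define Psi where "Psi = mat (?n * d) (?n * d) (\<lambda>(r, c). cop (c mod d) (\<lambda>p q. (\<Sum>x<d. t p x * snd V x $$ (r div d, c div d)) * dlt q (r mod d)))"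
  have cPhi: "Phi \<in> carrier_mat (?n * d) (?n * d)" and cPsi: "Psi \<in> carrier_mat (?n * d) (?n * d)"
    by (simp_all add: Phi_def Psi_def)
  have PsiPhi: "Psi * Phi = 1\<^sub>m (?n * d)"
  proof (rule eq_matI)
    fix r c assume "r < dim_row (1\<^sub>m (?n * d) :: 'k mat)" "c < dim_col (1\<^sub>m (?n * d) :: 'k mat)"
    then have rc: "r < ?n * d" "c < ?n * d" by auto
    note r = div_mod_less[OF rc(1)] and c = div_mod_less[OF rc(2)]
    have "(Psi * Phi) $$ (r, c) = (\<Sum>z<?n * d. cop (z mod d) (\<lambda>p q. (\<Sum>x<d. t p x * snd V x $$ (r div d, z div d)) * dlt q (r mod d)) *
       cop (c mod d) (\<lambda>a b. snd V a $$ (z div d, c div d) * dlt b (z mod d)))"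
      unfolding mult_index_carrier[OF cPsi cPhi rc] using rc by (intro sum.cong refl) (simp add: Phi_def Psi_def)
    also have "\<dots> = (\<Sum>z1<?n. \<Sum>z2<d. cop z2 (\<lambda>p q. (\<Sum>x<d. t p x * snd V x $$ (r div d, z1)) * dlt q (r mod d)) *
       cop (c mod d) (\<lambda>a b. snd V a $$ (z1, c div d) * dlt b z2))"
      by (rule sum_div_mod[OF d0])
    also have "\<dots> = (\<Sum>z1<?n. cop (c mod d) (\<lambda>a b. cop b (\<lambda>p q. (\<Sum>x<d. t p x * (snd V x $$ (r div d, z1) * snd V a $$ (z1, c div d))) * dlt q (r mod d))))"
    proof (rule sum.cong[OF refl])
      fix z1
      let ?C = "\<lambda>z2. cop z2 (\<lambda>p q. (\<Sum>x<d. t p x * snd V x $$ (r div d, z1)) * dlt q (r mod d))"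
      have "(\<Sum>z2<d. C z2 * cop (c mod d) (\<lambda>a b. X a * dlt b z2)) = cop (c mod d) (\<lambda>a b. X a * C b)" for C X
      proof -
        have "(\<Sum>z2<d. C z2 * cop (c mod d) (\<lambda>a b. X a * dlt b z2)) = cop (c mod d) (\<lambda>a b. \<Sum>z2<d. dlt b z2 * (X a * C z2))"
          by (simp only: cop_sum cop_scale(1)[symmetric] mult_ac)
        also have "\<dots> = cop (c mod d) (\<lambda>a b. X a * C b)"
          by (rule cop_cong[OF refl]) (simp only: sum_delta)
        finally show ?thesis .
      qed
      from this[of ?C "\<lambda>a. snd V a $$ (z1, c div d)"]
      have "(\<Sum>z2<d. ?C z2 * cop (c mod d) (\<lambda>a b. snd V a $$ (z1, c div d) * dlt b z2))
        = cop (c mod d) (\<lambda>a b. snd V a $$ (z1, c div d) * ?C b)" .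
      also have "\<dots> = cop (c mod d) (\<lambda>a b. cop b (\<lambda>p q. (\<Sum>x<d. t p x * (snd V x $$ (r div d, z1) * snd V a $$ (z1, c div d))) * dlt q (r mod d)))"
        by (simp only: cop_scale(1)[symmetric] sum_distrib_left sum_distrib_right mult_ac)
      finally show "(\<Sum>z2<d. ?C z2 * cop (c mod d) (\<lambda>a b. snd V a $$ (z1, c div d) * dlt b z2))
        = cop (c mod d) (\<lambda>a b. cop b (\<lambda>p q. (\<Sum>x<d. t p x * (snd V x $$ (r div d, z1) * snd V a $$ (z1, c div d))) * dlt q (r mod d)))" .
    qed
    also have "\<dots> = cop (c mod d) (\<lambda>a b. cop b (\<lambda>p q. (\<Sum>x<d. t p x * (\<Sum>z1<?n. snd V x $$ (r div d, z1) * snd V a $$ (z1, c div d))) * dlt q (r mod d)))"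
    proof -
      have "(\<Sum>x<d. t p x * (\<Sum>z1<?n. G x z1)) * y = (\<Sum>z1<?n. (\<Sum>x<d. t p x * G x z1) * y)" for p y and G :: "nat \<Rightarrow> nat \<Rightarrow> 'k"
        unfolding sum_distrib_left sum_distrib_right by (rule sum.swap)
      then show ?thesis by (simp only: cop_sum)
    qed
    also have "\<dots> = cop (c mod d) (\<lambda>a b. cop b (\<lambda>p q. (\<Sum>x<d. t p x * mul x a (\<lambda>k. snd V k $$ (r div d, c div d))) * dlt q (r mod d)))"
      using r c by (simp add: module_entry_mult V)
    also have "\<dots> = cop (c mod d) (\<lambda>w q. cop w (\<lambda>a p. (\<Sum>x<d. t p x * mul x a (\<lambda>k. snd V k $$ (r div d, c div d))) * dlt q (r mod d)))"
      using c by (intro cop_coassoc[symmetric]) simp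
    also have "\<dots> = cop (c mod d) (\<lambda>w q. eps w * (dlt (r div d) (c div d) * dlt q (r mod d)))"
      using r c by (intro cop_cong refl) (simp only: cop_scale(2) antipode_inverse_conv[OF t] module_entry_unit[OF V] mult.assoc)
    also have "\<dots> = dlt (r div d) (c div d) * dlt (c mod d) (r mod d)"
      using c by (intro cop_eps_left) simp
    also have "\<dots> = 1\<^sub>m (?n * d) $$ (r, c)"
      using rc by auto (metis div_mult_mod_eq)+
    finally show "(Psi * Phi) $$ (r, c) = 1\<^sub>m (?n * d) $$ (r, c)" .
  qed (simp_all add: Phi_def Psi_def)
  have PhiPsi: "Phi * Psi = 1\<^sub>m (?n * d)" by (rule square_inverse[OF cPsi cPhi PsiPhi])
  have rc: "snd reg k \<in> carrier_mat d d" for k by (simp add: snd_reg)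
  have cK: "kron ?I (snd reg k) \<in> carrier_mat (?n * d) (?n * d)" for k
    by (rule kron_carrier[OF one_carrier_mat rc])
  have cT: "snd ?T k \<in> carrier_mat (?n * d) (?n * d)" for k using tensor_carrier[of V reg k] by simp
  \<comment> \<open>On the source only the second tensor factor is acted on. By multiplicativity of
    the coproduct, \<open>b_1 a_1 v \<otimes> b_2 a_2\<close> is the image of
    \<open>v \<otimes> b a\<close>.\<close>
  have comm: "snd ?T k * Phi = Phi * kron ?I (snd reg k)" if k: "k < d" for k
  proof (rule eq_matI)
    fix r c assume "r < dim_row (Phi * kron ?I (snd reg k))" "c < dim_col (Phi * kron ?I (snd reg k))"
    then have rc': "r < ?n * d" "c < ?n * d" using cPhi carrier_matD[OF rc[of k]] by auto
    note r = div_mod_less[OF rc'(1)] and c = div_mod_less[OF rc'(2)]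
    have "(snd ?T k * Phi) $$ (r, c) = (\<Sum>z<?n * d. cop k (\<lambda>i j. snd V i $$ (r div d, z div d) * snd reg j $$ (r mod d, z mod d)) *
       cop (c mod d) (\<lambda>p q. snd V p $$ (z div d, c div d) * dlt q (z mod d)))"
      unfolding mult_index_carrier[OF cT cPhi rc'] using rc' by (intro sum.cong refl) (simp add: tensor_index Phi_def)
    also have "\<dots> = (\<Sum>z1<?n. \<Sum>z2<d. cop k (\<lambda>i j. snd V i $$ (r div d, z1) * snd reg j $$ (r mod d, z2)) *
       cop (c mod d) (\<lambda>p q. snd V p $$ (z1, c div d) * dlt q z2))"
      by (rule sum_div_mod[OF d0])
    also have "\<dots> = cop k (\<lambda>i j. cop (c mod d) (\<lambda>p q. mul i p (\<lambda>a. snd V a $$ (r div d, c div d)) * (\<Sum>z2<d. snd reg j $$ (r mod d, z2) * dlt q z2)))"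
      unfolding sum_cop_product using r c by (simp add: module_entry_mult V)
    also have "\<dots> = cop k (\<lambda>i j. cop (c mod d) (\<lambda>p q. mul i p (\<lambda>a. snd V a $$ (r div d, c div d)) * mul j q (\<lambda>b. dlt b (r mod d))))"
    proof (intro cop_cong refl arg_cong2[where f = times])
      fix j q assume jq: "j < d" "q < d"
      have "(\<Sum>z2<d. snd reg j $$ (r mod d, z2) * dlt q z2) = (\<Sum>z2<d. dlt q z2 * snd reg j $$ (r mod d, z2))"
        by (simp only: mult.commute)
      also have "\<dots> = hmu H j q (r mod d)" using jq r by (simp only: sum_delta) (simp add: snd_reg)
      also have "\<dots> = (\<Sum>b<d. dlt (r mod d) b * hmu H j q b)" using r by (simp only: sum_delta)
      also have "\<dots> = mul j q (\<lambda>b. dlt b (r mod d))" unfolding mul_def by (intro sum.cong refl) auto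
      finally show "(\<Sum>z2<d. snd reg j $$ (r mod d, z2) * dlt q z2) = mul j q (\<lambda>b. dlt b (r mod d))" .
    qed
    also have "\<dots> = mul k (c mod d) (\<lambda>z. cop z (\<lambda>p q. snd V p $$ (r div d, c div d) * dlt q (r mod d)))"
      using k c by (simp only: mul_cop mul_scale)
    also have "\<dots> = (\<Sum>z2<d. cop z2 (\<lambda>p q. snd V p $$ (r div d, c div d) * dlt q (r mod d)) * snd reg k $$ (z2, c mod d))"
      unfolding mul_def using c by (intro sum.cong refl) (simp add: snd_reg)
    also have "\<dots> = (\<Sum>z1<?n. dlt (c div d) z1 * (\<Sum>z2<d. cop z2 (\<lambda>p q. snd V p $$ (r div d, z1) * dlt q (r mod d)) * snd reg k $$ (z2, c mod d)))"
      using c by (simp only: sum_delta)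
    also have "\<dots> = (\<Sum>z1<?n. \<Sum>z2<d. cop z2 (\<lambda>p q. snd V p $$ (r div d, z1) * dlt q (r mod d)) * (dlt z1 (c div d) * snd reg k $$ (z2, c mod d)))"
      unfolding sum_distrib_left by (intro sum.cong refl) auto
    also have "\<dots> = (\<Sum>z<?n * d. cop (z mod d) (\<lambda>p q. snd V p $$ (r div d, z div d) * dlt q (r mod d)) * (dlt (z div d) (c div d) * snd reg k $$ (z mod d, c mod d)))"
      by (rule sum_div_mod[OF d0, symmetric])
    also have "\<dots> = (Phi * kron ?I (snd reg k)) $$ (r, c)"
      unfolding mult_index_carrier[OF cPhi cK rc'] using rc' c carrier_matD[OF rc[of k]] div_mod_less
      by (intro sum.cong refl arg_cong2[where f = times]) (simp_all add: Phi_def kron_def less_mult_imp_div_less)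
    finally show "(snd ?T k * Phi) $$ (r, c) = (Phi * kron ?I (snd reg k)) $$ (r, c)" .
  qed (use cPhi cK[of k] cT[of k] in auto)
  have actT: "act ?T e * Phi = Phi * kron ?I (act reg e)"
  proof -
    have "act ?T e * Phi = lincomb d (?n * d) (?n * d) e (\<lambda>k. snd ?T k * Phi)"
      unfolding act_def using cT by (simp add: lincomb_mult[OF cPhi])
    also have "\<dots> = lincomb d (?n * d) (?n * d) e (\<lambda>k. Phi * kron ?I (snd reg k))"
      by (rule lincomb_cong) (simp_all add: comm)
    also have "\<dots> = Phi * lincomb d (?n * d) (?n * d) e (\<lambda>k. kron ?I (snd reg k))"
      using cK by (simp add: mult_lincomb[OF cPhi])
    also have "lincomb d (?n * d) (?n * d) e (\<lambda>k. kron ?I (snd reg k)) = kron ?I (act reg e)"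
      unfolding act_def using rc by (simp add: kron_lincomb[OF _ one_carrier_mat])
    finally show ?thesis .
  qed
  have cL: "act reg e \<in> carrier_mat d d" using act_carrier[of reg e] by simp
  have cA: "act ?T e \<in> carrier_mat (?n * d) (?n * d)" using act_carrier[of ?T e] by simp
  have cKL: "kron ?I (act reg e) \<in> carrier_mat (?n * d) (?n * d)" by (rule kron_carrier[OF one_carrier_mat cL])
  have "act ?T e = Phi * kron ?I (act reg e) * Psi"
    unfolding actT[symmetric] using cPhi cPsi cA PhiPsi by (simp add: mult_assoc_dim)
  moreover have "kron ?I (act reg e) * kron ?I (act reg e) = kron ?I (act reg e)"
    using kron_mult[OF one_carrier_mat one_carrier_mat cL cL] idem by simp
  ultimately have 1: "idem_rank (act ?T e) = idem_rank (kron ?I (act reg e))"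
    using idem_rank_similar[OF cKL _ cPhi cPsi PsiPhi] by simp
  obtain r f f' where f: "f \<in> carrier_mat d r" "f' \<in> carrier_mat r d" "f * f' = act reg e" "f' * f = 1\<^sub>m r"
    by (rule idem_factor[OF cL idem])
  have "idem_rank (kron ?I f * kron ?I f') = ?n * r"
  proof (rule idem_rank_eq[OF kron_carrier[OF one_carrier_mat f(1)] kron_carrier[OF one_carrier_mat f(2)]])
    show "kron ?I f' * kron ?I f = 1\<^sub>m (?n * r)"
      using kron_mult[OF one_carrier_mat one_carrier_mat f(2,1)] f(4) by (simp add: kron_one_one)
  qed
  moreover have "kron ?I f * kron ?I f' = kron ?I (act reg e)"
    using kron_mult[OF one_carrier_mat one_carrier_mat f(1,2)] f(3) by simp
  moreover have "idem_rank (act reg e) = r" using idem_rank_eq[OF f(1,2,4)] f(3) by simp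
  ultimately show ?thesis using 1 by simp
qed

end

subsection \<open>The Grothendieck group\<close>

text \<open>The additive extension of the weight \<open>w\<close> to the free abelian group.\<close>

definition wsum :: "('a \<Rightarrow> int) \<Rightarrow> ('a \<Rightarrow>\<^sub>0 int) \<Rightarrow> int" where
  "wsum w a = (\<Sum>C\<in>Poly_Mapping.keys a. poly_mapping.lookup a C * w C)"

lemma wsum_superset:
  "finite B \<Longrightarrow> Poly_Mapping.keys a \<subseteq> B \<Longrightarrow> wsum w a = (\<Sum>C\<in>B. poly_mapping.lookup a C * w C)"
  unfolding wsum_def by (rule sum.mono_neutral_left) (auto simp: in_keys_iff)

lemma wsum_0 [simp]: "wsum w 0 = 0"
  by (simp add: wsum_def)

lemma wsum_add [simp]: "wsum w (a + b) = wsum w a + wsum w b"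
proof -
  let ?B = "Poly_Mapping.keys a \<union> Poly_Mapping.keys b"
  have "wsum w (a + b) = (\<Sum>C\<in>?B. poly_mapping.lookup (a + b) C * w C)"
    by (rule wsum_superset[OF _ keys_add]) simp
  also have "\<dots> = wsum w a + wsum w b"
    unfolding wsum_superset[of ?B a, OF _ Un_upper1, simplified] wsum_superset[of ?B b, OF _ Un_upper2, simplified]
    by (simp add: lookup_add distrib_right sum.distrib)
  finally show ?thesis .
qed

lemma wsum_uminus [simp]: "wsum w (- a) = - wsum w a"
  using wsum_add[of w a "- a"] by simp

lemma wsum_diff [simp]: "wsum w (a - b) = wsum w a - wsum w b"
  using wsum_add[of w "a - b" b] by simp

lemma wsum_frag_of [simp]: "wsum w (frag_of C) = w C"
  by (simp add: wsum_def keys_frag_of)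

lemma wsum_cmul [simp]: "wsum w (frag_cmul c a) = c * wsum w a"
  unfolding wsum_superset[OF finite_keys keys_cmul[of c a]] wsum_def[of w a] by (simp add: sum_distrib_left mult_ac)

lemma wsum_sum: "wsum w (\<Sum>i\<in>I. f i) = (\<Sum>i\<in>I. wsum w (f i))"
  by (induction I rule: infinite_finite_induct) simp_all

lemma frag_aug_wsum: "frag_aug a = wsum (\<lambda>C. int (class_dim C)) a"
  by (simp add: frag_aug_def wsum_def)

text \<open>The product becomes an iterated sum, so each argument can be treated modulo relations
  separately.\<close>

lemma wsum_frag_tensor:
  "wsum w (frag_tensor H a b) = wsum (\<lambda>C. wsum (\<lambda>C'. w (class_tensor H C C')) b) a"
  unfolding frag_tensor_def wsum_sum wsum_cmul wsum_frag_of by (simp add: wsum_def sum_distrib_left mult.assoc)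

context hopf_alg
begin

section \<open>Isomorphism classes and chosen representatives\<close>

lemma mod_iso_refl: "is_module H M \<Longrightarrow> mod_iso H M M"
  unfolding mod_iso_def using mod_hom_id by (intro exI[of _ "1\<^sub>m (fst M)"]) auto

lemma mod_iso_sym:
  assumes "is_module H M" "is_module H N" "mod_iso H M N"
  shows "mod_iso H N M"
proof -
  obtain f g where f: "mod_hom H M N f" and g: "g \<in> carrier_mat (fst M) (fst N)" "f * g = 1\<^sub>m (fst N)" "g * f = 1\<^sub>m (fst M)"
    using assms(3) unfolding mod_iso_def by blast
  have "mod_hom H N M g" by (rule inverse_hom[OF assms(1,2) f g])
  with g hom_carrier[OF f] show ?thesis unfolding mod_iso_def by blast
qed

lemma mod_iso_trans:
  assumes "is_module H M" "is_module H N" "is_module H L" "mod_iso H M N" "mod_iso H N L"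
  shows "mod_iso H M L"
proof -
  obtain f g where f: "mod_hom H M N f" and g: "g \<in> carrier_mat (fst M) (fst N)" "f * g = 1\<^sub>m (fst N)" "g * f = 1\<^sub>m (fst M)"
    using assms(4) unfolding mod_iso_def by blast
  obtain f' g' where f': "mod_hom H N L f'" and g': "g' \<in> carrier_mat (fst N) (fst L)" "f' * g' = 1\<^sub>m (fst L)" "g' * f' = 1\<^sub>m (fst N)"
    using assms(5) unfolding mod_iso_def by blast
  note fc = hom_carrier[OF f] and fc' = hom_carrier[OF f']
  have "mod_hom H M L (f' * f)" by (rule mod_hom_comp[OF assms(1-3) f f'])
  moreover have "g * g' \<in> carrier_mat (fst M) (fst L)" using g g' by auto
  moreover have "f' * f * (g * g') = 1\<^sub>m (fst L)"
    using fc fc' g(1) g'(1,2) by (simp add: mult_assoc_dim g(2)[THEN mult_eq_assoc])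
  moreover have "g * g' * (f' * f) = 1\<^sub>m (fst M)"
    using fc fc' g(1,3) g'(1) by (simp add: mult_assoc_dim g'(3)[THEN mult_eq_assoc])
  ultimately show ?thesis unfolding mod_iso_def by blast
qed

lemma iso_class_self: "is_module H M \<Longrightarrow> M \<in> iso_class H M"
  by (simp add: iso_class_def mod_iso_refl)

lemma iso_class_eq:
  assumes "is_module H M" "is_module H N" "mod_iso H M N"
  shows "iso_class H M = iso_class H N"
  unfolding iso_class_def using assms mod_iso_sym mod_iso_trans by blast

lemma iso_class_eqD:
  assumes "is_module H M" "is_module H N" "iso_class H M = iso_class H N"
  shows "mod_iso H M N"
  using iso_class_self[OF assms(2)] unfolding assms(3)[symmetric] by (simp add: iso_class_def)

lemma mod_iso_dim:
  assumes "mod_iso H M N"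
  shows "fst M = fst N"
proof -
  obtain f g where f: "mod_hom H M N f" and g: "g \<in> carrier_mat (fst M) (fst N)" "f * g = 1\<^sub>m (fst N)" "g * f = 1\<^sub>m (fst M)"
    using assms unfolding mod_iso_def by blast
  show ?thesis
    using left_inverse_dim_le[OF hom_carrier[OF f] g(1,3)] left_inverse_dim_le[OF g(1) hom_carrier[OF f] g(2)] by simp
qed

text \<open>The same choice as in \<open>class_dim\<close> and \<open>class_tensor\<close>, so that
  both unfold to it.\<close>

definition rep_of :: "'k rep set \<Rightarrow> 'k rep" where
  "rep_of C = (SOME M. M \<in> C)"

lemma rep_of_iso_class:
  assumes "is_module H M"
  shows "is_module H (rep_of (iso_class H M))" "mod_iso H M (rep_of (iso_class H M))"
proof -
  have "rep_of (iso_class H M) \<in> iso_class H M"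
    unfolding rep_of_def by (rule someI[of _ M]) (rule iso_class_self[OF assms])
  then show "is_module H (rep_of (iso_class H M))" "mod_iso H M (rep_of (iso_class H M))"
    by (simp_all add: iso_class_def)
qed

lemma rep_of_mod_classes:
  assumes "C \<in> mod_classes H"
  shows "is_module H (rep_of C)" "iso_class H (rep_of C) = C"
proof -
  obtain M where M: "is_module H M" "C = iso_class H M" using assms by (auto simp: mod_classes_def)
  show "is_module H (rep_of C)" "iso_class H (rep_of C) = C"
    unfolding M(2) using rep_of_iso_class[OF M(1)] iso_class_eq[OF M(1), symmetric] by blast+
qed

lemma short_exact_split:
  assumes "short_exact H U V W"
  obtains f g f' g' where "split_exact U V W f g f' g'"
proof -
  obtain f g where M: "is_module H U" "is_module H V" "is_module H W" and f: "mod_hom H U V f" and g: "mod_hom H V W g"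
    and inj: "\<And>x. x \<in> carrier_vec (fst U) \<Longrightarrow> f *\<^sub>v x = 0\<^sub>v (fst V) \<Longrightarrow> x = 0\<^sub>v (fst U)" and surj: "surj_mat g"
    and ex: "\<And>y. y \<in> carrier_vec (fst V) \<Longrightarrow> g *\<^sub>v y = 0\<^sub>v (fst W) \<longleftrightarrow> (\<exists>x\<in>carrier_vec (fst U). f *\<^sub>v x = y)"
    using assms unfolding short_exact_def by blast
  let ?u = "fst U" and ?v = "fst V" and ?w = "fst W"
  note fc = hom_carrier[OF f] and gc = hom_carrier[OF g]
  obtain g' where g': "g' \<in> carrier_mat ?v ?w" "g * g' = 1\<^sub>m ?w" by (rule right_inverse_if_surj[OF gc surj])
  have gf: "g * f = 0\<^sub>m ?w ?u"
  proof (rule mat_eq_if_cols)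
    fix x :: "'k vec" assume x: "x \<in> carrier_vec ?u"
    have "g *\<^sub>v (f *\<^sub>v x) = 0\<^sub>v ?w" using ex[of "f *\<^sub>v x"] x fc by auto
    then show "(g * f) *\<^sub>v x = 0\<^sub>m ?w ?u *\<^sub>v x" using assoc_mult_mat_vec[OF gc fc x] zero_mult_vec[OF x] by simp
  qed (use fc gc in auto)
  \<comment> \<open>The projection onto the kernel of \<open>g\<close>. By exactness each of its
    columns lies in the image of \<open>f\<close>, and the preimages form \<open>f'\<close>.\<close>
  define D where "D = 1\<^sub>m ?v - g' * g"
  have Dc: "D \<in> carrier_mat ?v ?v" unfolding D_def using g' gc by auto
  have gD: "g * D = 0\<^sub>m ?w ?v"
    unfolding D_def using g' gc by (simp add: mult_minus_dim g'(2)[THEN mult_eq_assoc])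
  have "\<exists>x\<in>carrier_vec ?u. f *\<^sub>v x = col D j" if j: "j < ?v" for j
  proof -
    have "g *\<^sub>v col D j = col (g * D) j" using Dc j by (intro mult_col[symmetric]) auto
    also have "\<dots> = 0\<^sub>v ?w" unfolding gD using j by (intro eq_vecI) auto
    finally show ?thesis using ex[of "col D j"] Dc j by auto
  qed
  then obtain f' where f'c: "f' \<in> carrier_mat ?u ?v" and ff': "f * f' = D" by (rule mat_from_cols[OF fc Dc])
  have Df: "D * f = f" unfolding D_def using g' gc fc
    by (simp add: minus_mult_dim mult_assoc_dim gf) (rule eq_matI; simp)
  have "f' * f = 1\<^sub>m ?u"
  proof (rule mat_eq_if_cols)
    fix x :: "'k vec" assume x: "x \<in> carrier_vec ?u"
    have cx: "(f' * f) *\<^sub>v x \<in> carrier_vec ?u" using f'c fc x by auto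
    have "f *\<^sub>v ((f' * f) *\<^sub>v x) = (f * (f' * f)) *\<^sub>v x"
      using f'c fc x by (intro assoc_mult_mat_vec[symmetric]) auto
    also have "f * (f' * f) = f" using f'c fc ff' Df by (simp add: mult_assoc_dim[symmetric])
    finally have "f *\<^sub>v ((f' * f) *\<^sub>v x - x) = 0\<^sub>v ?v"
      using mult_minus_distrib_mat_vec[OF fc cx x] fc x by simp
    then have z: "(f' * f) *\<^sub>v x - x = 0\<^sub>v ?u" using inj[of "(f' * f) *\<^sub>v x - x"] cx x by simp
    have "(f' * f) *\<^sub>v x = x" by (rule vec_eq_if_minus_zero[OF cx x z])
    then show "(f' * f) *\<^sub>v x = 1\<^sub>m ?u *\<^sub>v x" using x by simp
  qed (use f'c fc in auto)
  moreover have "f * f' + g' * g = 1\<^sub>m ?v" unfolding ff' D_def using g' gc by (intro eq_matI) auto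
  ultimately show ?thesis using that M f g f'c g' gf unfolding split_exact_def by blast
qed

lemma split_exact_short:
  assumes "split_exact U V W f g f' g'"
  shows "short_exact H U V W"
proof -
  have M: "is_module H U" "is_module H V" "is_module H W" "mod_hom H U V f" "mod_hom H V W g"
    and c': "f' \<in> carrier_mat (fst U) (fst V)" "g' \<in> carrier_mat (fst V) (fst W)"
    and e: "f' * f = 1\<^sub>m (fst U)" "g * g' = 1\<^sub>m (fst W)" "g * f = 0\<^sub>m (fst W) (fst U)" "f * f' + g' * g = 1\<^sub>m (fst V)"
    using assms by (auto simp: split_exact_def)
  note fc = hom_carrier[OF M(4)] and gc = hom_carrier[OF M(5)]
  have "x = 0\<^sub>v (fst U)" if x: "x \<in> carrier_vec (fst U)" "f *\<^sub>v x = 0\<^sub>v (fst V)" for x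
    using assoc_mult_mat_vec[OF c'(1) fc x(1)] x e(1) mult_zero_vec[OF c'(1)] by simp
  moreover have "g *\<^sub>v y = 0\<^sub>v (fst W) \<longleftrightarrow> (\<exists>x\<in>carrier_vec (fst U). f *\<^sub>v x = y)" if y: "y \<in> carrier_vec (fst V)" for y
  proof
    assume g0: "g *\<^sub>v y = 0\<^sub>v (fst W)"
    have "y = (f * f' + g' * g) *\<^sub>v y" using e(4) y by simp
    also have "\<dots> = (f * f') *\<^sub>v y + (g' * g) *\<^sub>v y"
      using fc gc c' y by (intro add_mult_distrib_mat_vec) auto
    also have "(g' * g) *\<^sub>v y = 0\<^sub>v (fst V)" using assoc_mult_mat_vec[OF c'(2) gc y] g0 mult_zero_vec[OF c'(2)] by simp
    also have "(f * f') *\<^sub>v y = f *\<^sub>v (f' *\<^sub>v y)" by (rule assoc_mult_mat_vec[OF fc c'(1) y])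
    also have "\<dots> + 0\<^sub>v (fst V) = f *\<^sub>v (f' *\<^sub>v y)" using fc c' y by simp
    finally show "\<exists>x\<in>carrier_vec (fst U). f *\<^sub>v x = y"
      using c' y by (intro bexI[of _ "f' *\<^sub>v y"]) auto
  next
    assume "\<exists>x\<in>carrier_vec (fst U). f *\<^sub>v x = y"
    then obtain x where x: "x \<in> carrier_vec (fst U)" "f *\<^sub>v x = y" by blast
    then show "g *\<^sub>v y = 0\<^sub>v (fst W)"
      using assoc_mult_mat_vec[OF gc fc x(1)] e(3) zero_mult_vec[OF x(1)] by simp
  qed
  ultimately show ?thesis unfolding short_exact_def
    using M surj_if_right_inverse[OF gc c'(2) e(2)] by blast
qed

text \<open>The functions on modules that induce homomorphisms from G_0(A) to the integers.\<close>

definition additive_fun :: "('k rep \<Rightarrow> int) \<Rightarrow> bool" where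
  "additive_fun \<phi> \<longleftrightarrow> (\<forall>M N. is_module H M \<longrightarrow> is_module H N \<longrightarrow> mod_iso H M N \<longrightarrow> \<phi> M = \<phi> N) \<and>
    (\<forall>U V W f g f' g'. split_exact U V W f g f' g' \<longrightarrow> \<phi> V = \<phi> U + \<phi> W)"

lemma additive_fun_class:
  "additive_fun \<phi> \<Longrightarrow> is_module H M \<Longrightarrow> \<phi> (rep_of (iso_class H M)) = \<phi> M"
  unfolding additive_fun_def using rep_of_iso_class by metis

lemma wsum_rels_zero:
  assumes \<phi>: "additive_fun \<phi>" and x: "x \<in> G0_rels H"
  shows "wsum (\<lambda>C. \<phi> (rep_of C)) x = 0 \<and> Poly_Mapping.keys x \<subseteq> mod_classes H"
proof -
  have gen: "wsum (\<lambda>C. \<phi> (rep_of C)) r = 0 \<and> Poly_Mapping.keys r \<subseteq> mod_classes H"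
    if "r \<in> {frag_of (iso_class H U) - frag_of (iso_class H V) + frag_of (iso_class H W) | U V W. short_exact H U V W}" for r
  proof -
    from that obtain U V W where r: "r = frag_of (iso_class H U) - frag_of (iso_class H V) + frag_of (iso_class H W)"
      and se: "short_exact H U V W" by blast
    have M: "is_module H U" "is_module H V" "is_module H W" using se by (auto simp: short_exact_def)
    obtain f g f' g' where sp: "split_exact U V W f g f' g'" by (rule short_exact_split[OF se])
    have "\<phi> V = \<phi> U + \<phi> W" using \<phi> sp unfolding additive_fun_def by blast
    then have "wsum (\<lambda>C. \<phi> (rep_of C)) r = 0" unfolding r using M by (simp add: additive_fun_class[OF \<phi>])
    moreover have "Poly_Mapping.keys r \<subseteq> mod_classes H"
    proof -
      have "Poly_Mapping.keys r \<subseteq> {iso_class H U, iso_class H V, iso_class H W}" unfolding r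
        using keys_add[of "frag_of (iso_class H U) - frag_of (iso_class H V)" "frag_of (iso_class H W)"]
          keys_diff[of "frag_of (iso_class H U)" "frag_of (iso_class H V)"] by (auto simp: keys_frag_of)
      then show ?thesis using M unfolding mod_classes_def by blast
    qed
    ultimately show ?thesis by blast
  qed
  show ?thesis using x unfolding G0_rels_def
  proof (induction rule: generate.induct)
    case one
    then show ?case by (simp add: G0_free_def)
  next
    case (incl h)
    then show ?case by (rule gen)
  next
    case (inv h)
    then show ?case using gen[OF inv] by (simp add: G0_free_def)
  next
    case (eng h1 h2)
    then show ?case using keys_add[of h1 h2] by (auto simp: G0_free_def)
  qed
qed

section \<open>Closure properties of the relations, and sources of additive functions\<close>

lemma rels_zero: "0 \<in> G0_rels H"
  using generate.one[of "G0_free H"] by (simp add: G0_rels_def G0_free_def)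

lemma rels_add: "x \<in> G0_rels H \<Longrightarrow> y \<in> G0_rels H \<Longrightarrow> x + y \<in> G0_rels H"
  using generate.eng[of x "G0_free H" _ y] by (simp add: G0_rels_def G0_free_def)

lemma additive_dim: "additive_fun (\<lambda>M. int (fst M))"
  unfolding additive_fun_def using mod_iso_dim split_exact_dim by auto

lemma rels_keys: "x \<in> G0_rels H \<Longrightarrow> Poly_Mapping.keys x \<subseteq> mod_classes H"
  using wsum_rels_zero[OF additive_dim] by blast

lemma rels_subgroup: "subgroup (G0_rels H) (G0_free H)"
  unfolding G0_rels_def
proof (rule group.generate_is_subgroup)
  show "group (G0_free H)" by (simp add: G0_free_def)
  show "{frag_of (iso_class H U) - frag_of (iso_class H V) + frag_of (iso_class H W) | U V W. short_exact H U V W} \<subseteq> carrier (G0_free H)"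
  proof
    fix x assume "x \<in> {frag_of (iso_class H U) - frag_of (iso_class H V) + frag_of (iso_class H W) | U V W. short_exact H U V W}"
    then have "x \<in> G0_rels H" unfolding G0_rels_def by (rule generate.incl)
    then show "x \<in> carrier (G0_free H)" using rels_keys by (simp add: G0_free_def)
  qed
qed

lemma rels_uminus: "x \<in> G0_rels H \<Longrightarrow> - x \<in> G0_rels H"
  using subgroup.m_inv_closed[OF rels_subgroup, of x] rels_keys[of x] by (simp add: G0_free_def)

lemma rels_diff: "x \<in> G0_rels H \<Longrightarrow> y \<in> G0_rels H \<Longrightarrow> x - y \<in> G0_rels H"
  using rels_add[of x "- y"] rels_uminus[of y] by simp

lemma rels_exact:
  assumes "split_exact U V W f g f' g'"
  shows "frag_of (iso_class H U) - frag_of (iso_class H V) + frag_of (iso_class H W) \<in> G0_rels H"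
  unfolding G0_rels_def by (rule generate.incl) (use split_exact_short[OF assms] in blast)

text \<open>Module maps commute with the action of \<open>e\<close>, so similarity gives invariance
  and \<open>idem_rank_exact\<close> gives additivity.\<close>

lemma additive_mult:
  assumes idem: "\<And>M. is_module H M \<Longrightarrow> act M e * act M e = act M e"
  shows "additive_fun (\<lambda>M. int (idem_rank (act M e)))"
  unfolding additive_fun_def
proof (intro conjI allI impI)
  fix M N assume M: "is_module H M" "is_module H N" and iso: "mod_iso H M N"
  obtain f g where f: "mod_hom H M N f" and g: "g \<in> carrier_mat (fst M) (fst N)" "f * g = 1\<^sub>m (fst N)" "g * f = 1\<^sub>m (fst M)"
    using iso unfolding mod_iso_def by blast
  have d: "fst N = fst M" using mod_iso_dim[OF iso] by simp
  note fc = hom_carrier[OF f]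
  have "act N e = act N e * (f * g)" using g(2) by simp
  also have "\<dots> = f * act M e * g" using fc g(1) by (simp add: mult_assoc_dim[symmetric] hom_act[OF f M])
  finally have e: "act N e = f * act M e * g" .
  show "int (idem_rank (act M e)) = int (idem_rank (act N e))"
    unfolding e using idem_rank_similar[OF act_carrier idem[OF M(1)] fc[unfolded d] g(1)[unfolded d] g(3)] by simp
next
  fix U V W f g f' g' assume se: "split_exact U V W f g f' g'"
  have M: "is_module H U" "is_module H V" "is_module H W" "mod_hom H U V f" "mod_hom H V W g"
    and c': "f' \<in> carrier_mat (fst U) (fst V)" "g' \<in> carrier_mat (fst V) (fst W)"
    and e: "f' * f = 1\<^sub>m (fst U)" "g * g' = 1\<^sub>m (fst W)" "g * f = 0\<^sub>m (fst W) (fst U)" "f * f' + g' * g = 1\<^sub>m (fst V)"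
    using se by (auto simp: split_exact_def)
  have "idem_rank (act V e) = idem_rank (act U e) + idem_rank (act W e)"
    by (rule idem_rank_exact[OF hom_carrier[OF M(4)] c'(1) hom_carrier[OF M(5)] c'(2) e
          act_carrier act_carrier act_carrier idem[OF M(1)] idem[OF M(2)] idem[OF M(3)]
          hom_act[OF M(4,1,2), symmetric] hom_act[OF M(5,2,3)]])
  then show "int (idem_rank (act V e)) = int (idem_rank (act U e)) + int (idem_rank (act W e))" by simp
qed

lemma additive_tensor:
  assumes "additive_fun \<phi>" "is_module H X"
  shows "additive_fun (\<lambda>M. \<phi> (tensor_mod H X M))"
  unfolding additive_fun_def
proof (intro conjI allI impI)
  fix M N assume M: "is_module H M" "is_module H N" "mod_iso H M N"
  show "\<phi> (tensor_mod H X M) = \<phi> (tensor_mod H X N)"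
    by (rule assms(1)[unfolded additive_fun_def, THEN conjunct1, rule_format,
          OF is_module_tensor[OF assms(2) M(1)] is_module_tensor[OF assms(2) M(2)] mod_iso_tensor[OF assms(2) M]])
next
  fix U V W f g f' g' assume "split_exact U V W f g f' g'"
  from tensor_split_exact[OF assms(2) this]
  show "\<phi> (tensor_mod H X V) = \<phi> (tensor_mod H X U) + \<phi> (tensor_mod H X W)"
    using assms(1) unfolding additive_fun_def by blast
qed

end

subsection \<open>Quotients of lattices\<close>

text \<open>Automorphisms of the lattice of rank \<open>l\<close>, realised on all integer
  sequences. Vectors are sequences vanishing from \<open>l\<close> on, and only the last two clauses
  mention \<open>l\<close>. The inverse is carried along because the kernel computation uses it
  explicitly.\<close>

definition lattice_auto :: "nat \<Rightarrow> ((nat \<Rightarrow> int) \<Rightarrow> nat \<Rightarrow> int) \<Rightarrow> ((nat \<Rightarrow> int) \<Rightarrow> nat \<Rightarrow> int) \<Rightarrow> bool" where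
  "lattice_auto l U U' \<longleftrightarrow>
    (\<forall>v w. U (\<lambda>i. v i + w i) = (\<lambda>i. U v i + U w i)) \<and> (\<forall>v w. U' (\<lambda>i. v i + w i) = (\<lambda>i. U' v i + U' w i)) \<and>
    (\<forall>v. U' (U v) = v) \<and> (\<forall>v. U (U' v) = v) \<and>
    (\<forall>v. (\<forall>i\<ge>l. v i = 0) \<longrightarrow> (\<forall>i\<ge>l. U v i = 0)) \<and> (\<forall>v. (\<forall>i\<ge>l. v i = 0) \<longrightarrow> (\<forall>i\<ge>l. U' v i = 0))"

lemma lattice_auto_id: "lattice_auto l (\<lambda>v. v) (\<lambda>v. v)"
  by (simp add: lattice_auto_def)

lemma lattice_auto_comp:
  assumes "lattice_auto l U U'" "lattice_auto l V V'"
  shows "lattice_auto l (\<lambda>v. V (U v)) (\<lambda>v. U' (V' v))"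
  using assms unfolding lattice_auto_def by simp

lemma lattice_auto_add:
  assumes "i < l" "i \<noteq> j"
  shows "lattice_auto l (\<lambda>v. v(i := v i + c * v j)) (\<lambda>v. v(i := v i - c * v j))"
  using assms unfolding lattice_auto_def by (auto simp: fun_eq_iff algebra_simps)

lemma lattice_auto_swap:
  assumes "i < l"
  shows "lattice_auto l (\<lambda>v k. v (if k = 0 then i else if k = i then 0 else k)) (\<lambda>v k. v (if k = 0 then i else if k = i then 0 else k))"
  using assms unfolding lattice_auto_def by (auto simp: fun_eq_iff)

lemma lattice_auto_scale:
  assumes "lattice_auto l U U'"
  shows "U (\<lambda>i. c * v i) = (\<lambda>i. c * U v i)"
proof -
  have add: "U (\<lambda>i. v i + w i) = (\<lambda>i. U v i + U w i)" for v w using assms by (simp add: lattice_auto_def)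
  have zero: "U (\<lambda>_. 0) = (\<lambda>_. 0)" using add[of "\<lambda>_. 0" "\<lambda>_. 0"] by (simp add: fun_eq_iff)
  have nat: "U (\<lambda>i. int n * v i) = (\<lambda>i. int n * U v i)" for n v
  proof (induction n)
    case (Suc n)
    then show ?case using add[of v "\<lambda>i. int n * v i"] by (simp add: distrib_right)
  qed (simp add: zero)
  have minus: "U (\<lambda>i. - v i) = (\<lambda>i. - U v i)" for v
    using add[of v "\<lambda>i. - v i"] zero by (simp add: fun_eq_iff eq_neg_iff_add_eq_0 add.commute)
  show ?thesis
  proof (cases c rule: int_cases2)
    case (nonneg n)
    then show ?thesis using nat by simp
  next
    case (nonpos n)
    then show ?thesis using nat[of n v] minus[of "\<lambda>i. int n * v i"] by simp
  qed
qed

text \<open>Euclid's algorithm on the entries of a vector.\<close>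
lemma unimodular_reduction:
  fixes a :: "nat \<Rightarrow> int"
  assumes "\<forall>i\<ge>l. a i = 0"
  shows "\<exists>U U' g. lattice_auto l U U' \<and> U a = (\<lambda>i. if i = 0 then g else 0)"
  using assms
proof (induction "nat (\<Sum>i<l. \<bar>a i\<bar>)" arbitrary: a rule: less_induct)
  case less
  show ?case
  proof (cases "\<exists>i j. i \<noteq> j \<and> i < l \<and> j < l \<and> a i \<noteq> 0 \<and> a j \<noteq> 0")
    case True
    then obtain i j where ij: "i \<noteq> j" "i < l" "j < l" "a j \<noteq> 0" "a i \<noteq> 0" "\<bar>a j\<bar> \<le> \<bar>a i\<bar>"
      by (metis linear)
    \<comment> \<open>The sign that makes adding \<open>c * a j\<close> shorten the larger entry by
      the absolute value of the smaller one.\<close>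
    define c where "c = - (sgn (a i) * sgn (a j))"
    define b where "b = a(i := a i + c * a j)"
    have "\<bar>a i + c * a j\<bar> < \<bar>a i\<bar>"
      unfolding c_def using ij(4-6) by (cases "0 < a i"; cases "0 < a j") auto
    then have "(\<Sum>k<l. \<bar>b k\<bar>) < (\<Sum>k<l. \<bar>a k\<bar>)"
      unfolding b_def using ij by (intro sum_strict_mono_ex1) (auto intro!: bexI[of _ i])
    moreover have "0 \<le> (\<Sum>k<l. \<bar>b k\<bar>)" by (simp add: sum_nonneg)
    ultimately have "nat (\<Sum>k<l. \<bar>b k\<bar>) < nat (\<Sum>k<l. \<bar>a k\<bar>)" by linarith
    moreover have "\<forall>k\<ge>l. b k = 0" using less.prems ij by (simp add: b_def)
    ultimately obtain U U' g where U: "lattice_auto l U U'" "U b = (\<lambda>i. if i = 0 then g else 0)"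
      using less.hyps by blast
    have "lattice_auto l (\<lambda>v. U (v(i := v i + c * v j))) (\<lambda>v. (\<lambda>w. w(i := w i - c * w j)) (U' v))"
      by (rule lattice_auto_comp[OF lattice_auto_add[OF ij(2,1)] U(1)])
    with U(2) show ?thesis unfolding b_def by blast
  next
    case False
    show ?thesis
    proof (cases "\<exists>i<l. a i \<noteq> 0")
      case True
      then obtain i where i: "i < l" "a i \<noteq> 0" by blast
      \<comment> \<open>At most one entry is nonzero at this stage; a transposition moves it to
        position 0.\<close>
      have "a k = 0" if "k \<noteq> i" for k
        using False i that less.prems by (metis not_le)
      then have "(\<lambda>k. a (if k = 0 then i else if k = i then 0 else k)) = (\<lambda>k. if k = 0 then a i else 0)"
        by (auto simp: fun_eq_iff)
      then show ?thesis using lattice_auto_swap[OF i(1)] by blast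
    next
      case False
      then have "a = (\<lambda>i. if i = 0 then 0 else 0)" using less.prems by (auto simp: fun_eq_iff) (metis not_le)
      then show ?thesis using lattice_auto_id by blast
    qed
  qed
qed

text \<open>Since \<open>s 0 = 1\<close>, dropping the coordinate \<open>0\<close> identifies the hyperplane orthogonal to \<open>s\<close> with \<open>\<int>\<^sup>l\<close>
  and the subgroup with \<open>d \<int>\<^sup>l + \<int> (a\<^sub>1, \<dots>, a\<^sub>l)\<close>.\<close>
theorem lattice_quotient_iso:
  fixes G :: "'b monoid" and K :: "(nat \<Rightarrow> int) \<Rightarrow> 'b" and s a :: "nat \<Rightarrow> int" and d \<gamma> l :: nat
  assumes G: "group G" and carr: "carrier G = range K"
    and K_mult: "\<And>v w. K v \<otimes>\<^bsub>G\<^esub> K w = K (\<lambda>j. v j + w j)"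
    and K_eq: "\<And>v w. K v = K w \<longleftrightarrow> (\<forall>j\<le>l. v j = w j)"
    and s0: "s 0 = 1" and sa: "(\<Sum>j\<le>l. a j * s j) = int d"
    and gam: "\<And>c::nat. c dvd \<gamma> \<longleftrightarrow> (\<forall>j\<le>l. int c dvd a j)"
  defines "Q \<equiv> G\<lparr>carrier := K ` {v. (\<Sum>j\<le>l. v j * s j) = 0}\<rparr> Mod
    range (\<lambda>v. K (\<lambda>j. int d * v j - (\<Sum>i\<le>l. v i * s i) * a j))"
  shows "group Q" "Q \<cong> product_group {..<l} (\<lambda>i. if i = 0 then integer_mod_group \<gamma> else integer_mod_group d)"
proof -
  interpret G: group G by (rule G)
  define dot where "dot v = (\<Sum>j\<le>l. v j * s j)" for v
  \<comment> \<open>After the change of basis the relations are spanned by \<open>d\<close> times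
    the lattice and by \<open>g\<close> times the first basis vector. So only coordinate 0 gets a
    modulus other than \<open>d\<close>, namely \<open>gcd d g\<close>, which \<open>gam'\<close>
    identifies with \<open>\<gamma>\<close>.\<close>
  define n where "n i = (if i = 0 then \<gamma> else d)" for i :: nat
  define tail where "tail v = (\<lambda>i. if i < l then v (Suc i) else (0::int))" for v
  have dot_split: "dot v = v 0 + (\<Sum>i<l. v (Suc i) * s (Suc i))" for v
    unfolding dot_def by (simp add: lessThan_Suc_atMost[symmetric] sum.lessThan_Suc_shift s0 del: sum.lessThan_Suc)
  have dot_add: "dot (\<lambda>j. v j + w j) = dot v + dot w" for v w by (simp add: dot_def distrib_right sum.distrib)
  have dot_lin: "dot (\<lambda>j. int d * v j - c * a j) = int d * dot v - c * int d" for v c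
  proof -
    have "dot (\<lambda>j. int d * v j - c * a j) = int d * dot v - c * dot a"
      unfolding dot_def by (simp add: left_diff_distrib sum_subtractf sum_distrib_left mult.assoc)
    then show ?thesis using sa by (simp add: dot_def)
  qed
  let ?L = "G\<lparr>carrier := K ` {v. dot v = 0}\<rparr>"
  let ?N = "range (\<lambda>v. K (\<lambda>j. int d * v j - dot v * a j))"
  let ?P = "product_group {..<l} (\<lambda>i. integer_mod_group (n i))"
  have K_one: "\<one>\<^bsub>G\<^esub> = K (\<lambda>_. 0)"
  proof -
    obtain v where v: "\<one>\<^bsub>G\<^esub> = K v" using G.one_closed unfolding carr by blast
    have "K (\<lambda>_. 0) = \<one>\<^bsub>G\<^esub> \<otimes>\<^bsub>G\<^esub> K (\<lambda>_. 0)" by (rule G.l_one[symmetric]) (simp add: carr)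
    then show ?thesis unfolding v K_mult by simp
  qed
  have K_inv: "inv\<^bsub>G\<^esub> (K v) = K (\<lambda>j. - v j)" for v
    by (rule G.inv_equality) (simp_all add: carr K_mult K_one)
  have sub: "subgroup (K ` {v. dot v = 0}) G"
  proof (rule G.subgroupI)
    show "K ` {v. dot v = 0} \<subseteq> carrier G" using carr by auto
    show "K ` {v. dot v = 0} \<noteq> {}" by (auto simp: dot_def intro!: exI[of _ "\<lambda>_. 0"])
    show "inv\<^bsub>G\<^esub> x \<in> K ` {v. dot v = 0}" if "x \<in> K ` {v. dot v = 0}" for x
      using that by (auto simp: K_inv dot_def sum_negf intro!: imageI)
    show "x \<otimes>\<^bsub>G\<^esub> y \<in> K ` {v. dot v = 0}" if "x \<in> K ` {v. dot v = 0}" "y \<in> K ` {v. dot v = 0}" for x y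
      using that by (auto simp: K_mult dot_add intro!: imageI)
  qed
  have L: "group ?L" by (rule G.subgroup_imp_group[OF sub])
  have P: "group ?P" by simp
  obtain U U' g where U: "lattice_auto l U U'" and Ua: "U (tail a) = (\<lambda>i. if i = 0 then g else 0)"
    using unimodular_reduction[of l "tail a"] by (auto simp: tail_def)
  have U_add: "U (\<lambda>i. v i + w i) = (\<lambda>i. U v i + U w i)" "U' (\<lambda>i. v i + w i) = (\<lambda>i. U' v i + U' w i)" for v w
    using U by (simp_all add: lattice_auto_def)
  have U_inv: "U' (U v) = v" "U (U' v) = v" for v using U by (simp_all add: lattice_auto_def)
  have U_supp: "(\<forall>i\<ge>l. v i = 0) \<Longrightarrow> i \<ge> l \<Longrightarrow> U v i = 0" "(\<forall>i\<ge>l. v i = 0) \<Longrightarrow> i \<ge> l \<Longrightarrow> U' v i = 0" for v i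
    using U by (auto simp: lattice_auto_def)
  have U'_auto: "lattice_auto l U' U" using U by (auto simp: lattice_auto_def)
  note U_scale = lattice_auto_scale[OF U] lattice_auto_scale[OF U'_auto]
  have U_lin: "U (\<lambda>i. c * v i - e * w i) = (\<lambda>i. c * U v i - e * U w i)" for c e v w
    using U_add(1)[of "\<lambda>i. c * v i" "\<lambda>i. (- e) * w i"] U_scale(1)[of c v] U_scale(1)[of "- e" w] by simp
  have g_dvd: "int c dvd g \<longleftrightarrow> (\<forall>i<l. int c dvd a (Suc i))" for c :: nat
  proof
    assume "int c dvd g"
    then obtain k where k: "g = int c * k" by blast
    have "tail a = U' (\<lambda>i. int c * (if i = 0 then k else 0))"
      using U_inv(1)[of "tail a"] unfolding Ua k by (simp add: if_distrib cong: if_cong)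
    then have "tail a i = int c * U' (\<lambda>i. if i = 0 then k else 0) i" for i unfolding U_scale by simp
    then show "\<forall>i<l. int c dvd a (Suc i)" unfolding tail_def by (metis dvd_triv_left)
  next
    assume h: "\<forall>i<l. int c dvd a (Suc i)"
    have "tail a = (\<lambda>i. int c * (tail a i div int c))" using h by (auto simp: tail_def fun_eq_iff)
    then have "U (tail a) 0 = int c * U (\<lambda>i. tail a i div int c) 0" using U_scale(1) by metis
    then show "int c dvd g" unfolding Ua by simp
  qed
  have gam': "int \<gamma> = gcd (int d) g"
  proof -
    have "c dvd \<gamma> \<longleftrightarrow> c dvd nat (gcd (int d) g)" for c :: nat
    proof -
      have "(\<forall>j\<le>l. int c dvd a j) \<longleftrightarrow> int c dvd a 0 \<and> (\<forall>i<l. int c dvd a (Suc i))"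
        by (metis Suc_leI Suc_le_eq less_Suc_eq_le not0_implies_Suc zero_le)
      also have "\<dots> \<longleftrightarrow> int c dvd int d \<and> (\<forall>i<l. int c dvd a (Suc i))"
      proof -
        \<comment> \<open>Because \<open>s 0 = 1\<close>, the entry \<open>a 0\<close> is
          \<open>d\<close> minus a combination of the other entries, so \<open>a 0\<close> may be
          exchanged for \<open>d\<close> among the numbers to be divided.\<close>
        have "int c dvd a 0 \<longleftrightarrow> int c dvd int d" if "\<forall>i<l. int c dvd a (Suc i)"
        proof -
          have "int c dvd (\<Sum>i<l. a (Suc i) * s (Suc i))" using that by (intro dvd_sum) auto
          moreover have "int d = a 0 + (\<Sum>i<l. a (Suc i) * s (Suc i))" using sa dot_split[of a] by (simp add: dot_def)
          ultimately show ?thesis by (metis dvd_add_left_iff)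
        qed
        then show ?thesis by blast
      qed
      also have "\<dots> \<longleftrightarrow> int c dvd gcd (int d) g" using g_dvd by simp
      also have "\<dots> \<longleftrightarrow> c dvd nat (gcd (int d) g)" by (metis gcd_ge_0_int int_dvd_int_iff int_nat_eq)
      finally show ?thesis using gam by blast
    qed
    then have "\<gamma> = nat (gcd (int d) g)" by (metis dvd_antisym dvd_refl)
    then show ?thesis by simp
  qed
  \<comment> \<open>Only the entries up to \<open>l\<close> of such a vector are determined by the
    class, and \<open>tail\<close> reads no others.\<close>
  define val where "val X = (SOME v. K v = X)" for X
  have val: "\<forall>j\<le>l. val (K v) j = v j" for v
  proof -
    have "K (val (K v)) = K v" unfolding val_def by (rule someI[of _ v]) simp
    then show ?thesis using K_eq by blast
  qed
  have tail_val: "tail (val (K v)) = tail v" for v using val[of v] by (auto simp: tail_def fun_eq_iff)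
  define h where "h X = (\<lambda>i\<in>{..<l}. U (tail (val X)) i mod int (n i))" for X
  have hK: "h (K v) = (\<lambda>i\<in>{..<l}. U (tail v) i mod int (n i))" for v by (simp add: h_def tail_val)
  have tail_add: "tail (\<lambda>j. v j + w j) = (\<lambda>i. tail v i + tail w i)" for v w by (auto simp: tail_def)
  have closed: "h X \<in> carrier ?P" for X
  proof -
    have "U (tail (val X)) i mod int (n i) \<in> carrier (integer_mod_group (n i))" for i
      by (simp add: carrier_integer_mod_group)
    then show ?thesis by (simp add: h_def)
  qed
  have hom: "group_hom ?L ?P h"
  proof (rule group_hom.intro[OF L P], rule group_hom_axioms.intro, rule homI)
    show "h X \<in> carrier ?P" for X by (rule closed)
    fix X Y assume "X \<in> carrier ?L" "Y \<in> carrier ?L"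
    then obtain v w where vw: "X = K v" "Y = K w" by auto
    show "h (X \<otimes>\<^bsub>?L\<^esub> Y) = h X \<otimes>\<^bsub>?P\<^esub> h Y"
      unfolding vw by (simp add: K_mult hK tail_add U_add restrict_def fun_eq_iff mod_simps)
  qed
  interpret group_hom ?L ?P h by (rule hom)
  have surj: "h ` carrier ?L = carrier ?P"
  proof
    show "h ` carrier ?L \<subseteq> carrier ?P" using closed by blast
    show "carrier ?P \<subseteq> h ` carrier ?L"
    proof
      fix t assume t: "t \<in> carrier ?P"
      define v where "v = U' (\<lambda>i. if i < l then t i else 0)"
      have v0: "v i = 0" if "i \<ge> l" for i unfolding v_def using that by (intro U_supp(2)) auto
      \<comment> \<open>The entry at 0 is forced by membership in the hyperplane.\<close>
      define w where "w j = (case j of 0 \<Rightarrow> - (\<Sum>i<l. v i * s (Suc i)) | Suc i \<Rightarrow> v i)" for j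
      have "dot w = 0" by (simp add: dot_split w_def)
      moreover have "tail w = v" using v0 by (auto simp: tail_def w_def fun_eq_iff)
      then have "h (K w) = (\<lambda>i\<in>{..<l}. t i mod int (n i))"
        unfolding hK by (auto simp: v_def U_inv)
      moreover have "\<dots> = t"
      proof
        fix i show "(\<lambda>i\<in>{..<l}. t i mod int (n i)) i = t i"
        proof (cases "i < l")
          case True
          then have "t i \<in> carrier (integer_mod_group (n i))" using t by auto
          then show ?thesis using True by (simp add: carrier_integer_mod_group split: if_splits)
        next
          case False
          then show ?thesis using t by (auto simp: PiE_def extensional_def)
        qed
      qed
      ultimately show "t \<in> h ` carrier ?L" by auto
    qed
  qed
  have ker: "kernel ?L ?P h = ?N"
  proof
    show "?N \<subseteq> kernel ?L ?P h"
    proof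
      fix X assume "X \<in> ?N"
      then obtain v where X: "X = K (\<lambda>j. int d * v j - dot v * a j)" by blast
      have "dot (\<lambda>j. int d * v j - dot v * a j) = 0" by (simp add: dot_lin)
      moreover have "h X = (\<lambda>i\<in>{..<l}. 0)"
      proof -
        have t: "tail (\<lambda>j. int d * v j - dot v * a j) = (\<lambda>i. int d * tail v i - dot v * tail a i)"
          by (auto simp: tail_def)
        have "int \<gamma> dvd int d * U (tail v) 0 - dot v * g" unfolding gam' by (intro dvd_diff dvd_mult dvd_mult2) auto
        then have "(int d * U (tail v) i - dot v * (if i = 0 then g else 0)) mod int (n i) = 0" for i
          by (auto simp: n_def)
        then show ?thesis unfolding X hK t U_lin Ua by (simp add: restrict_def)
      qed
      ultimately show "X \<in> kernel ?L ?P h" unfolding kernel_def X by auto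
    qed
    show "kernel ?L ?P h \<subseteq> ?N"
    proof
      fix X assume "X \<in> kernel ?L ?P h"
      then obtain v where v: "dot v = 0" "X = K v" and hX: "h X = (\<lambda>i\<in>{..<l}. 0)"
        by (auto simp: kernel_def)
      let ?u = "U (tail v)"
      have supp: "?u i = 0" if "i \<ge> l" for i using that by (intro U_supp(1)) (auto simp: tail_def)
      have dvd: "int (n i) dvd ?u i" for i
      proof (cases "i < l")
        case True
        then show ?thesis using hX[unfolded v hK, THEN fun_cong, of i] by auto
      qed (simp add: supp)
      obtain k where k: "?u 0 = int \<gamma> * k" using dvd[of 0] by (auto simp: n_def)
      \<comment> \<open>Bezout splits \<open>?u 0 = \<gamma> k\<close> as
        \<open>d (x k) + g (y k)\<close>. Hence \<open>?u\<close> is \<open>d w\<close> plus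
        \<open>y k\<close> times the image of \<open>tail a\<close>, the other entries of
        \<open>w\<close> being quotients by \<open>d\<close>.\<close>
      obtain x y where xy: "x * int d + y * g = int \<gamma>" unfolding gam' using bezout_int by blast
      define w where "w i = (if i = 0 then x * k else ?u i div int d)" for i
      have e: "?u = (\<lambda>i. int d * w i - (- (y * k)) * U (tail a) i)"
      proof
        fix i show "?u i = int d * w i - (- (y * k)) * U (tail a) i"
        proof (cases "i = 0")
          case True
          have "?u 0 = (x * int d + y * g) * k" unfolding xy k ..
          then show ?thesis using True by (simp add: w_def Ua algebra_simps)
        next
          case False
          then show ?thesis using dvd[of i] by (simp add: w_def Ua n_def)
        qed
      qed
      have "tail v = U' ?u" by (simp add: U_inv)
      also have "?u = U (\<lambda>i. int d * U' w i - (- (y * k)) * tail a i)"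
        unfolding U_lin U_inv by (rule e)
      finally have tv: "tail v = (\<lambda>i. int d * U' w i - (- (y * k)) * tail a i)" unfolding U_inv .
      \<comment> \<open>The entry at 0 is chosen so that \<open>dot z\<close> becomes
        \<open>- (y k)\<close>, the multiple of \<open>a\<close> that has to be subtracted.\<close>
      define z where "z j = (case j of 0 \<Rightarrow> - (y * k) - (\<Sum>i<l. U' w i * s (Suc i)) | Suc i \<Rightarrow> U' w i)" for j
      have dz: "dot z = - (y * k)" by (simp add: dot_split z_def)
      let ?z = "\<lambda>j. int d * z j - dot z * a j"
      have dz0: "dot ?z = 0" by (simp add: dot_lin)
      have tz: "v (Suc i) = ?z (Suc i)" if "i < l" for i
        using fun_cong[OF tv, of i] that by (simp add: tail_def z_def dz)
      \<comment> \<open>Both vectors lie in the hyperplane and agree in all other entries, so they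
        agree here too.\<close>
      have "v 0 = ?z 0"
      proof -
        have "(\<Sum>i<l. v (Suc i) * s (Suc i)) = (\<Sum>i<l. ?z (Suc i) * s (Suc i))"
          by (intro sum.cong refl arg_cong2[where f = times]) (simp add: tz)
        then show ?thesis using v(1) dz0 dot_split[of v] dot_split[of ?z] by linarith
      qed
      then have "v j = ?z j" if "j \<le> l" for j using tz that by (cases j) auto
      then have "X = K ?z" unfolding v(2) K_eq by blast
      then show "X \<in> ?N" by blast
    qed
  qed
  have Q: "Q = ?L Mod ?N" unfolding Q_def dot_def ..
  show "group Q" unfolding Q ker[symmetric] by (rule normal.factorgroup_is_group[OF normal_kernel])
  have "(\<lambda>i. integer_mod_group (n i)) = (\<lambda>i. if i = 0 then integer_mod_group \<gamma> else integer_mod_group d)"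
    by (auto simp: n_def)
  then show "Q \<cong> product_group {..<l} (\<lambda>i. if i = 0 then integer_mod_group \<gamma> else integer_mod_group d)"
    using FactGroup_iso[OF surj] unfolding ker Q by simp
qed

subsection \<open>The critical group of the regular module\<close>

text \<open>\<open>Sr 0, \<dots>, Sr l\<close> represent the simple modules, and \<open>e j\<close> are the coefficients of an idempotent of
  \<open>A\<close> generating the projective cover of \<open>Sr j\<close>; its rank on a module \<open>M\<close> is \<open>[M : Sr j]\<close>.\<close>
locale hopf_simples = hopf_alg H for H :: "'k::field hopf" +
  fixes l :: nat and Sr :: "nat \<Rightarrow> 'k rep" and e :: "nat \<Rightarrow> nat \<Rightarrow> 'k"
  assumes simple: "j \<le> l \<Longrightarrow> simple_mod H (Sr j)"
    and complete: "simple_mod H S \<Longrightarrow> \<exists>j\<le>l. mod_iso H S (Sr j)"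
    and Sr_0: "Sr 0 = trivial_mod H"
    and idem: "j \<le> l \<Longrightarrow> is_module H M \<Longrightarrow> act M (e j) * act M (e j) = act M (e j)"
    and dual: "i \<le> l \<Longrightarrow> j \<le> l \<Longrightarrow> idem_rank (act (Sr j) (e i)) = (if i = j then 1 else 0)"
    and cover: "j \<le> l \<Longrightarrow> \<exists>P f. indecomposable_mod H P \<and> projective_mod H P \<and> mod_hom H P (Sr j) f \<and>
      f \<noteq> 0\<^sub>m (fst (Sr j)) (fst P) \<and> idem_rank (act reg (e j)) = fst P"
begin

definition phi :: "nat \<Rightarrow> 'k rep \<Rightarrow> int" where
  "phi j M = int (idem_rank (act M (e j)))"

definition mlt :: "nat \<Rightarrow> ('k rep set \<Rightarrow>\<^sub>0 int) \<Rightarrow> int" where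
  "mlt j x = wsum (\<lambda>C. phi j (rep_of C)) x"

definition vfrag :: "(nat \<Rightarrow> int) \<Rightarrow> ('k rep set \<Rightarrow>\<^sub>0 int)" where
  "vfrag v = (\<Sum>j\<le>l. frag_cmul (v j) (frag_of (iso_class H (Sr j))))"

lemma additive_phi: "j \<le> l \<Longrightarrow> additive_fun (phi j)"
  unfolding phi_def using additive_mult idem by blast

lemma Sr_module: "j \<le> l \<Longrightarrow> is_module H (Sr j)"
  using simple by (simp add: simple_mod_def)

lemma phi_exact: "j \<le> l \<Longrightarrow> split_exact U V W f g f' g' \<Longrightarrow> phi j V = phi j U + phi j W"
  using additive_phi unfolding additive_fun_def by blast

lemma phi_iso: "j \<le> l \<Longrightarrow> is_module H M \<Longrightarrow> is_module H N \<Longrightarrow> mod_iso H M N \<Longrightarrow> phi j M = phi j N"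
  using additive_phi unfolding additive_fun_def by blast

lemma vfrag_add: "vfrag (\<lambda>j. v j + w j) = vfrag v + vfrag w"
  by (simp add: vfrag_def frag_cmul_distrib sum.distrib)

lemma vfrag_delta: "i \<le> l \<Longrightarrow> vfrag (\<lambda>j. if i = j then 1 else 0) = frag_of (iso_class H (Sr i))"
proof -
  assume i: "i \<le> l"
  have "vfrag (\<lambda>j. if i = j then 1 else 0) = (\<Sum>j\<le>l. if i = j then frag_of (iso_class H (Sr j)) else 0)"
    unfolding vfrag_def by (intro sum.cong) auto
  then show ?thesis using i by (simp add: sum.delta')
qed

lemma vfrag_cong: "(\<And>j. j \<le> l \<Longrightarrow> v j = w j) \<Longrightarrow> vfrag v = vfrag w"
  by (simp add: vfrag_def)

text \<open>The simple classes span: induction on the dimension along a proper nonzero submodule. In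
  the simple case the ranks form a unit vector by \<open>dual\<close>.\<close>

lemma composition_class:
  assumes "is_module H M"
  shows "frag_of (iso_class H M) - vfrag (\<lambda>j. phi j M) \<in> G0_rels H"
  using assms
proof (induction "fst M" arbitrary: M rule: less_induct)
  case less
  note M = less.prems
  show ?case
  proof (cases "simple_mod H M")
    case True
    then obtain i where i: "i \<le> l" "mod_iso H M (Sr i)" using complete by blast
    have "phi j M = (if i = j then 1 else 0)" if "j \<le> l" for j
      using phi_iso[OF that M Sr_module[OF i(1)] i(2)] dual[OF that i(1)] by (auto simp: phi_def)
    then have "vfrag (\<lambda>j. phi j M) = vfrag (\<lambda>j. if i = j then 1 else 0)" by (rule vfrag_cong)
    also have "\<dots> = frag_of (iso_class H (Sr i))" by (rule vfrag_delta[OF i(1)])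
    finally have "vfrag (\<lambda>j. phi j M) = frag_of (iso_class H (Sr i))" .
    moreover have "iso_class H M = iso_class H (Sr i)" by (rule iso_class_eq[OF M Sr_module[OF i(1)] i(2)])
    ultimately show ?thesis by (simp add: rels_zero)
  next
    case nsimple: False
    show ?thesis
    proof (cases "fst M = 0")
      case True
      have z: "A = B" if "A \<in> carrier_mat (fst M) (fst M)" "B \<in> carrier_mat (fst M) (fst M)" for A B :: "'k mat"
        using that True by (intro eq_matI) auto
      \<comment> \<open>For the zero module all matrices are 0 by 0, so identities form an exact
        sequence. Its relation \<open>[M] - [M] + [M]\<close> is \<open>[M]\<close> itself, and
        additivity forces all ranks to be 0.\<close>
      have "split_exact M M M (1\<^sub>m (fst M)) (1\<^sub>m (fst M)) (1\<^sub>m (fst M)) (1\<^sub>m (fst M))"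
        unfolding split_exact_def using M mod_hom_id[OF M]
        by (intro conjI) (auto intro!: z)
      note se = this
      have "phi j M = 0" if "j \<le> l" for j using phi_exact[OF that se] by simp
      then have "vfrag (\<lambda>j. phi j M) = vfrag (\<lambda>j. 0)" by (rule vfrag_cong)
      also have "\<dots> = 0" by (simp add: vfrag_def)
      finally show ?thesis using rels_exact[OF se] by simp
    next
      case False
      then obtain W where W: "inv_subspace H M W" "W \<noteq> {0\<^sub>v (fst M)}" "W \<noteq> carrier_vec (fst M)"
        using nsimple M unfolding simple_mod_def by blast
      obtain U Q f g f' g' where se: "split_exact U M Q f g f' g'" and WU: "W = {f *\<^sub>v v | v. v \<in> carrier_vec (fst U)}"
        by (rule inv_subspace_split[OF M W(1)])
      have dim: "fst M = fst U + fst Q" by (rule split_exact_dim[OF se])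
      have UQ: "is_module H U" "is_module H Q" and fc: "f \<in> carrier_mat (fst M) (fst U)" and gc: "g \<in> carrier_mat (fst Q) (fst M)"
        and f'c: "f' \<in> carrier_mat (fst U) (fst M)" and g'c: "g' \<in> carrier_mat (fst M) (fst Q)" 
        and one: "f * f' + g' * g = 1\<^sub>m (fst M)"
        using se hom_carrier by (auto simp: split_exact_def)
      have "fst U \<noteq> 0"
      proof
        assume U0: "fst U = 0"
        have "f *\<^sub>v v = 0\<^sub>v (fst M)" if "v \<in> carrier_vec (fst U)" for v
          using fc that U0 by (intro eq_vecI) (auto simp: scalar_prod_def)
        then have "W \<subseteq> {0\<^sub>v (fst M)}" unfolding WU by auto
        then show False using W(1,2) by (auto simp: inv_subspace_def)
      qed
      moreover have "fst Q \<noteq> 0"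
      proof
        assume Q0: "fst Q = 0"
        have "g' * g = 0\<^sub>m (fst M) (fst M)" using g'c gc Q0 by (intro eq_matI) (auto simp: scalar_prod_def)
        then have ff: "f * f' = 1\<^sub>m (fst M)" using one fc f'c by auto
        have "x \<in> W" if x: "x \<in> carrier_vec (fst M)" for x
        proof -
          have "x = f *\<^sub>v (f' *\<^sub>v x)" using assoc_mult_mat_vec[OF fc f'c x] ff x by simp
          then show ?thesis unfolding WU using f'c x by auto
        qed
        then show False using W(1,3) by (auto simp: inv_subspace_def)
      qed
      ultimately have lt: "fst U < fst M" "fst Q < fst M" using dim by auto
      have "vfrag (\<lambda>j. phi j M) = vfrag (\<lambda>j. phi j U + phi j Q)"
        by (rule vfrag_cong) (rule phi_exact[OF _ se])
      then have eq: "frag_of (iso_class H M) - vfrag (\<lambda>j. phi j M) =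
        (frag_of (iso_class H U) - vfrag (\<lambda>j. phi j U)) + (frag_of (iso_class H Q) - vfrag (\<lambda>j. phi j Q))
        - (frag_of (iso_class H U) - frag_of (iso_class H M) + frag_of (iso_class H Q))"
        by (simp add: vfrag_add)
      show ?thesis unfolding eq
        by (rule rels_diff[OF rels_add[OF less.hyps[OF lt(1) UQ(1)] less.hyps[OF lt(2) UQ(2)]] rels_exact[OF se]])
    qed
  qed
qed

lemma mlt_rels: "j \<le> l \<Longrightarrow> x \<in> G0_rels H \<Longrightarrow> mlt j x = 0"
  unfolding mlt_def using wsum_rels_zero[OF additive_phi] by blast

lemma keys_mod_classes: "is_module H M \<Longrightarrow> iso_class H M \<in> mod_classes H"
  unfolding mod_classes_def by blast

lemma mlt_frag_of: "j \<le> l \<Longrightarrow> is_module H M \<Longrightarrow> mlt j (frag_of (iso_class H M)) = phi j M"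
  by (simp add: mlt_def additive_fun_class[OF additive_phi])

lemma mlt_vfrag: "i \<le> l \<Longrightarrow> mlt i (vfrag v) = v i"
proof -
  assume i: "i \<le> l"
  have "mlt i (vfrag v) = (\<Sum>j\<le>l. v j * mlt i (frag_of (iso_class H (Sr j))))"
    unfolding mlt_def vfrag_def wsum_sum wsum_cmul ..
  also have "\<dots> = (\<Sum>j\<le>l. if i = j then v j else 0)"
    using i by (intro sum.cong refl) (auto simp: mlt_frag_of Sr_module, auto simp: phi_def dual)
  also have "\<dots> = v i" using i by (simp add: sum.delta')
  finally show ?thesis .
qed

lemma vfrag_keys: "Poly_Mapping.keys (vfrag v) \<subseteq> mod_classes H"
proof -
  have "vfrag v \<in> carrier (free_Abelian_group (mod_classes H))"
    unfolding vfrag_def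
  proof (rule sum_closed_free_Abelian_group)
    fix j assume "j \<in> {..l}"
    then have "iso_class H (Sr j) \<in> mod_classes H" using keys_mod_classes Sr_module by simp
    then show "frag_cmul (v j) (frag_of (iso_class H (Sr j))) \<in> carrier (free_Abelian_group (mod_classes H))"
      using keys_cmul[of "v j" "frag_of (iso_class H (Sr j))"] by (auto simp: keys_frag_of)
  qed
  then show ?thesis by simp
qed

lemma frag_class:
  assumes "Poly_Mapping.keys x \<subseteq> mod_classes H"
  shows "x - vfrag (\<lambda>j. mlt j x) \<in> G0_rels H"
proof (rule free_Abelian_group_induct[OF assms, where P = "\<lambda>x. x - vfrag (\<lambda>j. mlt j x) \<in> G0_rels H"])
  show "0 - vfrag (\<lambda>j. mlt j 0) \<in> G0_rels H" by (simp add: mlt_def vfrag_def rels_zero)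
next
  fix x y assume xy: "x - vfrag (\<lambda>j. mlt j x) \<in> G0_rels H" "y - vfrag (\<lambda>j. mlt j y) \<in> G0_rels H"
  have "vfrag (\<lambda>j. mlt j (x - y)) + vfrag (\<lambda>j. mlt j y) = vfrag (\<lambda>j. mlt j x)"
    unfolding vfrag_add[symmetric] by (simp add: mlt_def)
  then have eq: "x - y - vfrag (\<lambda>j. mlt j (x - y)) = (x - vfrag (\<lambda>j. mlt j x)) - (y - vfrag (\<lambda>j. mlt j y))"
    by (simp add: algebra_simps)
  show "x - y - vfrag (\<lambda>j. mlt j (x - y)) \<in> G0_rels H" unfolding eq by (rule rels_diff[OF xy])
next
  fix C assume "C \<in> mod_classes H"
  then obtain M where M: "is_module H M" "C = iso_class H M" by (auto simp: mod_classes_def)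
  have "vfrag (\<lambda>j. mlt j (frag_of C)) = vfrag (\<lambda>j. phi j M)"
    unfolding M(2) using M(1) by (intro vfrag_cong) (simp add: mlt_frag_of)
  then show "frag_of C - vfrag (\<lambda>j. mlt j (frag_of C)) \<in> G0_rels H"
    using composition_class[OF M(1)] M(2) by simp
qed

text \<open>The relations are exactly the common kernel of the coordinates: additive functions
  vanish on relations, and an element with zero coordinates is congruent to the zero combination of
  simple classes.\<close>

lemma rels_iff:
  assumes "Poly_Mapping.keys x \<subseteq> mod_classes H"
  shows "x \<in> G0_rels H \<longleftrightarrow> (\<forall>j\<le>l. mlt j x = 0)"
proof
  assume "\<forall>j\<le>l. mlt j x = 0"
  then have "vfrag (\<lambda>j. mlt j x) = 0" by (simp add: vfrag_def)
  then show "x \<in> G0_rels H" using frag_class[OF assms] by simp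
qed (use mlt_rels in blast)

text \<open>The class in \<open>G\<^sub>0(A)\<close> with coordinates \<open>v\<close> in the basis of simple modules.\<close>
definition K :: "(nat \<Rightarrow> int) \<Rightarrow> ('k rep set \<Rightarrow>\<^sub>0 int) set" where
  "K v = {y. Poly_Mapping.keys y \<subseteq> mod_classes H \<and> (\<forall>j\<le>l. mlt j y = v j)}"

lemma coset_eq_K:
  assumes "Poly_Mapping.keys x \<subseteq> mod_classes H"
  shows "r_coset (G0_free H) (G0_rels H) x = K (\<lambda>j. mlt j x)"
proof
  show "r_coset (G0_free H) (G0_rels H) x \<subseteq> K (\<lambda>j. mlt j x)"
  proof
    fix y assume "y \<in> r_coset (G0_free H) (G0_rels H) x"
    then obtain r where r: "r \<in> G0_rels H" "y = r + x" by (auto simp: r_coset_def G0_free_def)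
    have "mlt j y = mlt j x" if "j \<le> l" for j using mlt_rels[OF that r(1)] r(2) by (simp add: mlt_def)
    moreover have "Poly_Mapping.keys y \<subseteq> mod_classes H"
      using keys_add[of r x] rels_keys[OF r(1)] assms r(2) by auto
    ultimately show "y \<in> K (\<lambda>j. mlt j x)" by (simp add: K_def)
  qed
  show "K (\<lambda>j. mlt j x) \<subseteq> r_coset (G0_free H) (G0_rels H) x"
  proof
    fix y assume "y \<in> K (\<lambda>j. mlt j x)"
    then have y: "Poly_Mapping.keys y \<subseteq> mod_classes H" "\<forall>j\<le>l. mlt j y = mlt j x" by (auto simp: K_def)
    have "Poly_Mapping.keys (y - x) \<subseteq> mod_classes H" using keys_diff[of y x] y assms by auto
    then have "y - x \<in> G0_rels H" using rels_iff y(2) by (simp add: mlt_def)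
    then show "y \<in> r_coset (G0_free H) (G0_rels H) x"
      unfolding r_coset_def by (auto simp: G0_free_def intro!: bexI[of _ "y - x"])
  qed
qed

lemma K_cong: "(\<And>j. j \<le> l \<Longrightarrow> v j = w j) \<Longrightarrow> K v = K w"
  by (auto simp: K_def)

lemma vfrag_in_K: "vfrag v \<in> K v"
  by (simp add: K_def vfrag_keys mlt_vfrag)

lemma K_eq_coset: "K v = r_coset (G0_free H) (G0_rels H) (vfrag v)"
  unfolding coset_eq_K[OF vfrag_keys] by (rule K_cong) (simp add: mlt_vfrag)

lemma K_eq_iff: "K v = K w \<longleftrightarrow> (\<forall>j\<le>l. v j = w j)"
proof
  assume "K v = K w"
  then have "vfrag v \<in> K w" using vfrag_in_K[of v] by simp
  then show "\<forall>j\<le>l. v j = w j" by (simp add: K_def mlt_vfrag)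
next
  assume "\<forall>j\<le>l. v j = w j"
  then show "K v = K w" by (intro K_cong) simp
qed

lemma some_in_K: "(SOME x. x \<in> K v) \<in> K v"
  by (rule someI[of _ "vfrag v"]) (rule vfrag_in_K)

section \<open>The group structure and augmentation of G_0(A) in the basis of simple modules\<close>

lemma rels_normal: "normal (G0_rels H) (G0_free H)"
proof -
  interpret comm_group "G0_free H" unfolding G0_free_def by (rule abelian_free_Abelian_group)
  show ?thesis by (rule subgroup_imp_normal[OF rels_subgroup])
qed

lemma group_G0: "group (G0 H)"
  unfolding G0_def by (rule normal.factorgroup_is_group[OF rels_normal])

lemma carrier_G0: "carrier (G0 H) = range K"
proof
  show "carrier (G0 H) \<subseteq> range K"
    using coset_eq_K by (auto simp: G0_def FactGroup_def RCOSETS_def G0_free_def)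
  show "range K \<subseteq> carrier (G0 H)"
    unfolding G0_def FactGroup_def RCOSETS_def using K_eq_coset vfrag_keys by (fastforce simp: G0_free_def)
qed

lemma mult_G0: "K v \<otimes>\<^bsub>G0 H\<^esub> K w = K (\<lambda>j. v j + w j)"
proof -
  have "K v \<otimes>\<^bsub>G0 H\<^esub> K w = set_mult (G0_free H) (K v) (K w)" by (simp add: G0_def FactGroup_def)
  also have "\<dots> = r_coset (G0_free H) (G0_rels H) (vfrag v + vfrag w)"
    unfolding K_eq_coset using normal.rcos_sum[OF rels_normal] vfrag_keys by (simp add: G0_free_def)
  also have "\<dots> = K (\<lambda>j. v j + w j)"
    unfolding K_eq_coset vfrag_add ..
  finally show ?thesis .
qed

definition sdim :: "nat \<Rightarrow> int" where "sdim j = int (fst (Sr j))"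

text \<open>Dimension is additive, so it does not see the difference between \<open>x\<close> and
  its expansion in simple classes.\<close>

lemma dim_eq_mlt:
  assumes "Poly_Mapping.keys x \<subseteq> mod_classes H"
  shows "wsum (\<lambda>C. int (fst (rep_of C))) x = (\<Sum>j\<le>l. mlt j x * sdim j)"
proof -
  have "wsum (\<lambda>C. int (fst (rep_of C))) (x - vfrag (\<lambda>j. mlt j x)) = 0"
    using wsum_rels_zero[OF additive_dim frag_class[OF assms]] by blast
  then have "wsum (\<lambda>C. int (fst (rep_of C))) x = wsum (\<lambda>C. int (fst (rep_of C))) (vfrag (\<lambda>j. mlt j x))" by simp
  also have "\<dots> = (\<Sum>j\<le>l. mlt j x * sdim j)"
    unfolding vfrag_def wsum_sum using additive_fun_class[OF additive_dim] by (simp add: sdim_def Sr_module)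
  finally show ?thesis .
qed

lemma G0_aug_K: "G0_aug (K v) = (\<Sum>j\<le>l. v j * sdim j)"
proof -
  let ?x = "SOME x. x \<in> K v"
  have x: "Poly_Mapping.keys ?x \<subseteq> mod_classes H" "\<forall>j\<le>l. mlt j ?x = v j" using some_in_K[of v] by (auto simp: K_def)
  have "G0_aug (K v) = wsum (\<lambda>C. int (fst (rep_of C))) ?x"
    by (simp add: G0_aug_def frag_aug_wsum class_dim_def rep_of_def)
  then show ?thesis using dim_eq_mlt[OF x(1)] x(2) by simp
qed

lemma aug_ideal_eq: "aug_ideal H = K ` {v. (\<Sum>j\<le>l. v j * sdim j) = 0}"
  unfolding aug_ideal_def carrier_G0 using G0_aug_K by auto

section \<open>Multiplication by d - [A]\<close>

lemma class_tensor_rep: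
  assumes "C \<in> mod_classes H" "C' \<in> mod_classes H"
  shows "class_tensor H C C' = iso_class H (tensor_mod H (rep_of C) (rep_of C'))"
    "is_module H (tensor_mod H (rep_of C) (rep_of C'))"
  using is_module_tensor rep_of_mod_classes assms by (simp_all add: class_tensor_def rep_of_def)

lemma phi_tensor_trivial: "is_module H X \<Longrightarrow> phi j (tensor_mod H X (trivial_mod H)) = phi j X"
  by (simp add: phi_def act_tensor_trivial)

lemma phi_tensor_reg: "j \<le> l \<Longrightarrow> is_module H X \<Longrightarrow> phi j (tensor_mod H X reg) = int (fst X) * phi j reg"
  by (simp add: phi_def idem_rank_tensor_reg[OF _ idem[OF _ is_module_reg]])

lemma wsum_cong: "(\<And>C. C \<in> Poly_Mapping.keys x \<Longrightarrow> w C = w' C) \<Longrightarrow> wsum w x = wsum w' x"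
  by (simp add: wsum_def)

definition delta0 :: "('k rep set \<Rightarrow>\<^sub>0 int)" where
  "delta0 = frag_cmul (int d) (frag_of (iso_class H (trivial_mod H))) - frag_of (iso_class H reg)"

lemma delta0_keys: "Poly_Mapping.keys delta0 \<subseteq> mod_classes H"
proof -
  have "Poly_Mapping.keys delta0 \<subseteq> {iso_class H (trivial_mod H), iso_class H reg}"
    unfolding delta0_def using keys_diff[of "frag_cmul (int d) (frag_of (iso_class H (trivial_mod H)))" "frag_of (iso_class H reg)"]
      keys_cmul[of "int d" "frag_of (iso_class H (trivial_mod H))"] by (auto simp: keys_frag_of)
  then show ?thesis using keys_mod_classes[OF is_module_trivial] keys_mod_classes[OF is_module_reg] by auto
qed

text \<open>Only exactness in the right argument is needed: the value depends on the left argument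
  through its class alone, because \<open>[V] [A] = dim V [A]\<close>.\<close>
lemma mlt_frag_tensor:
  assumes x: "Poly_Mapping.keys x \<subseteq> mod_classes H" and y: "Poly_Mapping.keys y \<subseteq> mod_classes H"
    and eq: "\<forall>j\<le>l. mlt j y = mlt j delta0" and i: "i \<le> l"
  shows "mlt i (frag_tensor H x y) = int d * mlt i x - (\<Sum>j\<le>l. mlt j x * sdim j) * phi i reg"
proof -
  have "Poly_Mapping.keys (y - delta0) \<subseteq> mod_classes H" using keys_diff[of y delta0] y delta0_keys by auto
  then have rel: "y - delta0 \<in> G0_rels H" using rels_iff eq by (simp add: mlt_def)
  have inner: "wsum (\<lambda>C'. phi i (rep_of (class_tensor H C C'))) y = int d * phi i (rep_of C) - int (fst (rep_of C)) * phi i reg"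
    if C: "C \<in> mod_classes H" for C
  proof -
    let ?X = "rep_of C"
    have X: "is_module H ?X" using rep_of_mod_classes[OF C] by simp
    let ?psi = "\<lambda>M. phi i (tensor_mod H ?X M)"
    \<comment> \<open>Tensoring with a fixed left factor is exact, so this function is additive in
      the right factor and takes the same value on the representative \<open>y\<close> as on
      \<open>delta0\<close>.\<close>
    note add = additive_tensor[OF additive_phi[OF i] X]
    have "wsum (\<lambda>C'. phi i (rep_of (class_tensor H C C'))) y = wsum (\<lambda>C'. ?psi (rep_of C')) y"
    proof (rule wsum_cong)
      fix C' assume "C' \<in> Poly_Mapping.keys y"
      then have C': "C' \<in> mod_classes H" using y by auto
      show "phi i (rep_of (class_tensor H C C')) = ?psi (rep_of C')"
        unfolding class_tensor_rep(1)[OF C C'] by (rule additive_fun_class[OF additive_phi[OF i] class_tensor_rep(2)[OF C C']])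
    qed
    also have "\<dots> = wsum (\<lambda>C'. ?psi (rep_of C')) delta0"
      using wsum_rels_zero[OF add rel] by simp
    also have "\<dots> = int d * ?psi (trivial_mod H) - ?psi reg"
      unfolding delta0_def
      using additive_fun_class[OF add is_module_trivial] additive_fun_class[OF add is_module_reg] by simp
    finally show ?thesis unfolding phi_tensor_trivial[OF X] phi_tensor_reg[OF i X] .
  qed
  have "mlt i (frag_tensor H x y) = wsum (\<lambda>C. int d * phi i (rep_of C) - int (fst (rep_of C)) * phi i reg) x"
    unfolding mlt_def wsum_frag_tensor by (rule wsum_cong) (use inner x in auto)
  also have "\<dots> = int d * mlt i x - wsum (\<lambda>C. int (fst (rep_of C))) x * phi i reg"
    unfolding mlt_def wsum_def by (simp add: right_diff_distrib sum_subtractf sum_distrib_left sum_distrib_right mult_ac)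
  finally show ?thesis unfolding dim_eq_mlt[OF x] .
qed

lemma frag_tensor_keys:
  assumes x: "Poly_Mapping.keys x \<subseteq> mod_classes H" and y: "Poly_Mapping.keys y \<subseteq> mod_classes H"
  shows "Poly_Mapping.keys (frag_tensor H x y) \<subseteq> mod_classes H"
proof -
  have "frag_tensor H x y \<in> carrier (free_Abelian_group (mod_classes H))"
    unfolding frag_tensor_def
  proof (intro sum_closed_free_Abelian_group)
    fix C C' assume "C \<in> Poly_Mapping.keys x" "C' \<in> Poly_Mapping.keys y"
    then have C: "C \<in> mod_classes H" "C' \<in> mod_classes H" using x y by auto
    have "class_tensor H C C' \<in> mod_classes H"
      unfolding class_tensor_rep(1)[OF C] by (rule keys_mod_classes[OF class_tensor_rep(2)[OF C]])
    then show "frag_cmul (poly_mapping.lookup x C * poly_mapping.lookup y C') (frag_of (class_tensor H C C'))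
      \<in> carrier (free_Abelian_group (mod_classes H))"
      using keys_cmul[of "poly_mapping.lookup x C * poly_mapping.lookup y C'" "frag_of (class_tensor H C C')"]
      by (auto simp: keys_frag_of)
  qed
  then show ?thesis by simp
qed

lemma G0_mult_delta0:
  "G0_mult H (K v) (r_coset (G0_free H) (G0_rels H) delta0)
    = K (\<lambda>i. int d * v i - (\<Sum>j\<le>l. v j * sdim j) * phi i reg)"
proof -
  let ?D = "r_coset (G0_free H) (G0_rels H) delta0"
  let ?x = "SOME x. x \<in> K v" and ?y = "SOME y. y \<in> ?D"
  have D: "?D = K (\<lambda>j. mlt j delta0)" by (rule coset_eq_K[OF delta0_keys])
  have x: "Poly_Mapping.keys ?x \<subseteq> mod_classes H" "\<forall>j\<le>l. mlt j ?x = v j" using some_in_K[of v] by (auto simp: K_def)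
  have y: "Poly_Mapping.keys ?y \<subseteq> mod_classes H" "\<forall>j\<le>l. mlt j ?y = mlt j delta0"
    using some_in_K[of "\<lambda>j. mlt j delta0"] unfolding D by (auto simp: K_def)
  have "G0_mult H (K v) ?D = K (\<lambda>j. mlt j (frag_tensor H ?x ?y))"
    unfolding G0_mult_def by (rule coset_eq_K[OF frag_tensor_keys[OF x(1) y(1)]])
  also have "\<dots> = K (\<lambda>i. int d * v i - (\<Sum>j\<le>l. v j * sdim j) * phi i reg)"
    using mlt_frag_tensor[OF x(1) y] x(2) by (intro K_cong) simp
  finally show ?thesis .
qed

text \<open>An indecomposable projective has a simple quotient, and it shares this quotient with the
  chosen cover; hence the dimensions agree. So the numbers \<open>phi j reg\<close> are precisely
  the dimensions whose gcd is taken.\<close>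

lemma projective_dims:
  "(\<forall>P. indecomposable_mod H P \<and> projective_mod H P \<longrightarrow> (\<exists>j\<le>l. phi j reg = int (fst P)))"
  "j \<le> l \<Longrightarrow> \<exists>P. indecomposable_mod H P \<and> projective_mod H P \<and> phi j reg = int (fst P)"
proof -
  show "\<forall>P. indecomposable_mod H P \<and> projective_mod H P \<longrightarrow> (\<exists>j\<le>l. phi j reg = int (fst P))"
  proof (intro allI impI)
    fix P assume P: "indecomposable_mod H P \<and> projective_mod H P"
    then have M: "is_module H P" "0 < fst P" by (auto simp: indecomposable_mod_def)
    obtain S f where S: "simple_mod H S" and f: "mod_hom H P S f" "f \<noteq> 0\<^sub>m (fst S) (fst P)"
      by (rule ex_simple_quotient[OF M])
    have Sm: "is_module H S" using S by (simp add: simple_mod_def)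
    obtain j where j: "j \<le> l" "mod_iso H S (Sr j)" using complete[OF S] by blast
    obtain a b where a: "mod_hom H S (Sr j) a" and b: "b \<in> carrier_mat (fst S) (fst (Sr j))" "b * a = 1\<^sub>m (fst S)"
      using j(2) unfolding mod_iso_def by blast
    have af: "mod_hom H P (Sr j) (a * f)" by (rule mod_hom_comp[OF M(1) Sm Sr_module[OF j(1)] f(1) a])
    have nz: "a * f \<noteq> 0\<^sub>m (fst (Sr j)) (fst P)"
    proof
      assume "a * f = 0\<^sub>m (fst (Sr j)) (fst P)"
      then have "b * (a * f) = 0\<^sub>m (fst S) (fst P)" using b by simp
      then show False using f hom_carrier[OF a] hom_carrier[OF f(1)] b by (simp add: mult_assoc_dim[symmetric])
    qed
    obtain P' f' where P': "indecomposable_mod H P'" "projective_mod H P'" "mod_hom H P' (Sr j) f'"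
      "f' \<noteq> 0\<^sub>m (fst (Sr j)) (fst P')" "idem_rank (act reg (e j)) = fst P'" using cover[OF j(1)] by blast
    have "fst P = fst P'"
      using indecomposable_projective_same_top_dim_le[OF _ _ P'(1,2) simple[OF j(1)] af nz P'(3,4)]
        indecomposable_projective_same_top_dim_le[OF P'(1,2) _ _ simple[OF j(1)] P'(3,4) af nz] P by simp
    then show "\<exists>j\<le>l. phi j reg = int (fst P)" using j(1) P'(5) by (auto simp: phi_def)
  qed
  show "\<exists>P. indecomposable_mod H P \<and> projective_mod H P \<and> phi j reg = int (fst P)" if "j \<le> l"
    using cover[OF that] by (auto simp: phi_def)
qed

text \<open>Phrased through divisors, the form in which \<open>lattice_quotient_iso\<close> takes
  its modulus.\<close>

lemma gcd_projective_dims: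
  "c dvd Gcd {fst P | P. indecomposable_mod H P \<and> projective_mod H P} \<longleftrightarrow> (\<forall>j\<le>l. int c dvd phi j reg)"
proof -
  have "(\<forall>n\<in>{fst P | P. indecomposable_mod H P \<and> projective_mod H P}. c dvd n) \<longleftrightarrow> (\<forall>j\<le>l. int c dvd phi j reg)"
  proof
    assume h: "\<forall>n\<in>{fst P | P. indecomposable_mod H P \<and> projective_mod H P}. c dvd n"
    show "\<forall>j\<le>l. int c dvd phi j reg"
    proof (intro allI impI)
      fix j assume "j \<le> l"
      then obtain P where "indecomposable_mod H P" "projective_mod H P" "phi j reg = int (fst P)"
        using projective_dims(2) by blast
      moreover from this h have "c dvd fst P" by blast
      ultimately show "int c dvd phi j reg" by simp
    qed
  next
    assume h: "\<forall>j\<le>l. int c dvd phi j reg"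
    show "\<forall>n\<in>{fst P | P. indecomposable_mod H P \<and> projective_mod H P}. c dvd n"
    proof
      fix n assume "n \<in> {fst P | P. indecomposable_mod H P \<and> projective_mod H P}"
      then obtain P where P: "n = fst P" "indecomposable_mod H P \<and> projective_mod H P" by blast
      then obtain j where "j \<le> l" "phi j reg = int (fst P)" using projective_dims(1) by blast
      then show "c dvd n" using h P(1) by (metis int_dvd_int_iff)
    qed
  qed
  then show ?thesis by (simp only: dvd_Gcd_iff)
qed

lemma critical_group_iso:
  "group (critical_group H reg)" "critical_group H reg \<cong> product_group {..<l} (\<lambda>i. if i = 0
     then integer_mod_group (Gcd {fst P | P. indecomposable_mod H P \<and> projective_mod H P}) else integer_mod_group d)"
proof -
  have "critical_group H reg = (G0 H)\<lparr>carrier := aug_ideal H\<rparr> Mod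
      {G0_mult H X (r_coset (G0_free H) (G0_rels H) delta0) | X. X \<in> carrier (G0 H)}"
    by (simp add: critical_group_def delta0_def)
  also have "{G0_mult H X (r_coset (G0_free H) (G0_rels H) delta0) | X. X \<in> carrier (G0 H)}
      = range (\<lambda>v. K (\<lambda>i. int d * v i - (\<Sum>j\<le>l. v j * sdim j) * phi i reg))"
    unfolding carrier_G0 using G0_mult_delta0 by auto
  finally have eq: "critical_group H reg = (G0 H)\<lparr>carrier := K ` {v. (\<Sum>j\<le>l. v j * sdim j) = 0}\<rparr> Mod
      range (\<lambda>v. K (\<lambda>i. int d * v i - (\<Sum>j\<le>l. v j * sdim j) * phi i reg))"
    unfolding aug_ideal_eq .
  have s0: "sdim 0 = 1" by (simp add: sdim_def Sr_0)
  \<comment> \<open>The dimension of A, computed from its composition multiplicities.\<close>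
  have sd: "(\<Sum>j\<le>l. phi j reg * sdim j) = int d"
  proof -
    have "wsum (\<lambda>C. int (fst (rep_of C))) (frag_of (iso_class H reg)) = (\<Sum>j\<le>l. mlt j (frag_of (iso_class H reg)) * sdim j)"
      by (rule dim_eq_mlt) (use keys_mod_classes[OF is_module_reg] in \<open>simp add: keys_frag_of\<close>)
    then show ?thesis
      using additive_fun_class[OF additive_dim is_module_reg] by (simp add: mlt_frag_of is_module_reg)
  qed
  note lattice = lattice_quotient_iso[OF group_G0 carrier_G0 mult_G0 K_eq_iff s0 sd gcd_projective_dims]
  show "group (critical_group H reg)" unfolding eq by (rule lattice(1))
  show "critical_group H reg \<cong> product_group {..<l} (\<lambda>i. if i = 0
     then integer_mod_group (Gcd {fst P | P. indecomposable_mod H P \<and> projective_mod H P}) else integer_mod_group d)"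
    unfolding eq by (rule lattice(2))
qed

end

lemma (in hopf_alg) simple_trivial: "simple_mod H (trivial_mod H)"
  unfolding simple_mod_def
proof (intro conjI allI impI)
  fix W assume W: "inv_subspace H (trivial_mod H) W"
  show "W = {0\<^sub>v (fst (trivial_mod H))} \<or> W = carrier_vec (fst (trivial_mod H))"
  proof (cases "W \<subseteq> {0\<^sub>v 1}")
    case True
    then show ?thesis using W by (auto simp: inv_subspace_def)
  next
    case False
    then obtain w where w: "w \<in> W" "w \<noteq> 0\<^sub>v 1" by blast
    have wc: "w \<in> carrier_vec 1" using W w by (auto simp: inv_subspace_def)
    have w0: "w $ 0 \<noteq> 0"
    proof
      assume "w $ 0 = 0"
      then have "w = 0\<^sub>v 1" using wc by (intro eq_vecI) auto
      with w(2) show False ..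
    qed
    have "x \<in> W" if x: "x \<in> carrier_vec 1" for x
    proof -
      have "x = (x $ 0 / w $ 0) \<cdot>\<^sub>v w" using x wc w0 by (intro eq_vecI) auto
      then show ?thesis using W w by (metis inv_subspace_def)
    qed
    then show ?thesis using W by (auto simp: inv_subspace_def)
  qed
qed (simp_all add: is_module_trivial)

theorem theorem1p1:
  fixes H :: "'k::field hopf" and l :: nat
  assumes "alg_closed_field TYPE('k)"
    and "hopf_algebra H"
    and "card {iso_class H M | M. simple_mod H M} = l + 1"
  defines "d \<equiv> hdim H"
    and "\<gamma> \<equiv> Gcd {fst P | P. indecomposable_mod H P \<and> projective_mod H P}"
  shows "(l = 0 \<longrightarrow> trivial_group (critical_group H (regular_mod H))) \<and>
         (l \<noteq> 0 \<longrightarrow> critical_group H (regular_mod H) \<cong>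
            product_group {..<l} (\<lambda>i. if i = 0 then integer_mod_group \<gamma> else integer_mod_group d))"
proof -
  interpret hopf_alg H by unfold_locales fact
  let ?C = "{iso_class H M | M. simple_mod H M}" and ?T = "iso_class H (trivial_mod H)"
  have T: "?T \<in> ?C" by (rule CollectI, rule exI[of _ "trivial_mod H"]) (simp add: simple_trivial)
  \<comment> \<open>An infinite set has \<open>card\<close> 0, so the positive cardinality also
    provides finiteness.\<close>
  have "0 < card ?C" unfolding assms(3) by simp
  then have fin: "finite ?C" by (rule card_ge_0_finite)
  have "card (?C - {?T}) = l" using T fin assms(3) by (simp add: card_Diff_singleton)
  then obtain h where h: "bij_betw h {0..<l} (?C - {?T})"
    using ex_bij_betw_nat_finite[OF finite_Diff[OF fin], of "{?T}"] by auto
  \<comment> \<open>Index 0 is reserved for the trivial module; the remaining \<open>l\<close>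
    classes are enumerated by \<open>h\<close> with indices shifted by one.\<close>
  define Sr where "Sr j = (if j = 0 then trivial_mod H else SOME M. simple_mod H M \<and> iso_class H M = h (j - 1))" for j
  have Sr_Suc: "simple_mod H (Sr (Suc i)) \<and> iso_class H (Sr (Suc i)) = h i" if "i < l" for i
  proof -
    have "h i \<in> ?C" using bij_betwE[OF h] that by auto
    then obtain M where "simple_mod H M" "h i = iso_class H M" by blast
    then have "simple_mod H M \<and> iso_class H M = h i" by simp
    then have "simple_mod H (SOME M. simple_mod H M \<and> iso_class H M = h i) \<and>
      iso_class H (SOME M. simple_mod H M \<and> iso_class H M = h i) = h i" by (rule someI)
    then show ?thesis by (simp add: Sr_def)
  qed
  have Sr_0: "Sr 0 = trivial_mod H" by (simp add: Sr_def)
  have simple: "simple_mod H (Sr j)" if "j \<le> l" for j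
    using that Sr_Suc simple_trivial Sr_0 by (cases j) auto
  have module: "is_module H M" if "simple_mod H M" for M using that by (simp add: simple_mod_def)
  have class_inj: "i = j" if "i \<le> l" "j \<le> l" "iso_class H (Sr i) = iso_class H (Sr j)" for i j
  proof -
    have ne: "h i \<noteq> ?T" if "i < l" for i using bij_betwE[OF h] that by auto
    have inj: "i = j" if "i < l" "j < l" "h i = h j" for i j
      using bij_betw_imp_inj_on[OF h] that by (auto dest: inj_onD)
    have c: "iso_class H (Sr k) = (if k = 0 then ?T else h (k - 1))" if "k \<le> l" for k
      using that Sr_Suc Sr_0 by (cases k) auto
    have eq: "(if i = 0 then ?T else h (i - 1)) = (if j = 0 then ?T else h (j - 1))"
      using that(3) unfolding c[OF that(1)] c[OF that(2)] .
    show ?thesis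
    proof (cases i)
      case 0
      show ?thesis
      proof (cases j)
        case (Suc j')
        then have "h j' = ?T" using eq 0 by (simp only: diff_Suc_1 nat.distinct refl if_True if_False)
        then show ?thesis using ne[of j'] Suc that(2) by (simp only: Suc_le_eq)
      qed (simp add: 0)
    next
      case i: (Suc i')
      show ?thesis
      proof (cases j)
        case 0
        then have "h i' = ?T" using eq i by (simp only: diff_Suc_1 nat.distinct refl if_True if_False)
        then show ?thesis using ne[of i'] i that(1) by (simp only: Suc_le_eq)
      next
        case (Suc j')
        then have "h i' = h j'" using eq i by (simp only: diff_Suc_1 nat.distinct if_False)
        then show ?thesis using inj[of i' j'] i Suc that(1,2) by (simp only: Suc_le_eq)
      qed
    qed
  qed
  have complete: "\<exists>j\<le>l. mod_iso H S (Sr j)" if S: "simple_mod H S" for S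
  proof -
    have "\<exists>j\<le>l. iso_class H S = iso_class H (Sr j)"
    proof (cases "iso_class H S = ?T")
      case True
      then show ?thesis using Sr_0 by auto
    next
      case False
      have "iso_class H S \<in> ?C" using S by (intro CollectI exI[of _ S]) simp
      with False have "iso_class H S \<in> h ` {0..<l}" using bij_betw_imp_surj_on[OF h] by simp
      then obtain i where "i < l" "iso_class H S = h i" by auto
      then show ?thesis using Sr_Suc[of i] by (intro exI[of _ "Suc i"]) simp
    qed
    then show ?thesis using iso_class_eqD module S simple by blast
  qed
  \<comment> \<open>The properties of the idempotent in one predicate, with the projective cover
    under an existential quantifier, so that a single choice of \<open>e\<close> for each
    \<open>j\<close> suffices.\<close>
  define Q where "Q j e \<longleftrightarrow> (\<forall>M. is_module H M \<longrightarrow> act M e * act M e = act M e) \<and>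
    idem_rank (act (Sr j) e) = 1 \<and>
    (\<forall>S'. simple_mod H S' \<longrightarrow> \<not> mod_iso H (Sr j) S' \<longrightarrow> act S' e = 0\<^sub>m (fst S') (fst S')) \<and>
    (\<exists>P f. indecomposable_mod H P \<and> projective_mod H P \<and> mod_hom H P (Sr j) f \<and>
      f \<noteq> 0\<^sub>m (fst (Sr j)) (fst P) \<and> idem_rank (act reg e) = fst P)" for j e
  have "\<exists>e. Q j e" if j: "j \<le> l" for j
  proof -
    obtain e P where "\<And>M. is_module H M \<Longrightarrow> act M e * act M e = act M e" "idem_rank (act (Sr j) e) = 1"
      "\<And>S'. simple_mod H S' \<Longrightarrow> \<not> mod_iso H (Sr j) S' \<Longrightarrow> act S' e = 0\<^sub>m (fst S') (fst S')"
      "indecomposable_mod H P" "projective_mod H P" "idem_rank (act reg e) = fst P"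
      "\<exists>f. mod_hom H P (Sr j) f \<and> f \<noteq> 0\<^sub>m (fst (Sr j)) (fst P)"
      by (rule simple_idempotent[OF assms(1) simple[OF j]]) blast
    then have "Q j e" unfolding Q_def by blast
    then show ?thesis by blast
  qed
  then obtain e where e: "\<And>j. j \<le> l \<Longrightarrow> Q j (e j)" by metis
  interpret hopf_simples H l Sr e
  proof unfold_locales
    show "simple_mod H (Sr j)" if "j \<le> l" for j by (rule simple[OF that])
    show "\<exists>j\<le>l. mod_iso H S (Sr j)" if "simple_mod H S" for S by (rule complete[OF that])
    show "Sr 0 = trivial_mod H" by (rule Sr_0)
    show "act M (e j) * act M (e j) = act M (e j)" if "j \<le> l" "is_module H M" for j M
      using e[OF that(1)] that(2) unfolding Q_def by blast
    show "idem_rank (act (Sr j) (e i)) = (if i = j then 1 else 0)" if ij: "i \<le> l" "j \<le> l" for i j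
    proof (cases "i = j")
      case True
      then show ?thesis using e[OF ij(1)] unfolding Q_def by simp
    next
      case False
      have "\<not> mod_iso H (Sr i) (Sr j)"
        using class_inj[OF ij] iso_class_eq[OF module[OF simple[OF ij(1)]] module[OF simple[OF ij(2)]]] False by blast
      then have "act (Sr j) (e i) = 0\<^sub>m (fst (Sr j)) (fst (Sr j))"
        using e[OF ij(1)] simple[OF ij(2)] unfolding Q_def by blast
      then show ?thesis using False by simp
    qed
    show "\<exists>P f. indecomposable_mod H P \<and> projective_mod H P \<and> mod_hom H P (Sr j) f \<and>
      f \<noteq> 0\<^sub>m (fst (Sr j)) (fst P) \<and> idem_rank (act reg (e j)) = fst P" if "j \<le> l" for j
      using e[OF that] unfolding Q_def by blast
  qed
  note iso = critical_group_iso(2)[folded \<gamma>_def d_def]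
  have "trivial_group (critical_group H (regular_mod H))" if "l = 0"
  proof -
    \<comment> \<open>For \<open>l = 0\<close> the index set is empty, so the product is trivial and
      the modulus \<open>\<gamma>\<close> does not occur in it.\<close>
    have "trivial_group (product_group {..<l} (\<lambda>i. if i = 0 then integer_mod_group \<gamma> else integer_mod_group d))"
      by (simp add: trivial_product_group that)
    then show ?thesis
      using isomorphic_group_triviality1[OF group.iso_sym[OF critical_group_iso(1) iso] critical_group_iso(1)] by blast
  qed
  with iso show ?thesis by blast
qed

end
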